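(* Let $\tilde C_2=\sqrt{2/\sqrt{3}}$. For every positive integer $r$ there is a constant $C_r$ such that the following holds for every matrix $A\in\mathcal{A}$ with $\rho_A=0$ and the associated sub-Riemannian metric on the $3$-dimensional compact Heisenberg manifold $\Gamma_r\backslash H_1$. (1) If $r\le 4\pi/\tilde C_2^2$, then $sys(\Gamma_r\backslash H_1,dist_A)=s_1(r,A)$ and $$sys(\Gamma_r\backslash H_1,dist_A)\le C_r\left|\int_{\Gamma_r\backslash H_1}v(\mathfrak{v}_0,A)\right|^{\frac14}.$$ Moreover, equality holds if and only if the quotient flat metric on the base torus satisfies the equality in the systolic inequality of flat $2$-tori, i.e. $s_1(r,A)=\tilde C_2\,(r|\det\tilde A|^{-1})^{1/2}$. (2) If $r\ge 4\pi/\tilde C_2^2$, then $$sys(\Gamma_r\backslash H_1,dist_A)\le C_r\left|\int_{\Gamma_r\backslash H_1}v(\mathfrak{v}_0,A)\right|^{\frac14}.$$ Moreover, equality holds if and only if $s_1(r,A)\ge s_2(A)$.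
   Context: $H_1$ is the simply connected $3$-dimensional Heisenberg Lie group with Lie algebra $\mathfrak{h}_1$ having a basis $X_1,X_2,Z$ with $[X_1,X_2]=Z$ and $Z$ central; $\mathfrak{v}_0=\mathrm{Span}\{X_1,X_2\}$. For a positive integer $r$, $\Gamma_r<H_1$ is the lattice generated by $\exp(rX_1),\exp(X_2),\exp(Z)$. $\mathcal{A}$ is the set of matrices $A=\begin{pmatrix}\tilde A&0\\0&\rho_A\end{pmatrix}$ with $\tilde A\in GL_2(\mathbb{R})$, $\rho_A\in\mathbb{R}$, viewed as endomorphisms of $\mathfrak{h}_1$ in the basis $X_1,X_2,Z$. For $\rho_A=0$, let $\langle\cdot,\cdot\rangle_A$ (with norm $\|\cdot\|_A$) be the inner product on $\mathfrak{v}_0$ with orthonormal basis $AX_1,AX_2$. The left invariant sub-Riemannian structure $(\mathfrak{v}_0,\langle\cdot,\cdot\rangle_A)$ on $H_1$ defines a left invariant distance $\widetilde{dist}_A$: the infimum of lengths of absolutely continuous paths tangent a.e. to the left translates of $\mathfrak{v}_0$. $dist_A$ denotes the quotient distance on $\Gamma_r\backslash H_1$. Popp's volume: $v(\mathfrak{v}_0,A)=\delta(A)^{-1}(\det\tilde A)^{-1}X_1^*\wedge X_2^*\wedge Z^*$ (left invariant form, descended to the quotient), where $\delta(A)=\|{}^t\tilde A J_1\tilde A\|_{HS}$ is the Hilbert--Schmidt norm, $J_1=\begin{pmatrix}0&1\\-1&0\end{pmatrix}$, and $X_1^*,X_2^*,Z^*$ is the dual basis. Systole: $sys(X,dist)=\inf\{length(c)\mid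 [c]\in H_1(X,\mathbb{Z})\setminus\{0\}\}$, the infimum being over closed curves $c$ in $X$. Let $P_0:H_1\to\mathfrak{v}_0$ be the logarithm followed by the projection along $Z$, so $P_0(\Gamma_r)=\mathbb{Z}rX_1+\mathbb{Z}X_2$. The quotient flat metric on the base torus $P_0(\Gamma_r)\backslash\mathfrak{v}_0$ is the one induced by $\langle\cdot,\cdot\rangle_A$; its area is $r|\det\tilde A|^{-1}$. Set $s_1(r,A)=\min\{\|X\|_A\mid X\in P_0(\Gamma_r)\setminus\{0\}\}$ (the systole of the base torus) and $s_2(A)=\min\{\widetilde{dist}_A(e,\exp(pZ))\mid p\in\mathbb{Z}\setminus\{0\}\}$. The systolic inequality of flat $2$-tori with optimal constant reads $s_1(r,A)\le\tilde C_2\,(r|\det\tilde A|^{-1})^{1/2}$. *)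

theory Defs
  imports "HOL-Analysis.Analysis" "HOL-Homology.Homology"
begin

section \<open>The Heisenberg group and its lattices\<close>

text \<open>Vectors of the Lie algebra are their coordinates in the basis \<open>X1, X2, Z\<close>. The group
  is realised on the same space in exponential coordinates of the first kind, so that
  \<open>hexp\<close> and \<open>hlog\<close> are the identity and the product is given by the
  Baker-Campbell-Hausdorff formula, which stops after the first bracket because the algebra is
  2-step nilpotent.\<close>

definition X1 :: "real^3" where "X1 = axis 1 1"
definition X2 :: "real^3" where "X2 = axis 2 1"
definition Z :: "real^3" where "Z = axis 3 1"

definition lie_bracket :: "real^3 \<Rightarrow> real^3 \<Rightarrow> real^3" where
  "lie_bracket u v = (u$1 * v$2 - u$2 * v$1) *\<^sub>R Z"

definition v0 :: "(real^3) set" where "v0 = span {X1, X2}"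

definition hexp :: "real^3 \<Rightarrow> real^3" where "hexp u = u"
definition hlog :: "real^3 \<Rightarrow> real^3" where "hlog p = p"

definition hmul :: "real^3 \<Rightarrow> real^3 \<Rightarrow> real^3" where
  "hmul p q = hexp (hlog p + hlog q + (1/2) *\<^sub>R lie_bracket (hlog p) (hlog q))"

definition heis :: "(real^3) monoid" where
  "heis = \<lparr>carrier = UNIV, mult = hmul, one = hexp 0\<rparr>"

definition Gamma_r :: "nat \<Rightarrow> (real^3) set" where
  "Gamma_r r = generate heis {hexp (real r *\<^sub>R X1), hexp X2, hexp Z}"

text \<open>Points of the quotient by the lattice acting from the left are the cosets
  \<open>Gamma_r r #>\<^bsub>heis\<^esub> p\<close>; the space carries the quotient topology.\<close>

definition heis_manifold :: "nat \<Rightarrow> (real^3) set topology" where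
  "heis_manifold r = topology (\<lambda>U. U \<subseteq> rcosets\<^bsub>heis\<^esub> (Gamma_r r)
     \<and> open {p. Gamma_r r #>\<^bsub>heis\<^esub> p \<in> U})"

definition P0 :: "real^3 \<Rightarrow> real^3" where
  "P0 p = (hlog p $ 1) *\<^sub>R X1 + (hlog p $ 2) *\<^sub>R X2"

text \<open>The differential at \<open>p\<close> of the left translation taking \<open>p\<close> to
  the identity (the left Maurer-Cartan form); the inverse of \<open>p\<close> is \<open>- p\<close>.
  A tangent vector \<open>w\<close> at \<open>p\<close> lies in the left translate of a subspace of the
  Lie algebra iff \<open>mc p w\<close> lies in that subspace.\<close>

definition mc :: "real^3 \<Rightarrow> real^3 \<Rightarrow> real^3" where
  "mc p w = frechet_derivative (hmul (- p)) (at p) w"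


section \<open>Left invariant sub-Riemannian metrics\<close>

definition block_mat :: "real^2^2 \<Rightarrow> real \<Rightarrow> real^3^3" where
  "block_mat B \<rho> = vector [vector [B$1$1, B$1$2, 0], vector [B$2$1, B$2$2, 0], vector [0, 0, \<rho>]]"

definition calA :: "(real^3^3) set" where
  "calA = {block_mat B \<rho> | B \<rho>. invertible B}"

definition tilde :: "real^3^3 \<Rightarrow> real^2^2" where
  "tilde A = vector [vector [A$1$1, A$1$2], vector [A$2$1, A$2$2]]"

definition rho :: "real^3^3 \<Rightarrow> real" where
  "rho A = A$3$3"

text \<open>The columns of \<open>tilde A\<close> are the coordinates of \<open>A X1\<close>, \<open>A X2\<close>
  in the basis \<open>X1, X2\<close>, hence multiplication with its inverse gives the coordinates
  with respect to \<open>A X1, A X2\<close>. The form is meant for arguments in \<open>v0\<close>.\<close>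

definition sr_coords :: "real^3^3 \<Rightarrow> real^3 \<Rightarrow> real^2" where
  "sr_coords A u = matrix_inv (tilde A) *v vector [u$1, u$2]"

definition sr_inner :: "real^3^3 \<Rightarrow> real^3 \<Rightarrow> real^3 \<Rightarrow> real" where
  "sr_inner A u v = sr_coords A u \<bullet> sr_coords A v"

definition sr_norm :: "real^3^3 \<Rightarrow> real^3 \<Rightarrow> real" where
  "sr_norm A u = sqrt (sr_inner A u u)"

definition abs_continuous_on_Icc :: "real \<Rightarrow> real \<Rightarrow> (real \<Rightarrow> 'a::metric_space) \<Rightarrow> bool" where
  "abs_continuous_on_Icc a b c \<longleftrightarrow> (\<forall>e>0. \<exists>d>0. \<forall>(n::nat) s t.
     (\<forall>i<n. a \<le> s i \<and> s i \<le> t i \<and> t i \<le> b) \<and>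
     (\<forall>i<n. \<forall>j<n. i \<noteq> j \<longrightarrow> {s i<..<t i} \<inter> {s j<..<t j} = {}) \<and>
     (\<Sum>i<n. t i - s i) < d \<longrightarrow> (\<Sum>i<n. dist (c (s i)) (c (t i))) < e)"

definition horizontal_path :: "(real \<Rightarrow> real^3) \<Rightarrow> bool" where
  "horizontal_path c \<longleftrightarrow> abs_continuous_on_Icc 0 1 c \<and>
     (AE t in lebesgue. t \<in> {0..1} \<longrightarrow>
        (\<exists>w. (c has_vector_derivative w) (at t within {0..1}) \<and> mc (c t) w \<in> v0))"

definition sr_length :: "real^3^3 \<Rightarrow> (real \<Rightarrow> real^3) \<Rightarrow> real" where
  "sr_length A c = (LINT t:{0..1}|lebesgue.
     sr_norm A (mc (c t) (vector_derivative c (at t within {0..1}))))"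

definition sr_dist :: "real^3^3 \<Rightarrow> real^3 \<Rightarrow> real^3 \<Rightarrow> real" where
  "sr_dist A p q = Inf {sr_length A c | c. horizontal_path c \<and> c 0 = p \<and> c 1 = q}"

definition quot_dist :: "real^3^3 \<Rightarrow> (real^3) set \<Rightarrow> (real^3) set \<Rightarrow> real" where
  "quot_dist A S T = Inf {sr_dist A p q | p q. p \<in> S \<and> q \<in> T}"


section \<open>Systoles\<close>

definition curve_length :: "('a \<Rightarrow> 'a \<Rightarrow> real) \<Rightarrow> (real \<Rightarrow> 'a) \<Rightarrow> ereal" where
  "curve_length d c = Sup {ereal (\<Sum>i<n. d (c (t i)) (c (t (Suc i)))) | (n::nat) t.
     t 0 = 0 \<and> t n = 1 \<and> (\<forall>i<n. t i \<le> t (Suc i))}"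

definition closed_curve :: "'a topology \<Rightarrow> (real \<Rightarrow> 'a) \<Rightarrow> bool" where
  "closed_curve X c \<longleftrightarrow> pathin X c \<and> c 0 = c 1"

text \<open>The standard 1-simplex is parametrised by its second barycentric coordinate.\<close>

definition homology_class :: "'a topology \<Rightarrow> (real \<Rightarrow> 'a) \<Rightarrow> 'a chain set" where
  "homology_class X c = homologous_rel_set 1 X {}
     (frag_of (restrict (\<lambda>x. c (x 1)) (standard_simplex 1)))"

definition systole :: "'a topology \<Rightarrow> ('a \<Rightarrow> 'a \<Rightarrow> real) \<Rightarrow> ereal" where
  "systole X d = Inf {curve_length d c | c.
     closed_curve X c \<and> homology_class X c \<noteq> \<one>\<^bsub>homology_group 1 X\<^esub>}"

definition sys :: "nat \<Rightarrow> real^3^3 \<Rightarrow> ereal" where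
  "sys r A = systole (heis_manifold r) (quot_dist A)"

definition s1 :: "nat \<Rightarrow> real^3^3 \<Rightarrow> real" where
  "s1 r A = (LEAST l. l \<in> sr_norm A ` (P0 ` Gamma_r r - {0}))"

definition s2 :: "real^3^3 \<Rightarrow> real" where
  "s2 A = (LEAST l. l \<in> (\<lambda>p::int. sr_dist A (hexp 0) (hexp (of_int p *\<^sub>R Z))) ` (- {0}))"

definition C2 :: real where "C2 = sqrt (2 / sqrt 3)"


section \<open>Popp's volume\<close>

definition J1 :: "real^2^2" where "J1 = vector [vector [0, 1], vector [-1, 0]]"

text \<open>The norm of the type \<open>real^2^2\<close> is the Hilbert-Schmidt norm.\<close>

definition delta :: "real^3^3 \<Rightarrow> real" where
  "delta A = norm (transpose (tilde A) ** J1 ** tilde A)"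

text \<open>A differential 3-form takes a point and three tangent vectors. The value of the wedge
  product of the dual basis at three vectors of the Lie algebra is the determinant of their
  coordinates.\<close>

definition popp :: "real^3^3 \<Rightarrow> real^3 \<Rightarrow> real^3 \<Rightarrow> real^3 \<Rightarrow> real^3 \<Rightarrow> real" where
  "popp A p u v w = inverse (delta A) * inverse (det (tilde A)) *
     det (vector [mc p u, mc p v, mc p w] :: real^3^3)"

definition fundamental_domain :: "(real^3) set \<Rightarrow> (real^3) set \<Rightarrow> bool" where
  "fundamental_domain G F \<longleftrightarrow> F \<in> sets borel \<and> (\<forall>p. \<exists>!g. g \<in> G \<and> hmul g p \<in> F)"

text \<open>The integral over the quotient of (the form induced by) a left invariant 3-form is the
  integral of the form over a Borel fundamental domain; it does not depend on the choice of the
  domain. The last three arguments of \<open>\<omega>\<close> are the coordinate vector fields.\<close>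

definition quot_integral ::
  "nat \<Rightarrow> (real^3 \<Rightarrow> real^3 \<Rightarrow> real^3 \<Rightarrow> real^3 \<Rightarrow> real) \<Rightarrow> real" where
  "quot_integral r \<omega> = (LINT p:(SOME F. fundamental_domain (Gamma_r r) F)|lborel.
     \<omega> p (axis 1 1) (axis 2 1) (axis 3 1))"


section \<open>Basic facts\<close>

lemma hmul_eq: "hmul p q = p + q + (1/2) *\<^sub>R lie_bracket p q"
  by (simp add: hmul_def hexp_def hlog_def)

lemma lie_bracket_nth [simp]:
  "lie_bracket u v $ 1 = 0" "lie_bracket u v $ 2 = 0"
  "lie_bracket u v $ 3 = u$1 * v$2 - u$2 * v$1"
  by (simp_all add: lie_bracket_def Z_def axis_def)

lemma lie_bracket_X1_X2: "lie_bracket X1 X2 = Z"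
  by (simp add: lie_bracket_def X1_def X2_def axis_def)

lemma group_heis: "group heis"
proof (rule groupI)
  fix p q u :: "real^3"
  show "p \<otimes>\<^bsub>heis\<^esub> q \<otimes>\<^bsub>heis\<^esub> u = p \<otimes>\<^bsub>heis\<^esub> (q \<otimes>\<^bsub>heis\<^esub> u)"
    by (simp add: heis_def hmul_eq vec_eq_iff forall_3) (simp add: field_simps)
  show "\<exists>q\<in>carrier heis. q \<otimes>\<^bsub>heis\<^esub> p = \<one>\<^bsub>heis\<^esub>"
    by (rule bexI[of _ "- p"]) (simp_all add: heis_def hmul_eq hexp_def lie_bracket_def)
qed (simp_all add: heis_def hmul_eq hexp_def lie_bracket_def)

lemma inv_heis: "inv\<^bsub>heis\<^esub> p = - p"
  by (rule group.inv_equality[OF group_heis])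
     (simp_all add: heis_def hmul_eq hexp_def lie_bracket_def)

lemma subgroup_Gamma_r: "subgroup (Gamma_r r) heis"
  unfolding Gamma_r_def
  by (rule group.generate_is_subgroup[OF group_heis]) (simp add: heis_def)

lemma mc_eq: "mc p w = w - (1/2) *\<^sub>R lie_bracket p w"
proof -
  have "linear (\<lambda>w. w + (1/2) *\<^sub>R lie_bracket (- p) w)"
    by (rule linearI) (simp_all add: lie_bracket_def algebra_simps)
  then have "((\<lambda>w. w + (1/2) *\<^sub>R lie_bracket (- p) w) has_derivative
      (\<lambda>w. w + (1/2) *\<^sub>R lie_bracket (- p) w)) (at p)"
    by (rule linear_imp_has_derivative)
  from has_derivative_add[OF has_derivative_const[of "- p"] this]
  have "(hmul (- p) has_derivative (\<lambda>w. w + (1/2) *\<^sub>R lie_bracket (- p) w)) (at p)"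
    by (simp add: hmul_eq[abs_def] add.assoc)
  then have "frechet_derivative (hmul (- p)) (at p) = (\<lambda>w. w + (1/2) *\<^sub>R lie_bracket (- p) w)"
    by (rule frechet_derivative_at[symmetric])
  then show ?thesis
    by (simp add: mc_def lie_bracket_def field_simps)
qed

lemma openin_heis_manifold:
  "openin (heis_manifold r) U \<longleftrightarrow> U \<subseteq> rcosets\<^bsub>heis\<^esub> (Gamma_r r)
     \<and> open {p. Gamma_r r #>\<^bsub>heis\<^esub> p \<in> U}"
proof -
  have "istopology (\<lambda>U. U \<subseteq> rcosets\<^bsub>heis\<^esub> (Gamma_r r) \<and> open {p. Gamma_r r #>\<^bsub>heis\<^esub> p \<in> U})"
    unfolding istopology_def
  proof (intro conjI allI impI)
    fix K
    assume K: "\<forall>U\<in>K. U \<subseteq> rcosets\<^bsub>heis\<^esub> (Gamma_r r) \<and> open {p. Gamma_r r #>\<^bsub>heis\<^esub> p \<in> U}"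
    have "{p. Gamma_r r #>\<^bsub>heis\<^esub> p \<in> \<Union>K} = (\<Union>U\<in>K. {p. Gamma_r r #>\<^bsub>heis\<^esub> p \<in> U})"
      by auto
    then show "open {p. Gamma_r r #>\<^bsub>heis\<^esub> p \<in> \<Union>K}"
      using K by auto
  qed (auto simp: Collect_conj_eq)
  then show ?thesis
    by (simp add: heis_manifold_def topology_inverse')
qed

lemma topspace_heis_manifold: "topspace (heis_manifold r) = rcosets\<^bsub>heis\<^esub> (Gamma_r r)"
proof
  have "{p. Gamma_r r #>\<^bsub>heis\<^esub> p \<in> rcosets\<^bsub>heis\<^esub> (Gamma_r r)} = UNIV"
    by (auto simp: RCOSETS_def heis_def)
  then show "rcosets\<^bsub>heis\<^esub> (Gamma_r r) \<subseteq> topspace (heis_manifold r)"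
    by (intro openin_subset) (simp add: openin_heis_manifold)
  show "topspace (heis_manifold r) \<subseteq> rcosets\<^bsub>heis\<^esub> (Gamma_r r)"
    using openin_heis_manifold[of r "topspace (heis_manifold r)"] openin_topspace by blast
qed

lemma quotient_map_heis_manifold:
  "quotient_map euclidean (heis_manifold r) (\<lambda>p. Gamma_r r #>\<^bsub>heis\<^esub> p)"
proof -
  have "range (\<lambda>p. Gamma_r r #>\<^bsub>heis\<^esub> p) = rcosets\<^bsub>heis\<^esub> (Gamma_r r)"
    unfolding RCOSETS_def by (auto simp: heis_def)
  then show ?thesis
    unfolding quotient_map_def topspace_heis_manifold openin_heis_manifold by simp
qed

lemma tilde_block_mat [simp]: "tilde (block_mat B \<rho>) = B"
  by (simp add: tilde_def block_mat_def vec_eq_iff forall_2)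

lemma rho_block_mat [simp]: "rho (block_mat B \<rho>) = \<rho>"
  by (simp add: rho_def block_mat_def)

lemma sr_inner_orthonormal:
  assumes "A \<in> calA"
  shows "sr_inner A (A *v X1) (A *v X1) = 1" "sr_inner A (A *v X2) (A *v X2) = 1"
    "sr_inner A (A *v X1) (A *v X2) = 0"
proof -
  obtain B \<rho> where A: "A = block_mat B \<rho>" and B: "invertible B"
    using assms by (auto simp: calA_def)
  have inv: "matrix_inv B ** B = mat 1"
    using B unfolding invertible_def matrix_inv_def by (rule someI_ex[THEN conjunct2])
  have "vector [(A *v X1)$1, (A *v X1)$2] = B *v axis 1 1"
    "vector [(A *v X2)$1, (A *v X2)$2] = B *v axis 2 1"
    by (simp_all add: A block_mat_def matrix_vector_mult_def sum_2 sum_3 vec_eq_iff forall_2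
        X1_def X2_def axis_def)
  then have "sr_coords A (A *v X1) = axis 1 1" "sr_coords A (A *v X2) = axis 2 1"
    using inv by (simp_all add: sr_coords_def A matrix_vector_mul_assoc)
  then show "sr_inner A (A *v X1) (A *v X1) = 1" "sr_inner A (A *v X2) (A *v X2) = 1"
    "sr_inner A (A *v X1) (A *v X2) = 0"
    by (simp_all add: sr_inner_def inner_axis_axis)
qed

end

theory Submission
  imports Defs
begin

text \<open>A closed curve in the quotient lifts to a path from \<open>p\<close> to \<open>\<gamma> p\<close> with \<open>\<gamma>\<close> in the lattice, and
  \<open>\<gamma> \<noteq> 1\<close> unless the curve is null-homologous. If \<open>\<gamma>\<close> is not central, the projection of the path to
  the plane has length at least \<open>s1\<close>; if \<open>\<gamma> = exp (k Z)\<close>, the projection is a loop of area \<open>\<bar>k\<bar>\<close>, so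
  that the isoperimetric inequality bounds its length by \<open>s2 = sqrt (4 \<pi> / \<bar>det (tilde A)\<bar>)\<close>. Both bounds
  are attained, by a segment and by the lift of a circle; the latter has a nontrivial homology class
  (of order \<open>r\<close>) as soon as \<open>r > 1\<close>. Popp's volume of the quotient is \<open>r / (sqrt 2 det\<^sup>2)\<close>, so the claims
  reduce to comparing \<open>s1 \<le> C2 sqrt (r / \<bar>det\<bar>)\<close> (Hermite) with \<open>s2\<close>.\<close>

section \<open>The lattice and its cosets\<close>

text \<open>A competing curve in the quotient is merely continuous and its length is a supremum of
  sums of \<open>quot_dist\<close>, so its lift has no derivative to integrate. Infima over paths
  supply near-optimal horizontal pieces between partition points, and \<open>hchain\<close> records
  of each piece only a horizontal bound \<open>h \<le> e\<close> and a vertical error of order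
  \<open>h\<^sup>2\<close>. These errors add up to order \<open>e * l\<close> and vanish with
  \<open>e\<close>. The isoperimetric inequality must then hold for polygons; it comes from
  telescoping a cotangent potential that is sharp on circles. In \<open>sr_coords\<close> the metric
  is Euclidean, and heights are areas times \<open>det (tilde A)\<close>. Hence \<open>s2\<close>
  and the Hermite bound scale like \<open>\<bar>det\<bar>\<close> to the power -1/2 and the volume
  like the power -2, which explains the exponent 1/4 and why one constant serves all
  \<open>A\<close>. The torsion comes from the commutator of \<open>exp (r X1)\<close> and
  \<open>exp X2\<close> being \<open>exp (r Z)\<close>. For \<open>r = 1\<close> the vertical loop
  is null-homologous, but \<open>4 * pi / C2\<^sup>2 > 1\<close> puts this case into part (1), where
  \<open>s1 \<le> s2\<close> anyway.\<close>

lemma hmul_nth [simp]: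
  "hmul p q $ 1 = p$1 + q$1" "hmul p q $ 2 = p$2 + q$2"
  "hmul p q $ 3 = p$3 + q$3 + (p$1 * q$2 - p$2 * q$1) / 2"
  by (simp_all add: hmul_eq)

lemma vec3_eq_iff: "(p::'a^3) = q \<longleftrightarrow> p$1 = q$1 \<and> p$2 = q$2 \<and> p$3 = q$3"
  by (simp add: vec_eq_iff forall_3)

lemma hmul_assoc: "hmul (hmul p q) u = hmul p (hmul q u)"
  by (simp add: vec3_eq_iff field_simps)

lemma hmul_0 [simp]: "hmul 0 p = p" "hmul p 0 = p"
  by (simp_all add: vec3_eq_iff)

lemma hmul_minus [simp]: "hmul (- p) p = 0" "hmul p (- p) = 0"
  by (simp_all add: vec3_eq_iff)

lemma hmul_minus_cancel [simp]: "hmul (- p) (hmul p q) = q" "hmul p (hmul (- p) q) = q"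
  by (simp_all flip: hmul_assoc)

lemma minus_hmul: "- hmul p q = hmul (- q) (- p)"
  by (simp add: vec3_eq_iff field_simps)

lemma X_nth [simp]:
  "X1 $ 1 = 1" "X1 $ 2 = 0" "X1 $ 3 = 0"
  "X2 $ 1 = 0" "X2 $ 2 = 1" "X2 $ 3 = 0"
  "Z $ 1 = 0" "Z $ 2 = 0" "Z $ 3 = 1"
  by (simp_all add: X1_def X2_def Z_def axis_def)

text \<open>Integer parameters of \<open>exp (a r X1) exp (b X2) exp (k Z)\<close>; the half term is
  the bracket term of Baker-Campbell-Hausdorff. The plain third coordinate of a lattice element may
  be a half-integer.\<close>

definition lat :: "nat \<Rightarrow> int \<Rightarrow> int \<Rightarrow> int \<Rightarrow> real^3" where
  "lat r a b k = vector [real r * a, b, k + real r * a * b / 2]"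

lemma lat_nth [simp]:
  "lat r a b k $ 1 = real r * a" "lat r a b k $ 2 = b" "lat r a b k $ 3 = k + real r * a * b / 2"
  by (simp_all add: lat_def)

text \<open>The twist \<open>int r * a' * b\<close> is the cost of moving \<open>exp (b X2)\<close>
  past \<open>exp (r a' X1)\<close>. Commutators are therefore central with third parameter
  divisible by \<open>r\<close>, the origin of the torsion in homology.\<close>

lemma hmul_lat: "hmul (lat r a b k) (lat r a' b' k') = lat r (a + a') (b + b') (k + k' - int r * a' * b)"
  by (simp add: vec3_eq_iff field_simps)

lemma minus_lat: "- lat r a b k = lat r (- a) (- b) (- k - int r * a * b)"
  by (simp add: vec3_eq_iff field_simps)

lemma lat_eq_0_iff: "r > 0 \<Longrightarrow> lat r a b k = 0 \<longleftrightarrow> a = 0 \<and> b = 0 \<and> k = 0"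
  by (auto simp: vec3_eq_iff)

lemma Gamma_closed:
  "0 \<in> Gamma_r r"
  "p \<in> Gamma_r r \<Longrightarrow> q \<in> Gamma_r r \<Longrightarrow> hmul p q \<in> Gamma_r r"
  "p \<in> Gamma_r r \<Longrightarrow> - p \<in> Gamma_r r"
  using subgroup.one_closed[OF subgroup_Gamma_r] subgroup.m_closed[OF subgroup_Gamma_r]
    subgroup.m_inv_closed[OF subgroup_Gamma_r, unfolded inv_heis]
  by (auto simp: heis_def hexp_def)

lemma of_int_scale_in_Gamma:
  assumes "u \<in> Gamma_r r"
  shows "of_int m *\<^sub>R u \<in> Gamma_r r"
proof (induction m rule: int_induct[where k = 0])
  case base
  show ?case by (simp add: Gamma_closed)
next
  case (step1 i)
  have "of_int (i + 1) *\<^sub>R u = hmul (of_int i *\<^sub>R u) u"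
    by (simp add: vec3_eq_iff algebra_simps)
  then show ?case
    using step1 assms Gamma_closed(2) by metis
next
  case (step2 i)
  have "of_int (i - 1) *\<^sub>R u = hmul (of_int i *\<^sub>R u) (- u)"
    by (simp add: vec3_eq_iff algebra_simps)
  then show ?case
    using step2 assms Gamma_closed(2,3) by metis
qed

lemma Gamma_r_eq: "Gamma_r r = {lat r a b k | a b k. True}"
proof
  have "subgroup {lat r a b k | a b k. True} heis"
  proof (rule group.subgroupI[OF group_heis])
    show "{lat r a b k |a b k. True} \<noteq> {}" by blast
    show "inv\<^bsub>heis\<^esub> p \<in> {lat r a b k |a b k. True}" if "p \<in> {lat r a b k |a b k. True}" for p
      using that minus_lat inv_heis by fastforce
    show "p \<otimes>\<^bsub>heis\<^esub> q \<in> {lat r a b k |a b k. True}"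
      if pq: "p \<in> {lat r a b k |a b k. True}" "q \<in> {lat r a b k |a b k. True}" for p q
    proof -
      obtain a b k where "p = lat r a b k" using pq(1) by blast
      moreover obtain a' b' k' where "q = lat r a' b' k'" using pq(2) by blast
      ultimately show ?thesis using hmul_lat[of r a b k a' b' k'] by (auto simp: heis_def)
    qed
  qed (simp add: heis_def)
  moreover have "hexp (real r *\<^sub>R X1) = lat r 1 0 0" "hexp X2 = lat r 0 1 0" "hexp Z = lat r 0 0 1"
    by (simp_all add: hexp_def vec3_eq_iff)
  then have "{hexp (real r *\<^sub>R X1), hexp X2, hexp Z} \<subseteq> {lat r a b k | a b k. True}"
    by blast
  ultimately show "Gamma_r r \<subseteq> {lat r a b k | a b k. True}"
    unfolding Gamma_r_def by (intro group.generate_subgroup_incl[OF group_heis])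
  show "{lat r a b k | a b k. True} \<subseteq> Gamma_r r"
  proof clarify
    fix a b k
    have "real r *\<^sub>R X1 \<in> Gamma_r r" "X2 \<in> Gamma_r r" "Z \<in> Gamma_r r"
      by (auto simp: Gamma_r_def hexp_def intro: generate.incl)
    moreover have "lat r a b k = hmul (hmul (of_int a *\<^sub>R (real r *\<^sub>R X1)) (of_int b *\<^sub>R X2)) (of_int k *\<^sub>R Z)"
      by (simp add: vec3_eq_iff algebra_simps)
    ultimately show "lat r a b k \<in> Gamma_r r"
      by (metis Gamma_closed(2) of_int_scale_in_Gamma)
  qed
qed

lemma lat_in_Gamma [simp, intro]: "lat r a b k \<in> Gamma_r r"
  by (auto simp: Gamma_r_eq)

abbreviation proj :: "nat \<Rightarrow> real^3 \<Rightarrow> (real^3) set" where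
  "proj r p \<equiv> Gamma_r r #>\<^bsub>heis\<^esub> p"

lemma proj_eq: "proj r p = {hmul g p | g. g \<in> Gamma_r r}"
  by (auto simp: r_coset_def heis_def)

lemma self_in_proj: "p \<in> proj r p"
  unfolding proj_eq using Gamma_closed(1) hmul_0(1) by force

lemma proj_eq_iff: "proj r p = proj r q \<longleftrightarrow> (\<exists>g\<in>Gamma_r r. q = hmul g p)"
proof
  assume "proj r p = proj r q"
  then have "q \<in> proj r p" using self_in_proj by simp
  then show "\<exists>g\<in>Gamma_r r. q = hmul g p" by (auto simp: proj_eq)
next
  assume "\<exists>g\<in>Gamma_r r. q = hmul g p"
  then obtain g where g: "g \<in> Gamma_r r" "q = hmul g p" by auto
  show "Gamma_r r #>\<^bsub>heis\<^esub> p = Gamma_r r #>\<^bsub>heis\<^esub> q"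
  proof (intro equalityI subsetI)
    fix x assume "x \<in> proj r p"
    then obtain h where "h \<in> Gamma_r r" "x = hmul h p" by (auto simp: proj_eq)
    then have "x = hmul (hmul h (- g)) q" "hmul h (- g) \<in> Gamma_r r"
      using g Gamma_closed by (simp_all add: hmul_assoc)
    then show "x \<in> proj r q" by (auto simp: proj_eq)
  next
    fix x assume "x \<in> proj r q"
    then obtain h where "h \<in> Gamma_r r" "x = hmul h q" by (auto simp: proj_eq)
    then have "x = hmul (hmul h g) p" "hmul h g \<in> Gamma_r r"
      using g Gamma_closed by (simp_all add: hmul_assoc)
    then show "x \<in> proj r p" by (auto simp: proj_eq)
  qed
qed

lemma continuous_on_hmul [continuous_intros]:
  assumes "continuous_on S f" "continuous_on S g"
  shows "continuous_on S (\<lambda>x. hmul (f x) (g x))"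
  unfolding hmul_eq lie_bracket_def by (intro continuous_intros assms)

section \<open>Absolutely continuous curves\<close>

text \<open>Isolates the condition for one pair \<open>e\<close>, \<open>d\<close>, so that it can
  be re-indexed and restricted apart from the outer quantifiers.\<close>

definition abs_continuity_modulus ::
    "real \<Rightarrow> real \<Rightarrow> (real \<Rightarrow> 'a::metric_space) \<Rightarrow> real \<Rightarrow> real \<Rightarrow> bool" where
  "abs_continuity_modulus a b c e d \<longleftrightarrow> (\<forall>(n::nat) s t.
     (\<forall>i<n. a \<le> s i \<and> s i \<le> t i \<and> t i \<le> b) \<and>
     (\<forall>i<n. \<forall>j<n. i \<noteq> j \<longrightarrow> {s i<..<t i} \<inter> {s j<..<t j} = {}) \<and>
     (\<Sum>i<n. t i - s i) < d \<longrightarrow> (\<Sum>i<n. dist (c (s i)) (c (t i))) < e)"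

lemma abs_continuous_on_Icc_iff_modulus:
  "abs_continuous_on_Icc a b c \<longleftrightarrow> (\<forall>e>0. \<exists>d>0. abs_continuity_modulus a b c e d)"
  unfolding abs_continuous_on_Icc_def abs_continuity_modulus_def ..

text \<open>Divisions are finite sets of intervals, so the index set is transported from an initial
  segment of \<open>nat\<close> along a bijection.\<close>

lemma abs_continuity_modulusD:
  fixes c :: "real \<Rightarrow> 'a::metric_space"
  assumes ac: "abs_continuity_modulus a b c e d"
    and fin: "finite I"
    and sub: "\<And>i. i \<in> I \<Longrightarrow> a \<le> u i \<and> u i \<le> v i \<and> v i \<le> b"
    and disj: "\<And>i j. i \<in> I \<Longrightarrow> j \<in> I \<Longrightarrow> i \<noteq> j \<Longrightarrow> {u i<..<v i} \<inter> {u j<..<v j} = {}"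
    and small: "(\<Sum>i\<in>I. v i - u i) < d"
  shows "(\<Sum>i\<in>I. dist (c (u i)) (c (v i))) < e"
proof -
  obtain h where h: "bij_betw h {..<card I} I"
    using fin ex_bij_betw_nat_finite[OF fin] by (auto simp: atLeast0LessThan)
  have hI: "h i \<in> I" if "i < card I" for i using h that by (auto simp: bij_betw_def)
  have inj: "h i \<noteq> h j" if "i < card I" "j < card I" "i \<noteq> j" for i j
    using h that by (auto simp: bij_betw_def inj_on_def)
  have "(\<Sum>i<card I. dist (c (u (h i))) (c (v (h i)))) < e"
  proof (rule ac[unfolded abs_continuity_modulus_def, rule_format], intro conjI)
    show "\<forall>i<card I. a \<le> u (h i) \<and> u (h i) \<le> v (h i) \<and> v (h i) \<le> b"
      using sub hI by blast
    show "\<forall>i<card I. \<forall>j<card I. i \<noteq> j \<longrightarrow> {u (h i)<..<v (h i)} \<inter> {u (h j)<..<v (h j)} = {}"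
      using disj hI inj by simp
    show "(\<Sum>i<card I. v (h i) - u (h i)) < d"
      using small sum.reindex_bij_betw[OF h, of "\<lambda>i. v i - u i"] by simp
  qed
  then show ?thesis
    using sum.reindex_bij_betw[OF h, of "\<lambda>i. dist (c (u i)) (c (v i))"] by simp
qed

text \<open>Henstock-Kurzweil integration with two kinds of tags. Off \<open>N\<close> the gauge
  comes from differentiability and the error is proportional to length; tags in \<open>N\<close> are
  confined to an open set of measure below \<open>d\<close>, where absolute continuity bounds the
  total increment of \<open>c\<close>. On \<open>N\<close> the integrand is replaced by 0.\<close>

theorem fundamental_theorem_of_calculus_abs_continuous:
  fixes c :: "real \<Rightarrow> 'a::euclidean_space"
  assumes ac: "abs_continuous_on_Icc a b c" and "a \<le> b"
    and N: "negligible N"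
    and deriv: "\<And>t. t \<in> {a..b} - N \<Longrightarrow> (c has_vector_derivative f t) (at t within {a..b})"
  shows "(f has_integral (c b - c a)) {a..b}"
proof -
  define g where "g = (\<lambda>t. if t \<in> N then 0 else f t)"
  have "(g has_integral (c b - c a)) (cbox a b)"
    unfolding has_integral
  proof (intro allI impI)
    fix e :: real assume e: "e > 0"
    \<comment> \<open>The summand 1 keeps the denominator positive for \<open>a = b\<close> and
      makes \<open>e' * (b - a) < e / 2\<close> strict.\<close>
    define e' where "e' = e / (2 * (b - a + 1))"
    have e': "e' > 0" and e'_le: "e' * (b - a) < e / 2"
      using e \<open>a \<le> b\<close> by (auto simp: e'_def field_simps)
    obtain d where d: "d > 0" and acd: "abs_continuity_modulus a b c (e / 2) d"
      using ac e by (metis abs_continuous_on_Icc_iff_modulus half_gt_zero)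
    have N': "N \<in> lmeasurable" "measure lebesgue N = 0"
      using N by (auto simp: negligible_iff_measure)
    obtain U where U: "open U" "N \<subseteq> U" "U - N \<in> lmeasurable" "emeasure lebesgue (U - N) < ennreal d"
      by (rule sets_lebesgue_outer_open[OF fmeasurableD[OF N'(1)] d])
    have UN: "U = N \<union> (U - N)" using U by blast
    have U_meas: "U \<in> lmeasurable"
      by (subst UN) (intro fmeasurable.Un N' U)
    have "measure lebesgue (N \<union> (U - N)) \<le> measure lebesgue N + measure lebesgue (U - N)"
      using N' U by (intro measure_Un_le) (auto dest: fmeasurableD)
    moreover have "measure lebesgue (U - N) < d"
      using U(4) emeasure_eq_measure2[OF U(3)] d by (simp add: ennreal_less_iff)
    ultimately have U_less: "measure lebesgue U < d"
      using N' UN by simp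
    \<comment> \<open>Straddle estimate for an interval \<open>{u..v}\<close> that contains the tag
      \<open>t\<close> and has both ends near it.\<close>
    have "\<exists>r>0. \<forall>u v. u \<in> {a..b} \<longrightarrow> v \<in> {a..b} \<longrightarrow> \<bar>u - t\<bar> < r \<longrightarrow> \<bar>v - t\<bar> < r \<longrightarrow> u \<le> t \<longrightarrow> t \<le> v \<longrightarrow>
        norm (c v - c u - (v - u) *\<^sub>R f t) \<le> e' * (v - u)" if t: "t \<in> {a..b} - N" for t
    proof -
      from deriv[OF t, unfolded has_vector_derivative_def has_derivative_within_alt] e'
      obtain r where r: "r > 0" and *: "\<And>y. y \<in> {a..b} \<Longrightarrow> norm (y - t) < r \<Longrightarrow>
          norm (c y - c t - (y - t) *\<^sub>R f t) \<le> e' * norm (y - t)"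
        by blast
      show ?thesis
      proof (intro exI[of _ r] conjI allI impI r)
        fix u v assume uv: "u \<in> {a..b}" "v \<in> {a..b}" "\<bar>u - t\<bar> < r" "\<bar>v - t\<bar> < r" "u \<le> t" "t \<le> v"
        have "c v - c u - (v - u) *\<^sub>R f t = (c v - c t - (v - t) *\<^sub>R f t) - (c u - c t - (u - t) *\<^sub>R f t)"
          by (simp add: algebra_simps)
        then have "norm (c v - c u - (v - u) *\<^sub>R f t) \<le> norm (c v - c t - (v - t) *\<^sub>R f t) + norm (c u - c t - (u - t) *\<^sub>R f t)"
          by (metis norm_triangle_ineq4)
        also have "\<dots> \<le> e' * norm (v - t) + e' * norm (u - t)"
          using *[of v] *[of u] uv by auto
        also have "\<dots> = e' * (v - u)" using uv by (simp add: algebra_simps)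
        finally show "norm (c v - c u - (v - u) *\<^sub>R f t) \<le> e' * (v - u)" .
      qed
    qed
    then obtain r where r: "\<And>t. t \<in> {a..b} - N \<Longrightarrow> r t > 0"
      "\<And>t u v. t \<in> {a..b} - N \<Longrightarrow> u \<in> {a..b} \<Longrightarrow> v \<in> {a..b} \<Longrightarrow> \<bar>u - t\<bar> < r t \<Longrightarrow> \<bar>v - t\<bar> < r t \<Longrightarrow> u \<le> t \<Longrightarrow> t \<le> v \<Longrightarrow>
        norm (c v - c u - (v - u) *\<^sub>R f t) \<le> e' * (v - u)"
      by metis
    define \<gamma> where "\<gamma> = (\<lambda>t. if t \<in> N then U else if t \<in> {a..b} then ball t (r t) else UNIV)"
    have "gauge \<gamma>"
      using U r by (auto simp: \<gamma>_def gauge_def)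
    moreover have "norm ((\<Sum>(x,K)\<in>\<D>. measure lborel K *\<^sub>R g x) - (c b - c a)) < e"
      if D: "\<D> tagged_division_of cbox a b" and fine: "\<gamma> fine \<D>" for \<D>
    proof -
      have fin: "finite \<D>" using D by blast
      have DK: "x \<in> {Inf K..Sup K} \<and> K = {Inf K..Sup K} \<and> a \<le> Inf K \<and> Inf K \<le> Sup K \<and> Sup K \<le> b \<and>
          measure lborel K = Sup K - Inf K \<and> K \<subseteq> \<gamma> x" if xK: "(x, K) \<in> \<D>" for x K
      proof -
        obtain u v where uv: "K = cbox u v" using D xK by (meson tagged_division_ofD(4))
        have "x \<in> K" "K \<subseteq> cbox a b" using D xK by (auto dest: tagged_division_ofD(2,3))
        moreover have "K \<subseteq> \<gamma> x" using fine xK by (auto simp: fine_def)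
        ultimately show ?thesis using uv by (auto simp: subset_eq)
      qed
      have disj: "{Inf K<..<Sup K} \<inter> {Inf K'<..<Sup K'} = {}" if "(x, K) \<in> \<D>" "(x', K') \<in> \<D>" "(x, K) \<noteq> (x', K')" for x K x' K'
      proof -
        have "interior K \<inter> interior K' = {}"
          using D that by (meson tagged_division_ofD(5))
        then show ?thesis
          using DK[OF that(1)] DK[OF that(2)] by (metis interior_atLeastAtMost_real)
      qed
      define \<D>N where "\<D>N = {(x,K) \<in> \<D>. x \<in> N}"
      have subN: "\<D>N \<subseteq> \<D>" and finN: "finite \<D>N" using fin by (auto simp: \<D>N_def intro: finite_subset)
      have "(\<Sum>(x,K)\<in>\<D>. c (Sup K) - c (Inf K)) = c b - c a"
        using additive_tagged_division_1[OF \<open>a \<le> b\<close>, of \<D> c] D by (simp add: cbox_interval)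
      then have "(\<Sum>(x,K)\<in>\<D>. measure lborel K *\<^sub>R g x) - (c b - c a) = (\<Sum>(x,K)\<in>\<D>. measure lborel K *\<^sub>R g x - (c (Sup K) - c (Inf K)))"
        by (simp add: sum_subtractf case_prod_unfold)
      also have "norm \<dots> \<le> (\<Sum>(x,K)\<in>\<D>. norm (measure lborel K *\<^sub>R g x - (c (Sup K) - c (Inf K))))"
        by (simp add: case_prod_unfold norm_sum)
      also have "\<dots> = (\<Sum>(x,K)\<in>\<D> - \<D>N. norm (measure lborel K *\<^sub>R g x - (c (Sup K) - c (Inf K))))
          + (\<Sum>(x,K)\<in>\<D>N. norm (measure lborel K *\<^sub>R g x - (c (Sup K) - c (Inf K))))"
        by (rule sum.subset_diff[OF subN fin])
      also have "(\<Sum>(x,K)\<in>\<D> - \<D>N. norm (measure lborel K *\<^sub>R g x - (c (Sup K) - c (Inf K)))) \<le> (\<Sum>(x,K)\<in>\<D>-\<D>N. e' * measure lborel K)"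
      proof (rule sum_mono, clarify)
        fix x K assume xK: "(x, K) \<in> \<D>" "(x, K) \<notin> \<D>N"
        then have xN: "x \<notin> N" by (auto simp: \<D>N_def)
        note * = DK[OF xK(1)]
        have xab: "x \<in> {a..b} - N" using * xN by auto
        have "K \<subseteq> ball x (r x)" using * xN xab by (auto simp: \<gamma>_def split: if_splits)
        moreover have "Inf K \<in> K" "Sup K \<in> K" using * by (metis atLeastAtMost_iff order_refl)+
        ultimately have "\<bar>Inf K - x\<bar> < r x" "\<bar>Sup K - x\<bar> < r x" by (auto simp: dist_real_def)
        then have "norm (c (Sup K) - c (Inf K) - (Sup K - Inf K) *\<^sub>R f x) \<le> e' * (Sup K - Inf K)"
          using r(2)[OF xab, of "Inf K" "Sup K"] * by auto
        then show "norm (measure lborel K *\<^sub>R g x - (c (Sup K) - c (Inf K))) \<le> e' * measure lborel K"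
          using * xN by (simp add: g_def norm_minus_commute)
      qed
      also have "\<dots> \<le> (\<Sum>(x,K)\<in>\<D>. e' * measure lborel K)"
        using fin e' by (intro sum_mono2) auto
      also have "\<dots> = e' * (b - a)"
        using additive_content_tagged_division[OF D] \<open>a \<le> b\<close>
        by (simp add: sum_distrib_left[symmetric] case_prod_unfold)
      also have "\<dots> < e / 2" by (fact e'_le)
      also have "(\<Sum>(x,K)\<in>\<D>N. norm (measure lborel K *\<^sub>R g x - (c (Sup K) - c (Inf K)))) =
          (\<Sum>xK\<in>\<D>N. dist (c (Inf (snd xK))) (c (Sup (snd xK))))"
        by (intro sum.cong) (auto simp: \<D>N_def g_def dist_norm norm_minus_commute)
      also have "\<dots> < e / 2"
      proof (rule abs_continuity_modulusD[OF acd finN])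
        show "(\<Sum>xK\<in>\<D>N. Sup (snd xK) - Inf (snd xK)) < d"
        proof -
          have "(\<Sum>xK\<in>\<D>N. Sup (snd xK) - Inf (snd xK)) = (\<Sum>xK\<in>\<D>N. measure lebesgue {Inf (snd xK)<..<Sup (snd xK)})"
            using DK by (intro sum.cong refl) (auto simp: \<D>N_def)
          also have "\<dots> = measure lebesgue (\<Union>xK\<in>\<D>N. {Inf (snd xK)<..<Sup (snd xK)})"
          proof (rule measure_finite_Union[symmetric, OF finN])
            show "disjoint_family_on (\<lambda>xK. {Inf (snd xK)<..<Sup (snd xK)}) \<D>N"
              using disj subN unfolding disjoint_family_on_def by (metis prod.collapse subsetD)
            have "emeasure lborel {x<..<y} \<noteq> \<infinity>" for x y :: real
              by (cases "x \<le> y") auto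
            then show "emeasure lebesgue {Inf (snd xK)<..<Sup (snd xK)} \<noteq> \<infinity>" for xK :: "real \<times> real set"
              by simp
          qed auto
          also have "\<dots> \<le> measure lebesgue U"
          proof (rule measure_mono_fmeasurable[OF _ _ U_meas])
            show "(\<Union>xK\<in>\<D>N. {Inf (snd xK)<..<Sup (snd xK)}) \<subseteq> U"
            proof (rule UN_least)
              fix xK assume xK: "xK \<in> \<D>N"
              obtain x K where [simp]: "xK = (x, K)" by (cases xK)
              have "(x, K) \<in> \<D>" "x \<in> N" using xK by (auto simp: \<D>N_def)
              then have "{Inf K..Sup K} \<subseteq> U" using DK[of x K] by (auto simp: \<gamma>_def)
              then show "{Inf (snd xK)<..<Sup (snd xK)} \<subseteq> U" by (auto simp: subset_eq)
            qed
            show "(\<Union>xK\<in>\<D>N. {Inf (snd xK)<..<Sup (snd xK)}) \<in> sets lebesgue" using finN by auto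
          qed
          also have "\<dots> < d" by (fact U_less)
          finally show ?thesis .
        qed
        show "a \<le> Inf (snd xK) \<and> Inf (snd xK) \<le> Sup (snd xK) \<and> Sup (snd xK) \<le> b" if "xK \<in> \<D>N" for xK
          using DK[of "fst xK" "snd xK"] that subN by auto
        show "{Inf (snd xK)<..<Sup (snd xK)} \<inter> {Inf (snd yK)<..<Sup (snd yK)} = {}"
          if "xK \<in> \<D>N" "yK \<in> \<D>N" "xK \<noteq> yK" for xK yK
          using disj[of "fst xK" "snd xK" "fst yK" "snd yK"] that subN by auto
      qed
      finally show ?thesis by simp
    qed
    ultimately show "\<exists>\<gamma>. gauge \<gamma> \<and> (\<forall>\<D>. \<D> tagged_division_of cbox a b \<and> \<gamma> fine \<D> \<longrightarrow>
        norm ((\<Sum>(x,K)\<in>\<D>. measure lborel K *\<^sub>R g x) - (c b - c a)) < e)"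
      by (intro exI[of _ \<gamma>] conjI allI impI) (simp_all only: conj_commute)
  qed
  then show ?thesis
    using has_integral_spike[OF N, of "{a..b}" f g] by (simp add: g_def)
qed

lemma abs_continuous_on_Icc_subset:
  assumes "abs_continuous_on_Icc a b c" "a \<le> a'" "b' \<le> b"
  shows "abs_continuous_on_Icc a' b' c"
proof -
  have "abs_continuity_modulus a' b' c e d" if "abs_continuity_modulus a b c e d" for e d
    unfolding abs_continuity_modulus_def
  proof (intro allI impI)
    fix n :: nat and s t
    assume *: "(\<forall>i<n. a' \<le> s i \<and> s i \<le> t i \<and> t i \<le> b') \<and>
     (\<forall>i<n. \<forall>j<n. i \<noteq> j \<longrightarrow> {s i<..<t i} \<inter> {s j<..<t j} = {}) \<and> (\<Sum>i<n. t i - s i) < d"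
    have "\<forall>i<n. a \<le> s i \<and> s i \<le> t i \<and> t i \<le> b"
      using * assms(2,3) by (meson order_trans)
    then show "(\<Sum>i<n. dist (c (s i)) (c (t i))) < e"
      using * that[unfolded abs_continuity_modulus_def, rule_format] by blast
  qed
  then show ?thesis
    using assms(1) unfolding abs_continuous_on_Icc_iff_modulus by blast
qed

text \<open>On an interval shorter than the \<open>d\<close> belonging to \<open>e = 1\<close>, the
  norms of the integrals over the pieces of a division are increments of \<open>c\<close>, so their
  sum stays below 1; this bounded variation yields absolute integrability there.\<close>

lemma abs_continuous_derivative_absolutely_integrable:
  fixes c :: "real \<Rightarrow> 'a::euclidean_space"
  assumes ac: "abs_continuous_on_Icc a b c" and "a \<le> b"
    and N: "negligible N"
    and deriv: "\<And>t. t \<in> {a..b} - N \<Longrightarrow> (c has_vector_derivative f t) (at t within {a..b})"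
  shows "f absolutely_integrable_on {a..b}"
proof -
  have int: "(f has_integral (c v - c u)) {u..v}" if "a \<le> u" "u \<le> v" "v \<le> b" for u v
  proof (rule fundamental_theorem_of_calculus_abs_continuous[OF _ _ N])
    show "abs_continuous_on_Icc u v c"
      using abs_continuous_on_Icc_subset ac that by blast
    show "(c has_vector_derivative f t) (at t within {u..v})" if "t \<in> {u..v} - N" for t
      using deriv[of t] that \<open>a \<le> u\<close> \<open>v \<le> b\<close> by (auto intro: has_vector_derivative_within_subset)
  qed fact
  obtain d where d: "d > 0" and acd: "abs_continuity_modulus a b c (1) d"
      using ac by (metis abs_continuous_on_Icc_iff_modulus zero_less_one)
  have small: "f absolutely_integrable_on {u..v}" if uv: "a \<le> u" "u \<le> v" "v \<le> b" "v - u < d" for u v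
  proof -
    have "f absolutely_integrable_on cbox u v"
    proof (rule bounded_variation_absolutely_integrable_interval)
      show "f integrable_on cbox u v" using int[of u v] uv by (auto simp: has_integral_integrable)
      fix \<D> assume D: "\<D> division_of cbox u v"
      have DK: "K = {Inf K..Sup K} \<and> u \<le> Inf K \<and> Inf K \<le> Sup K \<and> Sup K \<le> v \<and>
          measure lborel K = Sup K - Inf K" if K: "K \<in> \<D>" for K
      proof -
        obtain u' v' where uv': "K = cbox u' v'" using D K by (meson division_ofD(4))
        have "K \<noteq> {}" "K \<subseteq> cbox u v" using D K by (auto dest: division_ofD(2,3))
        then show ?thesis using uv' by (auto simp: subset_eq)
      qed
      have "(\<Sum>K\<in>\<D>. norm (integral K f)) = (\<Sum>K\<in>\<D>. dist (c (Inf K)) (c (Sup K)))"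
      proof (rule sum.cong[OF refl])
        fix K assume "K \<in> \<D>"
        note K = DK[OF this]
        have "integral {Inf K..Sup K} f = c (Sup K) - c (Inf K)"
          using int[of "Inf K" "Sup K"] K uv by (intro integral_unique) auto
        then show "norm (integral K f) = dist (c (Inf K)) (c (Sup K))"
          using K by (metis dist_commute dist_norm)
      qed
      also have "\<dots> < 1"
      proof (rule abs_continuity_modulusD[OF acd])
        show "finite \<D>" using D by blast
        show "a \<le> Inf K \<and> Inf K \<le> Sup K \<and> Sup K \<le> b" if "K \<in> \<D>" for K
          using DK[OF that] uv by auto
        show "{Inf K<..<Sup K} \<inter> {Inf K'<..<Sup K'} = {}" if "K \<in> \<D>" "K' \<in> \<D>" "K \<noteq> K'" for K K'
          using division_ofD(5)[OF D that] DK[OF that(1)] DK[OF that(2)]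
          by (metis interior_atLeastAtMost_real)
        have "(\<Sum>K\<in>\<D>. Sup K - Inf K) = (\<Sum>K\<in>\<D>. measure lborel K)"
          using DK by (intro sum.cong) auto
        also have "\<dots> = v - u" using additive_content_division[OF D] uv by simp
        finally show "(\<Sum>K\<in>\<D>. Sup K - Inf K) < d" using uv by simp
      qed
      finally show "(\<Sum>K\<in>\<D>. norm (integral K f)) \<le> 1" by simp
    qed
    then show ?thesis by simp
  qed
  \<comment> \<open>Gluing in steps of length \<open>d / 2\<close>, so that each new piece is
    strictly shorter than \<open>d\<close>; the minimum stops at the right end.\<close>
  have "f absolutely_integrable_on {a..min b (a + n * (d / 2))}" for n :: nat
  proof (induction n)
    case 0
    then show ?case using \<open>a \<le> b\<close> small[of a a] d by simp
  next
    case (Suc n)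
    let ?m = "\<lambda>n. min b (a + real n * (d / 2))"
    have le: "a \<le> ?m n" "?m n \<le> ?m (Suc n)" "?m (Suc n) \<le> b" "?m (Suc n) - ?m n < d"
      using d \<open>a \<le> b\<close> by (auto simp: min_def field_simps)
    have "f absolutely_integrable_on {?m n..?m (Suc n)}"
      using small le by auto
    then have "f absolutely_integrable_on ({a..?m n} \<union> {?m n..?m (Suc n)})"
      using Suc by (intro absolutely_integrable_Un)
    moreover have "{a..?m n} \<union> {?m n..?m (Suc n)} = {a..?m (Suc n)}"
      by (rule ivl_disj_un_two_touch(4)[OF le(1,2)])
    ultimately show ?case by simp
  qed
  moreover obtain n :: nat where "n * (d / 2) > b - a"
    using d ex_less_of_nat_mult[of "d / 2" "b - a"] by auto
  then have "min b (a + n * (d / 2)) = b" by (simp add: min_def)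
  ultimately show ?thesis by metis
qed

section \<open>Lifting maps through the quotient\<close>

lemma norm_Gamma_ge_1:
  assumes "g \<in> Gamma_r r" "r > 0" "g \<noteq> 0"
  shows "norm g \<ge> 1"
proof -
  obtain a b k where g: "g = lat r a b k" using assms by (auto simp: Gamma_r_eq)
  have "1 \<le> real_of_int \<bar>i\<bar>" if "i \<noteq> 0" for i :: int using that by linarith
  then have 1: "1 \<le> \<bar>real_of_int i\<bar>" if "i \<noteq> 0" for i :: int using that by simp
  have "\<exists>i. \<bar>g $ i\<bar> \<ge> 1"
  proof (cases "a = 0 \<and> b = 0")
    case True
    then have "\<bar>g $ 3\<bar> \<ge> 1" using assms 1[of k] g lat_eq_0_iff[of r a b k] by simp
    then show ?thesis by blast
  next
    case False
    have "\<bar>g $ 1\<bar> \<ge> 1" if "a \<noteq> 0"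
      using 1[OF that] \<open>r > 0\<close> mult_mono[of 1 "real r" 1 "\<bar>real_of_int a\<bar>"] by (simp add: g abs_mult)
    moreover have "\<bar>g $ 2\<bar> \<ge> 1" if "b \<noteq> 0" using 1[OF that] by (simp add: g)
    ultimately show ?thesis using False by blast
  qed
  then show ?thesis using component_le_norm_cart[of g] by (metis order_trans)
qed

lemma countable_Gamma_r: "countable (Gamma_r r)"
proof -
  have "Gamma_r r = (\<lambda>(a, b, k). lat r a b k) ` UNIV"
    unfolding Gamma_r_eq image_def by auto
  then show ?thesis by (metis countableI_type countable_image)
qed

text \<open>Since \<open>hmul (hmul g q) (- q) = g\<close>, two points of a small neighbourhood can
  differ only by a lattice element of norm below 1, that is by 0.\<close>

lemma Gamma_discontinuous_action:
  assumes "r > 0"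
  obtains V where "open V" "p \<in> V" "\<forall>q\<in>V. \<forall>g\<in>Gamma_r r. hmul g q \<in> V \<longrightarrow> g = 0"
proof -
  have "open {x::(real^3)\<times>(real^3). norm (hmul (snd x) (- fst x)) < 1}"
    by (intro open_Collect_less continuous_intros)
  moreover have "(p, p) \<in> {x. norm (hmul (snd x) (- fst x)) < 1}" by simp
  ultimately obtain A B where AB: "open A" "open B" "p \<in> A" "p \<in> B"
      "A \<times> B \<subseteq> {x. norm (hmul (snd x) (- fst x)) < 1}"
    by (elim open_prod_elim) auto
  show ?thesis
  proof
    show "open (A \<inter> B)" "p \<in> A \<inter> B" using AB by auto
    show "\<forall>q\<in>A \<inter> B. \<forall>g\<in>Gamma_r r. hmul g q \<in> A \<inter> B \<longrightarrow> g = 0"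
    proof (intro ballI impI)
      fix q g assume "q \<in> A \<inter> B" "g \<in> Gamma_r r" "hmul g q \<in> A \<inter> B"
      moreover from this have "norm (hmul (hmul g q) (- q)) < 1" using AB(5) by fastforce
      then have "norm g < 1" by (simp add: hmul_assoc)
      ultimately show "g = 0" using norm_Gamma_ge_1 assms by (metis not_less)
    qed
  qed
qed

text \<open>The saturation of \<open>V\<close> is a union of lattice translates of \<open>V\<close>.
  Openness of the quotient map is what makes the local sections below continuous.\<close>

lemma openin_proj_image:
  assumes "open V"
  shows "openin (heis_manifold r) (proj r ` V)"
proof -
  have "{q. proj r q \<in> proj r ` V} = (\<Union>g\<in>Gamma_r r. hmul (- g) -` V)"
  proof (intro equalityI subsetI)
    fix q assume "q \<in> {q. proj r q \<in> proj r ` V}"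
    then obtain p where p: "p \<in> V" "proj r q = proj r p" by auto
    then obtain g where "g \<in> Gamma_r r" "p = hmul g q" by (auto simp: proj_eq_iff)
    then show "q \<in> (\<Union>g\<in>Gamma_r r. hmul (- g) -` V)"
      using p Gamma_closed(3)[of g r] by (intro UN_I[of "- g"]) auto
  next
    fix q assume "q \<in> (\<Union>g\<in>Gamma_r r. hmul (- g) -` V)"
    then obtain g where "g \<in> Gamma_r r" "hmul (- g) q \<in> V" by auto
    moreover from this have "proj r q = proj r (hmul (- g) q)"
      using Gamma_closed(3) unfolding proj_eq_iff by blast
    ultimately show "q \<in> {q. proj r q \<in> proj r ` V}" by auto
  qed
  moreover have "open (hmul (- g) -` V)" for g
    using assms by (intro open_vimage continuous_intros)
  moreover have "proj r ` V \<subseteq> rcosets\<^bsub>heis\<^esub> (Gamma_r r)"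
    unfolding RCOSETS_def by (auto simp: heis_def)
  ultimately show ?thesis by (auto simp: openin_heis_manifold intro!: open_UN)
qed

lemma continuous_map_proj: "continuous_map euclidean (heis_manifold r) (proj r)"
  using quotient_map_heis_manifold quotient_imp_continuous_map by blast

text \<open>The pullback of the quotient map along \<open>f\<close> is a covering of a subset of a Euclidean space,
  so that the library's lifting theorem for such coverings provides a section of it.\<close>

lemma lift_to_Heisenberg:
  fixes f :: "'c::euclidean_space \<Rightarrow> (real^3) set"
  assumes r: "r > 0" and K: "convex K"
    and f: "continuous_map (top_of_set K) (heis_manifold r) f"
  shows "\<exists>g. continuous_on K g \<and> (\<forall>k\<in>K. proj r (g k) = f k)"
proof -
  define E where "E = {(k, p). k \<in> K \<and> proj r p = f k}"
  have rep: "\<exists>p. proj r p = f k" if "k \<in> K" for k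
  proof -
    have "f k \<in> rcosets\<^bsub>heis\<^esub> (Gamma_r r)"
      using continuous_map_image_subset_topspace[OF f] that topspace_heis_manifold by auto
    then show ?thesis unfolding RCOSETS_def by auto
  qed
  have "covering_space E fst K"
  proof
    show "continuous_on E fst" by (intro continuous_intros)
    show "fst ` E = K" using rep by (force simp: E_def)
    fix k0 assume "k0 \<in> K"
    then obtain p0 where p0: "proj r p0 = f k0" using rep by blast
    obtain V where V: "open V" "p0 \<in> V" and
      V0: "\<forall>q\<in>V. \<forall>g\<in>Gamma_r r. hmul g q \<in> V \<longrightarrow> g = 0"
      using Gamma_discontinuous_action[OF r, of p0] by blast
    define W where "W = {k \<in> K. f k \<in> proj r ` V}"
    have W_sub: "openin (top_of_set K) {k \<in> K. f k \<in> proj r ` U}" if "open U" for U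
      using openin_continuous_map_preimage[OF f openin_proj_image[OF that]] by simp
    \<comment> \<open>Local section over \<open>W\<close>: the point of \<open>V\<close> above
      \<open>f k\<close>, unique because nonzero lattice elements move every point of
      \<open>V\<close> out of \<open>V\<close>.\<close>
    define s where "s = (\<lambda>k. SOME p. p \<in> V \<and> proj r p = f k)"
    have s: "s k \<in> V" "proj r (s k) = f k" if "k \<in> W" for k
    proof -
      have "\<exists>p. p \<in> V \<and> proj r p = f k" using that by (auto simp: W_def)
      from someI_ex[OF this] show "s k \<in> V" "proj r (s k) = f k" by (auto simp: s_def)
    qed
    have s_unique: "s k = p" if "k \<in> W" "p \<in> V" "proj r p = f k" for k p
    proof -
      have "proj r p = proj r (s k)" using s that by simp
      then obtain g where "g \<in> Gamma_r r" "s k = hmul g p" by (auto simp: proj_eq_iff)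
      moreover from this have "g = 0" using V0 that s[of k] by simp
      ultimately show ?thesis by simp
    qed
    have cont_s: "continuous_on W s"
      unfolding continuous_openin_preimage_eq
    proof (intro allI impI)
      fix U :: "(real^3) set" assume "open U"
      have "W \<inter> s -` U = {k \<in> K. f k \<in> proj r ` (V \<inter> U)}"
      proof (intro equalityI subsetI)
        fix k assume "k \<in> W \<inter> s -` U"
        then show "k \<in> {k \<in> K. f k \<in> proj r ` (V \<inter> U)}"
          using s[of k] by (force simp: W_def)
      next
        fix k assume "k \<in> {k \<in> K. f k \<in> proj r ` (V \<inter> U)}"
        then obtain p where p: "k \<in> K" "p \<in> V" "p \<in> U" "proj r p = f k" by auto
        then have "k \<in> W" by (force simp: W_def)
        then show "k \<in> W \<inter> s -` U" using s_unique p by auto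
      qed
      moreover have "openin (top_of_set K) {k \<in> K. f k \<in> proj r ` (V \<inter> U)}"
        using V \<open>open U\<close> by (intro W_sub) auto
      ultimately have "openin (top_of_set K) (W \<inter> s -` U)" by simp
      then show "openin (top_of_set W) (W \<inter> s -` U)"
        by (rule openin_subset_trans) (auto simp: W_def)
    qed
    \<comment> \<open>The sheet indexed by \<open>g\<close> collects the points whose translate by
      \<open>- g\<close> falls into \<open>V\<close>.\<close>
    define piece where "piece = (\<lambda>g. {x \<in> E. hmul (- g) (snd x) \<in> V})"
    show "\<exists>T. k0 \<in> T \<and> openin (top_of_set K) T \<and> (\<exists>v. \<Union>v = E \<inter> fst -` T \<and>
        (\<forall>u\<in>v. openin (top_of_set E) u) \<and> pairwise disjnt v \<and>
        (\<forall>u\<in>v. \<exists>q. homeomorphism u T fst q))"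
    proof (intro exI[of _ W] conjI exI[of _ "piece ` Gamma_r r"])
      show "k0 \<in> W" using V \<open>k0 \<in> K\<close> p0 by (force simp: W_def)
      show "openin (top_of_set K) W" unfolding W_def by (rule W_sub) (fact V)
      show "\<Union> (piece ` Gamma_r r) = E \<inter> fst -` W"
      proof (intro equalityI subsetI)
        fix x assume "x \<in> \<Union> (piece ` Gamma_r r)"
        then obtain g where g: "g \<in> Gamma_r r" "x \<in> E" "hmul (- g) (snd x) \<in> V"
          by (auto simp: piece_def)
        have "proj r (snd x) = proj r (hmul (- g) (snd x))"
          using Gamma_closed(3)[OF g(1)] unfolding proj_eq_iff by blast
        then show "x \<in> E \<inter> fst -` W" using g by (auto simp: E_def W_def)
      next
        fix x assume "x \<in> E \<inter> fst -` W"
        then have x: "x \<in> E" "proj r (snd x) = f (fst x)" "fst x \<in> W" by (auto simp: E_def)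
        then have "proj r (s (fst x)) = proj r (snd x)" using s by simp
        then obtain g where g: "g \<in> Gamma_r r" "snd x = hmul g (s (fst x))"
          by (auto simp: proj_eq_iff)
        then have "hmul (- g) (snd x) \<in> V" using s x by simp
        then have "x \<in> piece g" using x by (simp add: piece_def)
        then show "x \<in> \<Union> (piece ` Gamma_r r)" using g by blast
      qed
      show "\<forall>u\<in>piece ` Gamma_r r. openin (top_of_set E) u"
      proof
        fix u assume "u \<in> piece ` Gamma_r r"
        then obtain g where "u = E \<inter> (\<lambda>x. hmul (- g) (snd x)) -` V" by (auto simp: piece_def)
        then show "openin (top_of_set E) u"
          using V by (auto intro!: continuous_openin_preimage_gen continuous_intros)
      qed
      show "pairwise disjnt (piece ` Gamma_r r)"
      proof (rule pairwiseI)
        fix u u' assume "u \<in> piece ` Gamma_r r" "u' \<in> piece ` Gamma_r r" "u \<noteq> u'"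
        then obtain g g' where g: "g \<in> Gamma_r r" "g' \<in> Gamma_r r" "u = piece g" "u' = piece g'"
          by auto
        show "disjnt u u'"
          unfolding disjnt_def
        proof (rule ccontr)
          assume "u \<inter> u' \<noteq> {}"
          then obtain x where x: "hmul (- g) (snd x) \<in> V" "hmul (- g') (snd x) \<in> V"
            using g by (auto simp: piece_def)
          have "hmul (hmul (- g') g) (hmul (- g) (snd x)) = hmul (- g') (snd x)"
            by (simp add: hmul_assoc)
          moreover have "hmul (- g') g \<in> Gamma_r r" using g Gamma_closed by blast
          ultimately have "hmul (- g') g = 0" using V0 x by metis
          then have "hmul g' (hmul (- g') g) = g'" by simp
          then show False using g \<open>u \<noteq> u'\<close> by simp
        qed
      qed
      show "\<forall>u\<in>piece ` Gamma_r r. \<exists>q. homeomorphism u W fst q"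
      proof
        fix u assume "u \<in> piece ` Gamma_r r"
        then obtain g where g: "g \<in> Gamma_r r" "u = piece g" by auto
        have inW: "k \<in> W \<and> p = hmul g (s k)" if "(k, p) \<in> u" for k p
        proof -
          have x: "k \<in> K" "proj r p = f k" "hmul (- g) p \<in> V"
            using that g by (auto simp: piece_def E_def)
          have *: "proj r (hmul (- g) p) = f k"
            using Gamma_closed(3)[OF g(1)] x(2) proj_eq_iff by metis
          then have "k \<in> W" using x unfolding W_def by force
          moreover have "s k = hmul (- g) p" by (rule s_unique) fact+
          ultimately show ?thesis by simp
        qed
        have inu: "(k, hmul g (s k)) \<in> u" if "k \<in> W" for k
        proof -
          have "proj r (hmul g (s k)) = f k"
            using s[OF that] proj_eq_iff g by metis
          then show ?thesis using that s[OF that] g by (auto simp: piece_def E_def W_def)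
        qed
        have "homeomorphism u W fst (\<lambda>k. (k, hmul g (s k)))"
        proof (rule homeomorphismI)
          show "continuous_on u fst" by (intro continuous_intros)
          show "continuous_on W (\<lambda>k. (k, hmul g (s k)))" by (intro continuous_intros cont_s)
        qed (use inW inu in fastforce)+
        then show "\<exists>q. homeomorphism u W fst q" by blast
      qed
    qed
  qed
  \<comment> \<open>The identity of \<open>K\<close> is lifted: such a lift is a section of the
    pullback, and its second component is the wanted map.\<close>
  then obtain h where h: "continuous_on K h" "h \<in> K \<rightarrow> E" "\<And>k. k \<in> K \<Longrightarrow> fst (h k) = k"
    using covering_space_lift[of E fst K K "\<lambda>k. k"] convex_imp_simply_connected[OF K]
      convex_imp_locally_path_connected[OF K] by (metis continuous_on_id funcsetI)
  have "continuous_on K (snd \<circ> h)" using h by (intro continuous_on_compose continuous_intros)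
  moreover have "\<forall>k\<in>K. proj r ((snd \<circ> h) k) = f k"
    using h by (fastforce simp: E_def Pi_iff)
  ultimately show ?thesis by blast
qed

text \<open>The quotient of two lifts is a continuous map from a connected set into a countable one.
  A connected set with more than one point is uncountable, so the quotient is constant.\<close>

lemma lifts_differ_by_Gamma:
  assumes r: "r > 0" and K: "connected K" "K \<noteq> {}"
    and "continuous_on K g" "continuous_on K h"
    and eq: "\<And>k. k \<in> K \<Longrightarrow> proj r (g k) = proj r (h k)"
  shows "\<exists>\<gamma>\<in>Gamma_r r. \<forall>k\<in>K. h k = hmul \<gamma> (g k)"
proof -
  define d where "d = (\<lambda>k. hmul (h k) (- g k))"
  have d: "d k \<in> Gamma_r r" if k: "k \<in> K" for k
  proof -
    obtain \<gamma> where "\<gamma> \<in> Gamma_r r" "h k = hmul \<gamma> (g k)" using eq[OF k] by (auto simp: proj_eq_iff)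
    then show ?thesis by (simp add: d_def hmul_assoc)
  qed
  have "d constant_on K"
  proof -
    have "connected (d ` K)"
      unfolding d_def by (intro connected_continuous_image continuous_intros assms)
    moreover have "countable (d ` K)"
      using d by (intro countable_subset[OF _ countable_Gamma_r[of r]]) auto
    ultimately show ?thesis
      unfolding constant_on_def using connected_uncountable by (metis image_eqI)
  qed
  then obtain \<gamma> where \<gamma>: "\<And>k. k \<in> K \<Longrightarrow> d k = \<gamma>" by (auto simp: constant_on_def)
  have "\<gamma> \<in> Gamma_r r" using d \<gamma> K by auto
  moreover have "h k = hmul \<gamma> (g k)" if "k \<in> K" for k
    using \<gamma>[OF that, symmetric] by (simp add: d_def hmul_assoc)
  ultimately show ?thesis by blast
qed

section \<open>Homology classes of closed curves\<close>

definition simplex1_of :: "real \<Rightarrow> nat \<Rightarrow> real" where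
  "simplex1_of t = (\<lambda>i. if i = 0 then 1 - t else if i = 1 then t else 0)"

text \<open>Standard simplices consist of functions on \<open>nat\<close>, whereas
  \<open>lift_to_Heisenberg\<close> works over convex sets in a Euclidean space. The vertices 0, 1,
  2 correspond to \<open>(0, 0)\<close>, \<open>(1, 0)\<close>, \<open>(0, 1)\<close>.\<close>

definition simplex2_of :: "real \<times> real \<Rightarrow> nat \<Rightarrow> real" where
  "simplex2_of x = (\<lambda>i. if i = 0 then 1 - fst x - snd x else if i = 1 then fst x
     else if i = 2 then snd x else 0)"

definition simplex_triangle :: "(real \<times> real) set" where
  "simplex_triangle = {x. 0 \<le> fst x \<and> 0 \<le> snd x \<and> fst x + snd x \<le> 1}"

lemma simplex1_of_in: "t \<in> {0..1} \<Longrightarrow> simplex1_of t \<in> standard_simplex 1"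
  by (auto simp: standard_simplex_def simplex1_of_def)

lemma simplex2_of_in: "x \<in> simplex_triangle \<Longrightarrow> simplex2_of x \<in> standard_simplex 2"
  by (auto simp: standard_simplex_def simplex2_of_def simplex_triangle_def numeral_2_eq_2)

lemma continuous_map_simplex2_of:
  "continuous_map (top_of_set simplex_triangle) (subtopology (powertop_real UNIV) (standard_simplex 2)) simplex2_of"
proof -
  have "continuous_map (top_of_set simplex_triangle) (powertop_real UNIV) simplex2_of"
    unfolding continuous_map_componentwise_UNIV
  proof
    fix k :: nat
    consider "k = 0" | "k = 1" | "k = 2" | "k > 2" by linarith
    then show "continuous_map (top_of_set simplex_triangle) euclideanreal (\<lambda>t. simplex2_of t k)"
      by cases (simp_all add: simplex2_of_def continuous_intros)
  qed
  then show ?thesis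
    unfolding continuous_map_in_subtopology using simplex2_of_in by auto
qed

lemma convex_simplex_triangle: "convex simplex_triangle"
proof -
  have "simplex_triangle = fst -` {0..} \<inter> snd -` {0..} \<inter> (\<lambda>x. fst x + snd x) -` {..1}"
    by (auto simp: simplex_triangle_def)
  also have "convex \<dots>"
    by (intro convex_Int convex_linear_vimage linearI) (auto simp: algebra_simps)
  finally show ?thesis .
qed

text \<open>Face \<open>k\<close> omits vertex \<open>k\<close> and keeps the order of the other
  two, which fixes the direction in which each edge is traversed.\<close>

lemma singular_faces_on_edges:
  assumes "t \<in> {0..1}"
  shows "singular_face 2 0 \<tau> (simplex1_of t) = \<tau> (simplex2_of (1 - t, t))"
    "singular_face 2 1 \<tau> (simplex1_of t) = \<tau> (simplex2_of (0, t))"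
    "singular_face 2 2 \<tau> (simplex1_of t) = \<tau> (simplex2_of (t, 0))"
proof -
  have "simplical_face 0 (simplex1_of t) = simplex2_of (1 - t, t)"
    "simplical_face 1 (simplex1_of t) = simplex2_of (0, t)"
    "simplical_face 2 (simplex1_of t) = simplex2_of (t, 0)"
    by (auto simp: simplical_face_def simplex1_of_def simplex2_of_def fun_eq_iff)
  then show "singular_face 2 0 \<tau> (simplex1_of t) = \<tau> (simplex2_of (1 - t, t))"
    "singular_face 2 1 \<tau> (simplex1_of t) = \<tau> (simplex2_of (0, t))"
    "singular_face 2 2 \<tau> (simplex1_of t) = \<tau> (simplex2_of (t, 0))"
    using simplex1_of_in[OF assms] by (simp_all add: singular_face_def)
qed

definition path_simplex :: "(real \<Rightarrow> 'a) \<Rightarrow> (nat \<Rightarrow> real) \<Rightarrow> 'a" where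
  "path_simplex c = restrict (\<lambda>x. c (x 1)) (standard_simplex 1)"

lemma path_simplex_simplex1_of: "t \<in> {0..1} \<Longrightarrow> path_simplex c (simplex1_of t) = c t"
  using simplex1_of_in[of t] by (simp add: path_simplex_def simplex1_of_def)

lemma singular_simplex_path_simplex:
  assumes "pathin X c"
  shows "singular_simplex 1 X (path_simplex c)"
proof -
  have "continuous_map (subtopology (powertop_real UNIV) (standard_simplex 1)) (top_of_set {0..1}) (\<lambda>x. x 1)"
    unfolding continuous_map_in_subtopology
  proof
    show "continuous_map (subtopology (powertop_real UNIV) (standard_simplex 1)) euclideanreal (\<lambda>x. x 1)"
      by (intro continuous_map_from_subtopology continuous_map_product_projection) simp
  qed (auto simp: standard_simplex_def)
  from continuous_map_compose[OF this assms[unfolded pathin_def]]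
  have "continuous_map (subtopology (powertop_real UNIV) (standard_simplex 1)) X (\<lambda>x. c (x 1))"
    by (simp add: o_def)
  then show ?thesis
    unfolding singular_simplex_def path_simplex_def
    by (auto intro: continuous_map_eq)
qed

lemma homology_class_eq_one_iff:
  "homology_class X c = \<one>\<^bsub>homology_group 1 X\<^esub> \<longleftrightarrow> singular_relboundary 1 X {} (frag_of (path_simplex c))"
proof -
  have "\<one>\<^bsub>homology_group 1 X\<^esub> = homologous_rel_set 1 X {} 0"
    using one_relative_homology_group[of 1 X "{}"]
    by (simp add: homologous_rel_def singular_relboundary_minus)
  then show ?thesis
    unfolding homology_class_def path_simplex_def[symmetric]
    by (simp add: homologous_rel_set_eq) (simp add: homologous_rel_def)
qed

lemma chain_boundary_closed_path:
  assumes "c 0 = c 1"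
  shows "chain_boundary 1 (frag_of (path_simplex c)) = 0"
proof -
  have "singular_face 1 0 (path_simplex c) = singular_face 1 1 (path_simplex c)"
    unfolding singular_face_def
  proof (rule restrict_ext)
    fix x :: "nat \<Rightarrow> real" assume "x \<in> standard_simplex (1 - Suc 0)"
    then have x: "x = (\<lambda>i. if i = 0 then 1 else 0)"
      by (auto simp: standard_simplex_def fun_eq_iff)
    have "simplical_face 0 x = simplex1_of 1" "simplical_face 1 x = simplex1_of 0"
      by (auto simp: simplical_face_def simplex1_of_def x fun_eq_iff)
    then show "(path_simplex c \<circ> simplical_face 0) x = (path_simplex c \<circ> simplical_face 1) x"
      using assms by (simp add: path_simplex_simplex1_of)
  qed
  then show ?thesis by (simp add: chain_boundary_of)
qed

text \<open>The closed lift is a 1-cycle in a contractible space and thus a boundary; the quotient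
  map carries it and its filling to the given curve.\<close>

lemma null_homologous_if_lift_closed:
  fixes g :: "real \<Rightarrow> real^3"
  assumes g: "continuous_on {0..1} g" "g 0 = g 1" and eq: "\<And>t. t \<in> {0..1} \<Longrightarrow> proj r (g t) = c t"
  shows "homology_class (heis_manifold r) c = \<one>\<^bsub>homology_group 1 (heis_manifold r)\<^esub>"
proof -
  have "pathin euclidean g" using g by (simp add: pathin_def)
  then have "singular_simplex 1 euclidean (path_simplex g)" by (rule singular_simplex_path_simplex)
  then have "singular_relcycle 1 euclidean {} (frag_of (path_simplex g))"
    using chain_boundary_closed_path[of g] g by (simp add: singular_cycle singular_chain_of)
  then have "homology_class euclidean g \<in> carrier (homology_group 1 (euclidean :: (real^3) topology))"
    using carrier_relative_homology_group[of 1 "euclidean :: (real^3) topology" "{}"]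
    unfolding homology_class_def path_simplex_def[symmetric] by simp
  moreover have "trivial_group (homology_group 1 (euclidean :: (real^3) topology))"
    using trivial_reduced_homology_group_contractible_space[of "euclidean :: (real^3) topology" 1]
      contractible_space_top_of_set[of "UNIV :: (real^3) set"] convex_imp_contractible[of "UNIV :: (real^3) set"]
    by (simp add: un_reduced_homology_group)
  ultimately have "homology_class euclidean g = \<one>\<^bsub>homology_group 1 (euclidean :: (real^3) topology)\<^esub>"
    unfolding trivial_group_def by simp
  then have "singular_relboundary 1 euclidean {} (frag_of (path_simplex g))"
    by (simp add: homology_class_eq_one_iff)
  then have "singular_relboundary 1 (heis_manifold r) {} (chain_map 1 (proj r) (frag_of (path_simplex g)))"
    using continuous_map_proj by (rule singular_relboundary_chain_map) auto
  moreover have "simplex_map 1 (proj r) (path_simplex g) = path_simplex c"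
    unfolding simplex_map_def path_simplex_def
    using eq by (intro restrict_ext) (auto simp: standard_simplex_def)
  ultimately show ?thesis
    by (simp add: homology_class_eq_one_iff chain_map_of)
qed

text \<open>An integer valued function on the group whose increments change by multiples of \<open>m\<close> under the
  lattice yields a singular 1-cocycle modulo \<open>m\<close>: the increment along a lift of the simplex.\<close>

lemma lift_increment_dvd_if_null_homologous:
  fixes \<psi> :: "real^3 \<Rightarrow> int" and m :: int
  assumes r: "r > 0"
    and \<psi>: "\<And>\<gamma> p q. \<gamma> \<in> Gamma_r r \<Longrightarrow> m dvd (\<psi> (hmul \<gamma> p) - \<psi> p) - (\<psi> (hmul \<gamma> q) - \<psi> q)"
    and g: "continuous_on {0..1} g"
    and null: "homology_class (heis_manifold r) (\<lambda>t. proj r (g t)) = \<one>\<^bsub>homology_group 1 (heis_manifold r)\<^esub>"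
  shows "m dvd \<psi> (g 1) - \<psi> (g 0)"
proof -
  define lift where "lift = (\<lambda>\<sigma> h. continuous_on {0..1} h \<and> (\<forall>t\<in>{0..1}. proj r (h t) = \<sigma> (simplex1_of t)))"
  define \<Phi> where "\<Phi> = (\<lambda>\<sigma>. let h = SOME h. lift \<sigma> h in \<psi> (h 1) - \<psi> (h 0))"
  \<comment> \<open>Modulo \<open>m\<close> the choice of the lift does not matter, because two
    lifts differ by one fixed lattice element.\<close>
  have \<Phi>: "m dvd \<Phi> \<sigma> - (\<psi> (h 1) - \<psi> (h 0))" if h: "lift \<sigma> h" for \<sigma> h
  proof -
    define h' where "h' = (SOME h. lift \<sigma> h)"
    have h': "lift \<sigma> h'" unfolding h'_def using someI[of "lift \<sigma>", OF h] .
    have "\<exists>\<gamma>\<in>Gamma_r r. \<forall>k\<in>{0..1}. h' k = hmul \<gamma> (h k)"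
      by (rule lifts_differ_by_Gamma[OF r]) (use h h' in \<open>auto simp: lift_def\<close>)
    then obtain \<gamma> where "\<gamma> \<in> Gamma_r r" "\<And>k. k \<in> {0..1} \<Longrightarrow> h' k = hmul \<gamma> (h k)"
      by blast
    then have "m dvd (\<psi> (h' 1) - \<psi> (h 1)) - (\<psi> (h' 0) - \<psi> (h 0))" using \<psi> by simp
    then show ?thesis
      by (simp add: \<Phi>_def h'_def[symmetric] algebra_simps)
  qed
  \<comment> \<open>Linear extension of \<open>\<Phi>\<close> to singular chains, with the integers
    realised as the free abelian group on one generator.\<close>
  define F where "F = (\<lambda>x. Poly_Mapping.lookup (frag_extend (\<lambda>\<sigma>. frag_cmul (\<Phi> \<sigma>) (frag_of ())) x) ())"
  have F_diff: "F (x - y) = F x - F y" and F_0: "F 0 = 0" and F_of: "F (frag_of \<sigma>) = \<Phi> \<sigma>" for x y \<sigma>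
    by (simp_all add: F_def frag_extend_diff lookup_minus)
  have "m dvd F (chain_boundary 2 d)" if "singular_chain 2 (heis_manifold r) d" for d
    using that[unfolded singular_chain_def]
  proof (induction d rule: frag_induction)
    case zero
    then show ?case by (simp add: F_0)
  next
    case (one \<tau>)
    then have \<tau>: "singular_simplex 2 (heis_manifold r) \<tau>" by simp
    have "continuous_map (top_of_set simplex_triangle) (heis_manifold r) (\<tau> \<circ> simplex2_of)"
      using \<tau> unfolding singular_simplex_def
      by (intro continuous_map_compose[OF continuous_map_simplex2_of]) simp
    from lift_to_Heisenberg[OF r convex_simplex_triangle this]
    obtain G where G: "continuous_on simplex_triangle G" "\<And>k. k \<in> simplex_triangle \<Longrightarrow> proj r (G k) = (\<tau> \<circ> simplex2_of) k"
      by blast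
    \<comment> \<open>One lift \<open>G\<close> of the triangle restricts to lifts of all three
      edges, so their increments are, modulo \<open>m\<close>, differences of \<open>\<psi>\<close>
      at its corners and cancel in the alternating sum.\<close>
    have edge: "lift (singular_face 2 k \<tau>) (\<lambda>t. G (e t))"
      if "continuous_on {0..1} e" "\<And>t. t \<in> {0..1} \<Longrightarrow> e t \<in> simplex_triangle"
        "\<And>t. t \<in> {0..1} \<Longrightarrow> singular_face 2 k \<tau> (simplex1_of t) = \<tau> (simplex2_of (e t))" for k e
      unfolding lift_def using that G(2)
      by (auto intro!: continuous_on_compose2[OF G(1)])
    have "lift (singular_face 2 0 \<tau>) (\<lambda>t. G (1 - t, t))"
      by (rule edge) (auto simp: simplex_triangle_def singular_faces_on_edges intro!: continuous_intros)
    from \<Phi>[OF this] have f0: "m dvd \<Phi> (singular_face 2 0 \<tau>) - (\<psi> (G (0, 1)) - \<psi> (G (1, 0)))" by simp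
    have "lift (singular_face 2 1 \<tau>) (\<lambda>t. G (0, t))"
      by (rule edge) (auto simp: simplex_triangle_def singular_faces_on_edges[simplified] intro!: continuous_intros)
    from \<Phi>[OF this] have f1: "m dvd \<Phi> (singular_face 2 1 \<tau>) - (\<psi> (G (0, 1)) - \<psi> (G (0, 0)))" by simp
    have "lift (singular_face 2 2 \<tau>) (\<lambda>t. G (t, 0))"
      by (rule edge) (auto simp: simplex_triangle_def singular_faces_on_edges[simplified] intro!: continuous_intros)
    from \<Phi>[OF this] have f2: "m dvd \<Phi> (singular_face 2 2 \<tau>) - (\<psi> (G (1, 0)) - \<psi> (G (0, 0)))" by simp
    have "chain_boundary 2 (frag_of \<tau>) = frag_of (singular_face 2 0 \<tau>) -
        (frag_of (singular_face 2 1 \<tau>) - frag_of (singular_face 2 2 \<tau>))"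
      by (simp add: chain_boundary_of numeral_2_eq_2)
    then have "F (chain_boundary 2 (frag_of \<tau>)) =
        \<Phi> (singular_face 2 0 \<tau>) - (\<Phi> (singular_face 2 1 \<tau>) - \<Phi> (singular_face 2 2 \<tau>))"
      by (simp add: F_diff F_of)
    moreover have "m dvd (\<Phi> (singular_face 2 0 \<tau>) - (\<psi> (G (0, 1)) - \<psi> (G (1, 0))))
        - (\<Phi> (singular_face 2 1 \<tau>) - (\<psi> (G (0, 1)) - \<psi> (G (0, 0))))
        + (\<Phi> (singular_face 2 2 \<tau>) - (\<psi> (G (1, 0)) - \<psi> (G (0, 0))))"
      by (rule dvd_add[OF dvd_diff[OF f0 f1] f2])
    moreover have "\<Phi> (singular_face 2 0 \<tau>) - (\<Phi> (singular_face 2 1 \<tau>) - \<Phi> (singular_face 2 2 \<tau>)) =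
        (\<Phi> (singular_face 2 0 \<tau>) - (\<psi> (G (0, 1)) - \<psi> (G (1, 0))))
        - (\<Phi> (singular_face 2 1 \<tau>) - (\<psi> (G (0, 1)) - \<psi> (G (0, 0))))
        + (\<Phi> (singular_face 2 2 \<tau>) - (\<psi> (G (1, 0)) - \<psi> (G (0, 0))))" by simp
    ultimately show ?case by metis
  next
    case (diff a b)
    then show ?case by (simp add: chain_boundary_diff F_diff)
  qed
  moreover obtain d where "singular_chain 2 (heis_manifold r) d"
      "chain_boundary 2 d = frag_of (path_simplex (\<lambda>t. proj r (g t)))"
    using null unfolding homology_class_eq_one_iff singular_boundary by (auto simp: numeral_2_eq_2)
  ultimately have "m dvd \<Phi> (path_simplex (\<lambda>t. proj r (g t)))" using F_of by metis
  moreover have "lift (path_simplex (\<lambda>t. proj r (g t))) g"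
    using g by (simp add: lift_def path_simplex_simplex1_of)
  note \<Phi>[OF this]
  ultimately have "m dvd \<Phi> (path_simplex (\<lambda>t. proj r (g t))) -
      (\<Phi> (path_simplex (\<lambda>t. proj r (g t))) - (\<psi> (g 1) - \<psi> (g 0)))"
    by (rule dvd_diff)
  then show ?thesis by simp
qed

text \<open>Three invariants: the increments of \<open>\<lfloor>x / r\<rfloor>\<close> and
  \<open>\<lfloor>y\<rfloor>\<close> determine \<open>a\<close> and \<open>b\<close>, and that of a
  twisted height determines \<open>k\<close> modulo \<open>r\<close>. The cocycle lemma accepts
  discontinuous functions, so integer parts may be used.\<close>

lemma not_null_homologous:
  assumes r: "r > 0" and g: "continuous_on {0..1} g"
    and final: "g 1 = hmul (lat r a b k) (g 0)"
    and nz: "a \<noteq> 0 \<or> b \<noteq> 0 \<or> \<not> int r dvd k"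
  shows "homology_class (heis_manifold r) (\<lambda>t. proj r (g t)) \<noteq> \<one>\<^bsub>homology_group 1 (heis_manifold r)\<^esub>"
proof
  assume null: "homology_class (heis_manifold r) (\<lambda>t. proj r (g t)) = \<one>\<^bsub>homology_group 1 (heis_manifold r)\<^esub>"
  note dvd = lift_increment_dvd_if_null_homologous[OF r _ g null]
  have fl1: "\<lfloor>hmul (lat r a b k) p $ 1 / r\<rfloor> = a + \<lfloor>p $ 1 / r\<rfloor>" for a b k p
  proof -
    have "hmul (lat r a b k) p $ 1 / r = of_int a + p $ 1 / r" using r by (simp add: field_simps)
    then show ?thesis by simp
  qed
  have fl2: "\<lfloor>hmul (lat r a b k) p $ 2\<rfloor> = b + \<lfloor>p $ 2\<rfloor>" for a b k p
    by simp
  \<comment> \<open>\<open>p$3 + p$1 * p$2 / 2\<close> is the height \<open>w\<close> of a point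
    written as \<open>exp (y X2) exp (x X1) exp (w Z)\<close>. Translation by
    \<open>lat r a b k\<close> changes it by an integer plus \<open>r * a * p$2\<close>; the
    subtracted term absorbs this real part and leaves \<open>k\<close> up to a multiple of
    \<open>r\<close>.\<close>
  define \<psi> where "\<psi> = (\<lambda>p::real^3. \<lfloor>p $ 3 + p $ 1 * p $ 2 / 2 - real r * real_of_int \<lfloor>p $ 1 / r\<rfloor> * p $ 2\<rfloor>)"
  have fl3: "\<psi> (hmul (lat r a b k) p) = k - int r * \<lfloor>p $ 1 / r\<rfloor> * b + \<psi> p" for a b k p
  proof -
    have "hmul (lat r a b k) p $ 3 + hmul (lat r a b k) p $ 1 * hmul (lat r a b k) p $ 2 / 2
       - real r * real_of_int \<lfloor>hmul (lat r a b k) p $ 1 / r\<rfloor> * hmul (lat r a b k) p $ 2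
      = of_int (k - int r * \<lfloor>p $ 1 / r\<rfloor> * b) + (p $ 3 + p $ 1 * p $ 2 / 2 - real r * real_of_int \<lfloor>p $ 1 / r\<rfloor> * p $ 2)"
      unfolding fl1 by (simp add: field_simps)
    moreover have "\<lfloor>of_int z + y\<rfloor> = z + \<lfloor>y\<rfloor>" for z and y :: real by simp
    ultimately show ?thesis unfolding \<psi>_def by (simp only:)
  qed
  \<comment> \<open>Divisibility by 0 is equality, so \<open>m = 0\<close> turns the cocycle modulo
    \<open>m\<close> into an integral one.\<close>
  have "0 dvd \<lfloor>g 1 $ 1 / r\<rfloor> - \<lfloor>g 0 $ 1 / r\<rfloor>"
  proof (rule dvd[where \<psi> = "\<lambda>p. \<lfloor>p $ 1 / r\<rfloor>"])
    fix \<gamma> p q assume "\<gamma> \<in> Gamma_r r"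
    then obtain a b k where "\<gamma> = lat r a b k" by (auto simp: Gamma_r_eq)
    then show "0 dvd \<lfloor>hmul \<gamma> p $ 1 / r\<rfloor> - \<lfloor>p $ 1 / r\<rfloor> - (\<lfloor>hmul \<gamma> q $ 1 / r\<rfloor> - \<lfloor>q $ 1 / r\<rfloor>)"
      using fl1 by simp
  qed
  then have a: "a = 0" unfolding final fl1 by simp
  have "0 dvd \<lfloor>g 1 $ 2\<rfloor> - \<lfloor>g 0 $ 2\<rfloor>"
  proof (rule dvd[where \<psi> = "\<lambda>p. \<lfloor>p $ 2\<rfloor>"])
    fix \<gamma> p q assume "\<gamma> \<in> Gamma_r r"
    then obtain a b k where "\<gamma> = lat r a b k" by (auto simp: Gamma_r_eq)
    then show "0 dvd \<lfloor>hmul \<gamma> p $ 2\<rfloor> - \<lfloor>p $ 2\<rfloor> - (\<lfloor>hmul \<gamma> q $ 2\<rfloor> - \<lfloor>q $ 2\<rfloor>)"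
      using fl2 by simp
  qed
  then have b: "b = 0" unfolding final fl2 by simp
  have "int r dvd \<psi> (g 1) - \<psi> (g 0)"
  proof (rule dvd)
    fix \<gamma> p q assume "\<gamma> \<in> Gamma_r r"
    then obtain a b k where \<gamma>: "\<gamma> = lat r a b k" by (auto simp: Gamma_r_eq)
    have "\<psi> (hmul \<gamma> p) - \<psi> p - (\<psi> (hmul \<gamma> q) - \<psi> q) = int r * ((\<lfloor>q $ 1 / r\<rfloor> - \<lfloor>p $ 1 / r\<rfloor>) * b)"
      unfolding \<gamma> fl3 by (simp add: algebra_simps)
    then show "int r dvd \<psi> (hmul \<gamma> p) - \<psi> p - (\<psi> (hmul \<gamma> q) - \<psi> q)" by simp
  qed
  then have "int r dvd k" unfolding final fl3 b by simp
  then show False using nz a b by simp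
qed

section \<open>Chains and the isoperimetric inequality\<close>

definition cross2 :: "real^2 \<Rightarrow> real^2 \<Rightarrow> real" where
  "cross2 u v = u$1 * v$2 - u$2 * v$1"

text \<open>Lagrange's identity: the squares of cross and inner product add up to the product of the
  squared norms.\<close>

lemma abs_cross2_le: "\<bar>cross2 u v\<bar> \<le> norm u * norm v"
proof -
  have "(cross2 u v)\<^sup>2 \<le> (norm u)\<^sup>2 * (norm v)\<^sup>2"
  proof -
    have "(norm u)\<^sup>2 * (norm v)\<^sup>2 = (cross2 u v)\<^sup>2 + (u \<bullet> v)\<^sup>2"
      unfolding power2_norm_eq_inner by (simp add: cross2_def inner_vec_def sum_2 power2_eq_square algebra_simps)
    then show ?thesis by simp
  qed
  then have "\<bar>cross2 u v\<bar>\<^sup>2 \<le> (norm u * norm v)\<^sup>2" by (simp add: power_mult_distrib)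
  then show ?thesis by (rule power2_le_imp_le) simp
qed

lemma linear_cross2: "linear (cross2 u)"
  by (rule linearI) (simp_all add: cross2_def algebra_simps)

lemma cross2_simps:
  "cross2 u (v - w) = cross2 u v - cross2 u w" "cross2 (v - w) u = cross2 v u - cross2 w u" "cross2 u u = 0"
  by (simp_all add: cross2_def algebra_simps)

lemma linear_sr_coords: "linear (sr_coords A)"
proof -
  have "linear (\<lambda>u::real^3. vector [u$1, u$2] :: real^2)"
    by (rule linearI) (simp_all add: vec_eq_iff forall_2)
  from linear_compose[OF this matrix_vector_mul_linear[of "matrix_inv (tilde A)"]]
  show ?thesis by (simp add: sr_coords_def[abs_def] o_def)
qed

lemma sr_coords_diff: "sr_coords A (u - v) = sr_coords A u - sr_coords A v"
  and sr_coords_0 [simp]: "sr_coords A 0 = 0"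
  and sr_coords_minus: "sr_coords A (- u) = - sr_coords A u"
  and sr_coords_scaleR: "sr_coords A (t *\<^sub>R u) = t *\<^sub>R sr_coords A u"
  using linear_sr_coords[of A] by (simp_all add: linear_diff linear_0 linear_neg linear_cmul)

lemma sr_coords_cong: "u$1 = v$1 \<Longrightarrow> u$2 = v$2 \<Longrightarrow> sr_coords A u = sr_coords A v"
  by (simp add: sr_coords_def)

lemma sr_coords_hmul: "sr_coords A (hmul (- p) q) = sr_coords A q - sr_coords A p"
  unfolding sr_coords_diff[symmetric] by (rule sr_coords_cong) simp_all

lemma sr_norm_eq: "sr_norm A u = norm (sr_coords A u)"
  by (simp add: sr_norm_def sr_inner_def norm_eq_sqrt_inner)

lemma calA_inverse:
  assumes "A \<in> calA"
  shows "invertible (tilde A)" "det (tilde A) \<noteq> 0" "tilde A *v sr_coords A u = vector [u$1, u$2]"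
    "sr_coords A u = w \<longleftrightarrow> tilde A *v w = vector [u$1, u$2]"
proof -
  show inv: "invertible (tilde A)" using assms by (auto simp: calA_def)
  then show "det (tilde A) \<noteq> 0" by (simp add: invertible_det_nz)
  from inv have *: "tilde A ** matrix_inv (tilde A) = mat 1" "matrix_inv (tilde A) ** tilde A = mat 1"
    unfolding invertible_def matrix_inv_def by (metis (mono_tags, lifting) someI_ex)+
  then show "tilde A *v sr_coords A u = vector [u$1, u$2]"
    by (simp add: sr_coords_def matrix_vector_mul_assoc)
  then show "sr_coords A u = w \<longleftrightarrow> tilde A *v w = vector [u$1, u$2]"
    using *(2) by (metis matrix_vector_mul_assoc matrix_vector_mul_lid)
qed

text \<open>Passing to coordinates in the orthonormal basis \<open>A X1\<close>, \<open>A X2\<close>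
  divides areas by the determinant. Every comparison of heights with Euclidean areas goes through
  this identity.\<close>

lemma cross_eq_det_cross2:
  assumes "A \<in> calA"
  shows "u$1 * v$2 - u$2 * v$1 = det (tilde A) * cross2 (sr_coords A u) (sr_coords A v)"
proof -
  define U V where "U = sr_coords A u" "V = sr_coords A v"
  have "vector [u$1, u$2] = tilde A *v U" "vector [v$1, v$2] = tilde A *v V"
    using calA_inverse(3)[OF assms] by (simp_all add: U_V_def)
  then have "u$1 = (tilde A *v U)$1" "u$2 = (tilde A *v U)$2" "v$1 = (tilde A *v V)$1" "v$2 = (tilde A *v V)$2"
    by (metis vector_2)+
  then show ?thesis
    unfolding U_V_def[symmetric]
    by (simp add: cross2_def det_2 matrix_vector_mult_def sum_2 algebra_simps)
qed

text \<open>Discrete replacement for horizontal curves of length \<open>l\<close>: these chains are trivially closed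
  under concatenation, while the lower bounds for the length hold for them already.\<close>

inductive hchain :: "real^3^3 \<Rightarrow> real \<Rightarrow> real^3 \<Rightarrow> real^3 \<Rightarrow> real \<Rightarrow> bool"
  for A :: "real^3^3" and e :: real and p :: "real^3" where
  hchain_refl: "hchain A e p p 0"
| hchain_step: "hchain A e p q l \<Longrightarrow> 0 < h \<Longrightarrow> h \<le> e \<Longrightarrow> norm (sr_coords A (hmul (- q) s)) \<le> h \<Longrightarrow>
    \<bar>hmul (- q) s $ 3\<bar> \<le> \<bar>det (tilde A)\<bar> / 2 * h\<^sup>2 \<Longrightarrow> hchain A e p s (l + h)"

lemma hchain_trans:
  assumes "hchain A e q s l'" "hchain A e p q l"
  shows "hchain A e p s (l + l')"
  using assms
proof (induction)
  case hchain_refl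
  then show ?case by simp
next
  case (hchain_step s' l' h s)
  then have "hchain A e p s' (l + l')" by simp
  from hchain.hchain_step[OF this] hchain_step show ?case by (simp add: add.assoc)
qed

lemma hchain_left_mult:
  assumes "hchain A e p q l"
  shows "hchain A e (hmul g p) (hmul g q) l"
  using assms
proof (induction)
  case hchain_refl
  then show ?case by (rule hchain.hchain_refl)
next
  case (hchain_step q l h s)
  have "hmul (- hmul g q) (hmul g s) = hmul (- q) s"
    by (simp add: minus_hmul hmul_assoc)
  then show ?case
    using hchain_step.hyps by (intro hchain.hchain_step[OF hchain_step.IH]) (simp_all only:)
qed

lemma hchain_sym:
  assumes "hchain A e p q l"
  shows "hchain A e q p l"
  using assms
proof (induction)
  case hchain_refl
  then show ?case by (rule hchain.hchain_refl)
next
  case (hchain_step q l h s)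
  have "hmul (- s) q = - hmul (- q) s" by (simp add: minus_hmul)
  then have "hchain A e s q (0 + h)"
    using hchain_step.hyps by (intro hchain.hchain_step[OF hchain.hchain_refl])
      (simp_all only: sr_coords_minus norm_minus_cancel vector_uminus_component abs_minus_cancel)
  from hchain_trans[OF hchain_step.IH this] show ?case by (simp add: add.commute)
qed

lemma hchain_nonneg: "hchain A e p q l \<Longrightarrow> 0 \<le> l"
  by (induction rule: hchain.induct) auto

lemma hchain_projection:
  assumes "hchain A e p q l"
  shows "norm (sr_coords A (q - p)) \<le> l"
  using assms
proof (induction)
  case hchain_refl
  then show ?case by simp
next
  case (hchain_step q l h s)
  have "sr_coords A (s - p) = sr_coords A (q - p) + sr_coords A (hmul (- q) s)"
    by (simp add: sr_coords_diff sr_coords_hmul)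
  then have "norm (sr_coords A (s - p)) \<le> norm (sr_coords A (q - p)) + norm (sr_coords A (hmul (- q) s))"
    by (simp only: norm_triangle_ineq)
  then show ?case using hchain_step.IH hchain_step.hyps(4) by linarith
qed

section \<open>The isoperimetric inequality for chains\<close>

lemma x_cos_le_sin:
  assumes "0 \<le> x" "x \<le> pi"
  shows "x * cos x \<le> sin (x::real)"
proof -
  have "sin 0 - 0 * cos 0 \<le> sin x - x * cos x"
  proof (rule DERIV_nonneg_imp_nondecreasing[OF assms(1)])
    fix t assume t: "0 \<le> t" "t \<le> x"
    have "((\<lambda>t. sin t - t * cos t) has_real_derivative t * sin t) (at t)"
      by (auto intro!: derivative_eq_intros)
    moreover have "0 \<le> t * sin t" using t assms by (simp add: sin_ge_zero)
    ultimately show "\<exists>y. ((\<lambda>t. sin t - t * cos t) has_real_derivative y) (at t) \<and> 0 \<le> y" by blast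
  qed
  then show ?thesis by simp
qed

lemma cot_le_inverse:
  assumes "0 < x" "x < pi"
  shows "cot x \<le> 1 / x"
  using assms x_cos_le_sin[of x] sin_gt_zero[of x] by (simp add: cot_def field_simps)

text \<open>Up to the factor \<open>2 sin \<theta> sin \<phi> sin (\<theta> + \<phi>)\<close> the difference of the two sides is
  \<open>\<parallel>sin (\<theta> + \<phi>) u - sin \<theta> R v\<parallel>\<^sup>2\<close>, where \<open>R\<close> is the rotation by \<open>- \<phi>\<close>.\<close>

lemma cross2_le_cot_telescope:
  assumes "0 < \<theta>" "0 < \<phi>" "\<theta> + \<phi> < pi"
  shows "cross2 u v \<le> cot \<phi> / 2 * (norm (v - u))\<^sup>2 - cot (\<theta> + \<phi>) / 2 * (norm v)\<^sup>2 + cot \<theta> / 2 * (norm u)\<^sup>2"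
proof -
  define a b s c where "a = sin (\<theta> + \<phi>)" "b = sin \<theta>" "s = sin \<phi>" "c = cos \<phi>"
  have pos: "a > 0" "b > 0" "s > 0"
    using assms by (auto simp: a_b_s_c_def intro!: sin_gt_zero)
  have sc: "s\<^sup>2 + c\<^sup>2 = 1" by (simp add: a_b_s_c_def)
  have 1: "cot \<phi> + cot \<theta> = a / (s * b)"
    using pos by (simp add: a_b_s_c_def cot_def sin_add field_simps)
  have "b = sin ((\<theta> + \<phi>) - \<phi>)" by (simp add: a_b_s_c_def)
  then have "b = a * c - cos (\<theta> + \<phi>) * s" unfolding sin_diff a_b_s_c_def .
  then have 2: "cot \<phi> - cot (\<theta> + \<phi>) = b / (s * a)"
    using pos by (simp add: a_b_s_c_def cot_def field_simps)
  have 3: "cot \<phi> = c / s" by (simp add: a_b_s_c_def cot_def)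
  have nrm: "(norm w)\<^sup>2 = (w$1)\<^sup>2 + (w$2)\<^sup>2" for w :: "real^2"
    unfolding power2_norm_eq_inner by (simp add: inner_vec_def sum_2 power2_eq_square)
  have ident: "cot \<phi> * (norm (v - u))\<^sup>2 - cot (\<theta> + \<phi>) * (norm v)\<^sup>2 + cot \<theta> * (norm u)\<^sup>2 - 2 * cross2 u v
     = (cot \<phi> + cot \<theta>) * (norm u)\<^sup>2 + (cot \<phi> - cot (\<theta> + \<phi>)) * (norm v)\<^sup>2 - 2 * cot \<phi> * (u \<bullet> v) - 2 * cross2 u v"
    by (simp add: power2_norm_eq_inner inner_diff_left inner_diff_right inner_commute algebra_simps)
  have "0 \<le> (a * u$1 - b * (c * v$1 + s * v$2))\<^sup>2 + (a * u$2 - b * (c * v$2 - s * v$1))\<^sup>2"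
    by simp
  also have "\<dots> = a\<^sup>2 * (norm u)\<^sup>2 + b\<^sup>2 * (s\<^sup>2 + c\<^sup>2) * (norm v)\<^sup>2 - 2 * a * b * (c * (u \<bullet> v) + s * cross2 u v)"
    unfolding nrm by (simp add: cross2_def inner_vec_def sum_2 power2_eq_square algebra_simps)
  also have "\<dots> = s * a * b * (a / (s * b) * (norm u)\<^sup>2 + b / (s * a) * (norm v)\<^sup>2 - 2 * (c / s) * (u \<bullet> v) - 2 * cross2 u v)"
    using pos unfolding sc by (simp add: field_simps power2_eq_square)
  finally have "0 \<le> a / (s * b) * (norm u)\<^sup>2 + b / (s * a) * (norm v)\<^sup>2 - 2 * (c / s) * (u \<bullet> v) - 2 * cross2 u v"
    using pos by (meson mult_pos_neg mult_pos_pos not_less)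
  then have "0 \<le> (cot \<phi> + cot \<theta>) * (norm u)\<^sup>2 + (cot \<phi> - cot (\<theta> + \<phi>)) * (norm v)\<^sup>2 - 2 * cot \<phi> * (u \<bullet> v) - 2 * cross2 u v"
    unfolding 1 2 unfolding 3 .
  then show ?thesis unfolding ident[symmetric] by (simp add: field_simps)
qed

text \<open>The angle is proportional to the length travelled, and half its cotangent times the
  squared distance from the origin is a potential that telescopes by
  \<open>cross2_le_cot_telescope\<close>. On an arc of a circle of circumference \<open>L\<close>
  through the origin the estimate becomes an equality as \<open>\<eta>\<close> and \<open>e\<close>
  tend to 0. The offset \<open>\<eta>\<close> keeps the angle off the pole at 0, and
  \<open>\<eta> + l < L\<close> keeps it off the pole at \<open>pi\<close>.\<close>

lemma hchain_isoperimetric_step: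
  assumes A: "A \<in> calA" and "hchain A e 0 q l" "0 < \<eta>" "\<eta> + l < L"
  shows "2 * q$3 / det (tilde A) + cot (pi * (\<eta> + l) / L) / 2 * (norm (sr_coords A q))\<^sup>2
      \<le> l * L / (2 * pi) + e * l"
  using assms(2-)
proof (induction)
  case hchain_refl
  then show ?case by simp
next
  case (hchain_step q l h s)
  let ?d = "det (tilde A)" and ?u = "sr_coords A q" and ?v = "sr_coords A s"
  have d: "?d \<noteq> 0" by (rule calA_inverse(2)[OF A])
  have l: "0 \<le> l" using hchain_nonneg hchain_step by blast
  have L: "L > 0" using l hchain_step by simp
  define \<theta> \<phi> where "\<theta> = pi * (\<eta> + l) / L" "\<phi> = pi * h / L"
  have sum: "pi * (\<eta> + (l + h)) / L = \<theta> + \<phi>" by (simp add: \<theta>_\<phi>_def add_divide_distrib[symmetric] algebra_simps)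
  have pos: "0 < \<theta>" "0 < \<phi>" using L l hchain_step by (simp_all add: \<theta>_\<phi>_def)
  have "pi * (\<eta> + (l + h)) < pi * L" using hchain_step by (intro mult_strict_left_mono) auto
  then have lt: "\<theta> + \<phi> < pi" using L unfolding sum[symmetric] by (simp add: field_simps)
  \<comment> \<open>\<open>cot \<phi> \<le> 1 / \<phi>\<close> turns the chord of the step into its
    share \<open>h * L / (2 * pi)\<close> of the bound.\<close>
  have "cot \<phi> * (norm (?v - ?u))\<^sup>2 \<le> 1 / \<phi> * h\<^sup>2"
  proof -
    have "cot \<phi> * (norm (?v - ?u))\<^sup>2 \<le> 1 / \<phi> * (norm (?v - ?u))\<^sup>2"
      using cot_le_inverse[of \<phi>] pos lt by (intro mult_right_mono) auto
    also have "\<dots> \<le> 1 / \<phi> * h\<^sup>2"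
      using pos hchain_step(4) by (intro mult_left_mono power_mono) (auto simp: sr_coords_hmul)
    finally show ?thesis .
  qed
  also have "1 / \<phi> * h\<^sup>2 = h * L / pi"
    using hchain_step(2) L by (simp add: \<theta>_\<phi>_def power2_eq_square field_simps)
  finally have cot: "cot \<phi> / 2 * (norm (?v - ?u))\<^sup>2 \<le> h * L / (2 * pi)" by simp
  have "s$3 = q$3 + hmul (- q) s $ 3 + (q$1 * s$2 - q$2 * s$1) / 2"
    by (simp add: field_simps)
  also have "\<dots> = q$3 + hmul (- q) s $ 3 + ?d * cross2 ?u ?v / 2"
    by (simp only: cross_eq_det_cross2[OF A])
  finally have s3: "2 * s$3 / ?d = 2 * q$3 / ?d + 2 * hmul (- q) s $ 3 / ?d + cross2 ?u ?v"
    using d by (simp add: field_simps)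
  \<comment> \<open>The vertical error, quadratic in \<open>h\<close>, costs at most
    \<open>e * h\<close>; over the whole chain this sums to \<open>e * l\<close>.\<close>
  have "\<bar>2 * x / ?d\<bar> = \<bar>x\<bar> * 2 / \<bar>?d\<bar>" for x by (simp add: abs_mult)
  then have "\<bar>2 * hmul (- q) s $ 3 / ?d\<bar> = \<bar>hmul (- q) s $ 3\<bar> * 2 / \<bar>?d\<bar>" .
  also have "\<dots> \<le> (\<bar>?d\<bar> / 2 * h\<^sup>2) * 2 / \<bar>?d\<bar>"
    using hchain_step(5) by (intro divide_right_mono mult_right_mono) auto
  also have "\<dots> = h * h" using d by (simp add: power2_eq_square)
  also have "\<dots> \<le> e * h" using hchain_step(2,3) by (intro mult_right_mono) auto
  finally have err: "2 * hmul (- q) s $ 3 / ?d \<le> e * h" by linarith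
  have IH: "2 * q$3 / ?d + cot \<theta> / 2 * (norm ?u)\<^sup>2 \<le> l * L / (2 * pi) + e * l"
    using hchain_step unfolding \<theta>_\<phi>_def by simp
  have "(l + h) * L / (2 * pi) = l * L / (2 * pi) + h * L / (2 * pi)"
    by (simp add: field_simps)
  then show ?case
    using cross2_le_cot_telescope[OF pos lt, of ?u ?v] IH err s3 cot unfolding sum
    by (simp add: algebra_simps)
qed

text \<open>Where the projection closes up the potential vanishes and only the length term remains.
  Taking \<open>e = \<eta>\<close> and \<open>L = l + 2 * \<eta>\<close> respects the strict bound
  of the step lemma and tends to the sharp constant. The reversed chain, translated by
  \<open>- q\<close>, settles the other sign.\<close>

lemma hchain_isoperimetric:
  assumes A: "A \<in> calA" and ch: "\<And>e. e > 0 \<Longrightarrow> hchain A e 0 q l" and q: "q$1 = 0" "q$2 = 0"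
  shows "4 * pi * \<bar>q$3\<bar> \<le> \<bar>det (tilde A)\<bar> * l\<^sup>2"
proof -
  let ?d = "det (tilde A)"
  have d: "?d \<noteq> 0" by (rule calA_inverse(2)[OF A])
  have main: "2 * q$3 / ?d \<le> l * l / (2 * pi)"
    if ch: "\<And>e. e > 0 \<Longrightarrow> hchain A e 0 q l" and q: "q$1 = 0" "q$2 = 0" for q
  proof -
    have l: "l \<ge> 0" using ch[of 1] hchain_nonneg by auto
    have sr: "sr_coords A q = 0" using sr_coords_cong[of q 0 A] q by simp
    have *: "2 * q$3 / ?d \<le> l * (l + 2 * \<eta>) / (2 * pi) + \<eta> * l" if "\<eta> > 0" for \<eta>
      using hchain_isoperimetric_step[OF A ch[OF that] that, of "l + 2 * \<eta>"] sr that by simp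
    have "((\<lambda>\<eta>. l * (l + 2 * \<eta>) / (2 * pi) + \<eta> * l) \<longlongrightarrow> l * (l + 2 * 0) / (2 * pi) + 0 * l) (at_right 0)"
      by (intro tendsto_intros) auto
    then have "2 * q$3 / ?d \<le> l * (l + 2 * 0) / (2 * pi) + 0 * l"
      by (rule tendsto_lowerbound) (auto simp: eventually_at_right_less * eventually_at_filter)
    then show ?thesis by simp
  qed
  have "hchain A e 0 (- q) l" if "e > 0" for e
    using hchain_left_mult[OF hchain_sym[OF ch[OF that]], of "- q"] by simp
  from main[OF this] main[OF ch q] q
  have "\<bar>2 * q$3 / ?d\<bar> \<le> l * l / (2 * pi)" by (simp add: abs_le_iff)
  then show ?thesis using d by (simp add: field_simps power2_eq_square abs_mult)
qed

section \<open>Horizontal paths as chains\<close>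

lemma v0_nth_3: "x \<in> v0 \<Longrightarrow> x $ 3 = 0"
  unfolding v0_def by (induction rule: span_induct) (auto simp: subspace_def)

lemma mc_nth [simp]:
  "mc p w $ 1 = w $ 1" "mc p w $ 2 = w $ 2" "mc p w $ 3 = w $ 3 - (p $ 1 * w $ 2 - p $ 2 * w $ 1) / 2"
  by (simp_all add: mc_eq)

lemma in_v0_iff: "x \<in> v0 \<longleftrightarrow> x $ 3 = 0"
proof
  assume "x $ 3 = 0"
  then have "x = x $ 1 *\<^sub>R X1 + x $ 2 *\<^sub>R X2" by (simp add: vec3_eq_iff)
  also have "\<dots> \<in> v0"
    unfolding v0_def by (intro span_add span_scale span_base) auto
  finally show "x \<in> v0" .
qed (rule v0_nth_3)

lemma sr_norm_mc: "sr_norm A (mc p w) = norm (sr_coords A w)"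
  unfolding sr_norm_eq by (rule arg_cong[where f = norm]) (rule sr_coords_cong, simp_all)

text \<open>\<open>F\<close> is the arc length.\<close>

lemma horizontal_path_increments:
  assumes A: "A \<in> calA" and c: "horizontal_path c"
  obtains F where "continuous_on {0..1} F" "F 0 = 0" "F 1 = sr_length A c"
    "\<forall>s\<in>{0..1}. \<forall>t\<in>{0..1}. s \<le> t \<longrightarrow> norm (sr_coords A (hmul (- c s) (c t))) \<le> F t - F s \<and>
      \<bar>hmul (- c s) (c t) $ 3\<bar> \<le> \<bar>det (tilde A)\<bar> / 2 * (F t - F s)\<^sup>2"
proof -
  let ?d = "det (tilde A)"
  define D where "D = (\<lambda>t. vector_derivative c (at t within {0..1}))"
  obtain N where N: "N \<in> null_sets lebesgue" and
    Nc: "{t \<in> space lebesgue. \<not> (t \<in> {0..1} \<longrightarrow> (\<exists>w. (c has_vector_derivative w) (at t within {0..1}) \<and> mc (c t) w \<in> v0))} \<subseteq> N"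
    using c unfolding horizontal_path_def eventually_ae_filter by blast
  have negl: "negligible N" using N negligible_iff_null_sets by blast
  have D: "(c has_vector_derivative D t) (at t within {0..1})" "mc (c t) (D t) \<in> v0" if t: "t \<in> {0..1} - N" for t
  proof -
    from t Nc obtain w where w: "(c has_vector_derivative w) (at t within {0..1})" "mc (c t) w \<in> v0"
      by auto
    have "D t = w" unfolding D_def
      using t w(1) by (intro vector_derivative_within_closed_interval) auto
    then show "(c has_vector_derivative D t) (at t within {0..1})" "mc (c t) (D t) \<in> v0"
      using w by auto
  qed
  have ac: "abs_continuous_on_Icc 0 1 c" using c by (simp add: horizontal_path_def)
  have abs: "D absolutely_integrable_on {0..1}"
    by (rule abs_continuous_derivative_absolutely_integrable[OF ac _ negl D(1)]) auto
  have int: "(D has_integral (c t - c s)) {s..t}" if st: "0 \<le> s" "s \<le> t" "t \<le> 1" for s t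
  proof (rule fundamental_theorem_of_calculus_abs_continuous[OF _ _ negl])
    show "abs_continuous_on_Icc s t c" by (rule abs_continuous_on_Icc_subset[OF ac]) (use st in auto)
    show "(c has_vector_derivative D x) (at x within {s..t})" if "x \<in> {s..t} - N" for x
      using D(1)[of x] that st by (auto intro: has_vector_derivative_within_subset)
  qed (use st in auto)
  define w where "w = (\<lambda>t. sr_coords A (D t))"
  have "w absolutely_integrable_on {0..1}"
    using absolutely_integrable_linear[OF abs, of "sr_coords A"] linear_sr_coords
    by (simp add: w_def o_def linear_conv_bounded_linear)
  then have nint01: "(\<lambda>t. norm (w t)) integrable_on {0..1}" and nabs: "(\<lambda>t. norm (w t)) absolutely_integrable_on {0..1}"
    by (auto simp: absolutely_integrable_on_def absolutely_integrable_norm)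
  have nint: "(\<lambda>t. norm (w t)) integrable_on {s..t}" if "0 \<le> s" "t \<le> 1" for s t
    by (rule integrable_on_subinterval[OF nint01]) (use that in auto)
  have wint: "(w has_integral sr_coords A (c t - c s)) {s..t}" if "0 \<le> s" "s \<le> t" "t \<le> 1" for s t
    using has_integral_linear[OF int[OF that], of "sr_coords A"] linear_sr_coords
    by (simp add: w_def o_def linear_conv_bounded_linear)
  define F where "F = (\<lambda>t. integral {0..t} (\<lambda>t. norm (w t)))"
  have F_diff: "integral {s..t} (\<lambda>t. norm (w t)) = F t - F s" if "0 \<le> s" "s \<le> t" "t \<le> 1" for s t
    using Henstock_Kurzweil_Integration.integral_combine[of 0 s t "\<lambda>t. norm (w t)"] nint[of 0 t] that
    by (simp add: F_def)
  have norm_le: "norm (sr_coords A (c t - c s)) \<le> F t - F s" if "0 \<le> s" "s \<le> t" "t \<le> 1" for s t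
  proof -
    have "norm (integral {s..t} w) \<le> integral {s..t} (\<lambda>t. norm (w t))"
      using wint[OF that] nint[of s t] that by (intro integral_norm_bound_integral) auto
    then show ?thesis using wint[OF that] F_diff[OF that] by (simp add: integral_unique)
  qed
  have F_mono: "F s \<le> F t" if "0 \<le> s" "s \<le> t" "t \<le> 1" for s t
    using norm_le[OF that] norm_ge_zero[of "sr_coords A (c t - c s)"] by linarith
  \<comment> \<open>Seen from \<open>c s\<close>, the vertical velocity is \<open>?d / 2\<close>
    times the cross product of the displacement \<open>u \<tau> - u s\<close> with the horizontal
    velocity. The displacement is at most the arc length, whence a quadratic bound.\<close>
  have third: "\<bar>hmul (- c s) (c t) $ 3\<bar> \<le> \<bar>?d\<bar> / 2 * (F t - F s)\<^sup>2" if st: "0 \<le> s" "s \<le> t" "t \<le> 1" for s t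
  proof -
    define u where "u = (\<lambda>t. sr_coords A (c t))"
    define h where "h = (\<lambda>\<tau>. D \<tau> $ 3 - ?d / 2 * cross2 (u s) (w \<tau>))"
    have "((\<lambda>\<tau>. D \<tau> $ 3) has_integral (c t - c s) $ 3) {s..t}"
      using has_integral_linear[OF int[OF st], of "\<lambda>x. x $ 3"] by (simp add: o_def bounded_linear_vec_nth)
    moreover have "((\<lambda>\<tau>. cross2 (u s) (w \<tau>)) has_integral cross2 (u s) (sr_coords A (c t - c s))) {s..t}"
      using has_integral_linear[OF wint[OF st], of "cross2 (u s)"] linear_cross2
      by (simp add: o_def linear_conv_bounded_linear)
    ultimately have "(h has_integral ((c t - c s) $ 3 - ?d / 2 * cross2 (u s) (sr_coords A (c t - c s)))) {s..t}"
      unfolding h_def by (intro has_integral_diff has_integral_mult_right)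
    also have "(c t - c s) $ 3 - ?d / 2 * cross2 (u s) (sr_coords A (c t - c s)) = hmul (- c s) (c t) $ 3"
    proof -
      have "cross2 (u s) (sr_coords A (c t - c s)) = cross2 (u s) (u t)"
        by (simp add: sr_coords_diff cross2_simps u_def)
      then have "?d / 2 * cross2 (u s) (sr_coords A (c t - c s)) = (c s$1 * c t$2 - c s$2 * c t$1) / 2"
        unfolding cross_eq_det_cross2[OF A] u_def by simp
      then show ?thesis by (simp add: field_simps)
    qed
    finally have hint: "(h has_integral hmul (- c s) (c t) $ 3) {s..t}" .
    \<comment> \<open>On \<open>N\<close> horizontality may fail, so the integrand is set to 0
      there.\<close>
    define h' where "h' = (\<lambda>\<tau>. if \<tau> \<in> N then 0 else h \<tau>)"
    have h'int: "(h' has_integral hmul (- c s) (c t) $ 3) {s..t}"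
      by (rule has_integral_spike[OF negl _ hint]) (simp add: h'_def)
    have "norm (h' \<tau>) \<le> \<bar>?d\<bar> / 2 * (F t - F s) * norm (w \<tau>)" if \<tau>: "\<tau> \<in> {s..t}" for \<tau>
    proof (cases "\<tau> \<in> N")
      case True
      then show ?thesis using F_mono[OF st] by (simp add: h'_def)
    next
      case False
      then have "mc (c \<tau>) (D \<tau>) $ 3 = 0" using D(2)[of \<tau>] \<tau> st by (intro v0_nth_3) auto
      then have "D \<tau> $ 3 = (c \<tau>$1 * D \<tau>$2 - c \<tau>$2 * D \<tau>$1) / 2" by simp
      also have "\<dots> = ?d / 2 * cross2 (u \<tau>) (w \<tau>)"
        unfolding cross_eq_det_cross2[OF A] u_def w_def by simp
      finally have "h' \<tau> = ?d / 2 * cross2 (u \<tau> - u s) (w \<tau>)"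
        using False by (simp add: h'_def h_def cross2_simps algebra_simps)
      then have "norm (h' \<tau>) = \<bar>?d\<bar> / 2 * \<bar>cross2 (u \<tau> - u s) (w \<tau>)\<bar>"
        by (simp only: real_norm_def abs_mult abs_divide abs_numeral)
      also have "\<dots> \<le> \<bar>?d\<bar> / 2 * (norm (u \<tau> - u s) * norm (w \<tau>))"
        using abs_cross2_le by (intro mult_left_mono) auto
      also have "\<dots> \<le> \<bar>?d\<bar> / 2 * ((F t - F s) * norm (w \<tau>))"
      proof -
        have "norm (u \<tau> - u s) \<le> F \<tau> - F s" using norm_le[of s \<tau>] \<tau> st by (simp add: u_def sr_coords_diff)
        also have "\<dots> \<le> F t - F s" using F_mono[of \<tau> t] \<tau> st by simp
        finally show ?thesis by (intro mult_left_mono mult_right_mono) auto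
      qed
      finally show ?thesis by (simp add: mult.assoc)
    qed
    moreover have bint: "((\<lambda>\<tau>. \<bar>?d\<bar> / 2 * (F t - F s) * norm (w \<tau>)) has_integral \<bar>?d\<bar> / 2 * (F t - F s) * (F t - F s)) {s..t}"
      using nint[of s t] F_diff[OF st] st by (intro has_integral_mult_right) (auto simp: has_integral_integral)
    ultimately have "norm (integral {s..t} h') \<le> integral {s..t} (\<lambda>\<tau>. \<bar>?d\<bar> / 2 * (F t - F s) * norm (w \<tau>))"
      using h'int by (intro integral_norm_bound_integral) (auto simp: has_integral_integrable)
    then show ?thesis
      unfolding integral_unique[OF h'int] integral_unique[OF bint]
      by (simp only: real_norm_def power2_eq_square mult.assoc)
  qed
  show ?thesis
  proof
    show "continuous_on {0..1} F"
      unfolding F_def by (rule indefinite_integral_continuous_1[OF nint01])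
    show "F 0 = 0" by (simp add: F_def)
    have "sr_length A c = (LINT t:{0..1}|lebesgue. norm (w t))"
      unfolding sr_length_def sr_norm_mc w_def D_def ..
    also have "\<dots> = F 1"
      unfolding F_def by (rule set_lebesgue_integral_eq_integral(2)[OF nabs])
    finally show "F 1 = sr_length A c" ..
    show "\<forall>s\<in>{0..1}. \<forall>t\<in>{0..1}. s \<le> t \<longrightarrow> norm (sr_coords A (hmul (- c s) (c t))) \<le> F t - F s \<and>
      \<bar>hmul (- c s) (c t) $ 3\<bar> \<le> \<bar>det (tilde A)\<bar> / 2 * (F t - F s)\<^sup>2"
    proof (intro ballI impI conjI)
      fix s t :: real assume "s \<in> {0..1}" "t \<in> {0..1}" "s \<le> t"
      then have st: "0 \<le> s" "s \<le> t" "t \<le> 1" by auto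
      show "norm (sr_coords A (hmul (- c s) (c t))) \<le> F t - F s"
        using norm_le[OF st] unfolding sr_coords_hmul sr_coords_diff .
      show "\<bar>hmul (- c s) (c t) $ 3\<bar> \<le> \<bar>?d\<bar> / 2 * (F t - F s)\<^sup>2" by (rule third[OF st])
    qed
  qed
qed

lemma horizontal_path_hchain:
  assumes A: "A \<in> calA" and c: "horizontal_path c" and l: "sr_length A c < l" and e: "e > 0"
  shows "hchain A e (c 0) (c 1) l"
proof -
  obtain F where F: "continuous_on {0..1} F" "F 0 = 0" "F 1 = sr_length A c" and
    inc: "\<forall>s\<in>{0..1}. \<forall>t\<in>{0..1}. s \<le> t \<longrightarrow> norm (sr_coords A (hmul (- c s) (c t))) \<le> F t - F s \<and>
      \<bar>hmul (- c s) (c t) $ 3\<bar> \<le> \<bar>det (tilde A)\<bar> / 2 * (F t - F s)\<^sup>2"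
    by (rule horizontal_path_increments[OF A c]) blast
  \<comment> \<open>The surplus of \<open>l\<close> over the length is shared equally among the
    steps. This makes every \<open>h\<close> positive, even where the curve rests, and the total
    exactly \<open>l\<close>.\<close>
  define \<delta> where "\<delta> = l - sr_length A c"
  have \<delta>: "\<delta> > 0" using l by (simp add: \<delta>_def)
  have "uniformly_continuous_on {0..1} F" using F(1) by (rule compact_uniformly_continuous) simp
  then obtain \<eta> where \<eta>: "\<eta> > 0" "\<And>x y. x \<in> {0..1} \<Longrightarrow> y \<in> {0..1} \<Longrightarrow> dist y x < \<eta> \<Longrightarrow> dist (F y) (F x) < e / 2"
    unfolding uniformly_continuous_on_def using e by (metis half_gt_zero)
  obtain n :: nat where n: "n > 0" "1 / n < \<eta>" "\<delta> / n < e / 2"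
  proof -
    obtain m :: nat where m: "m > 1 / \<eta> + \<delta> / (e / 2)" using reals_Archimedean2 by blast
    have "0 \<le> \<delta> / (e / 2)" "0 < 1 / \<eta>" using \<delta> e \<eta> by auto
    then have "m > 1 / \<eta>" "m > \<delta> / (e / 2)" "0 < real m" using m by linarith+
    then show ?thesis using that[of m] \<eta>(1) e by (simp add: field_simps)
  qed
  have "hchain A e (c 0) (c (i / n)) (F (i / n) + i * (\<delta> / n))" if "i \<le> n" for i
    using that
  proof (induction i)
    case 0
    then show ?case using F by (simp add: hchain_refl)
  next
    case (Suc i)
    let ?s = "i / n" and ?t = "Suc i / n"
    have st: "?s \<in> {0..1}" "?t \<in> {0..1}" "?s \<le> ?t" "?t - ?s = 1 / n"
      using Suc n by (auto simp: field_simps)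
    define h where "h = F ?t - F ?s + \<delta> / n"
    have 1: "norm (sr_coords A (hmul (- c ?s) (c ?t))) \<le> F ?t - F ?s"
      "\<bar>hmul (- c ?s) (c ?t) $ 3\<bar> \<le> \<bar>det (tilde A)\<bar> / 2 * (F ?t - F ?s)\<^sup>2"
      using inc st by blast+
    then have ge: "0 \<le> F ?t - F ?s" using norm_ge_zero order_trans by blast
    have "hchain A e (c 0) (c ?t) (F ?s + i * (\<delta> / n) + h)"
    proof (rule hchain_step)
      show "hchain A e (c 0) (c ?s) (F ?s + i * (\<delta> / n))" using Suc by simp
      show "0 < h" using ge \<delta> n by (simp add: h_def add_nonneg_pos)
      have "dist (F ?t) (F ?s) < e / 2" using st n by (intro \<eta>(2)) (auto simp: dist_real_def)
      then show "h \<le> e" using n(3) unfolding h_def dist_real_def by linarith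
      have h: "F ?t - F ?s \<le> h" using \<delta> by (simp add: h_def)
      then show "norm (sr_coords A (hmul (- c ?s) (c ?t))) \<le> h" using 1 by linarith
      have "\<bar>det (tilde A)\<bar> / 2 * (F ?t - F ?s)\<^sup>2 \<le> \<bar>det (tilde A)\<bar> / 2 * h\<^sup>2"
        using h ge by (intro mult_left_mono power_mono) auto
      then show "\<bar>hmul (- c ?s) (c ?t) $ 3\<bar> \<le> \<bar>det (tilde A)\<bar> / 2 * h\<^sup>2" using 1 by linarith
    qed
    moreover have "F ?s + i * (\<delta> / n) + h = F ?t + Suc i * (\<delta> / n)"
      by (simp add: h_def add_divide_distrib algebra_simps)
    ultimately show ?case by (simp only:)
  qed
  from this[of n] show ?thesis using n F by (simp add: \<delta>_def)
qed

text \<open>A connecting path is assumed because an infimum over the empty set would carry no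
  information; \<open>horizontal_path_exists\<close> supplies one later.\<close>

lemma sr_dist_less_imp_hchain:
  assumes A: "A \<in> calA" and ne: "\<exists>c. horizontal_path c \<and> c 0 = p \<and> c 1 = q"
    and l: "sr_dist A p q < l" and e: "e > 0"
  shows "hchain A e p q l"
proof -
  have "{sr_length A c | c. horizontal_path c \<and> c 0 = p \<and> c 1 = q} \<noteq> {}" using ne by blast
  from cInf_lessD[OF this l[unfolded sr_dist_def]]
  obtain c where "horizontal_path c" "c 0 = p" "c 1 = q" "sr_length A c < l" by blast
  then show ?thesis using horizontal_path_hchain[OF A _ _ e] by metis
qed

lemma sr_length_nonneg: "0 \<le> sr_length A c"
  unfolding sr_length_def set_lebesgue_integral_def
  by (rule Bochner_Integration.integral_nonneg) (simp add: sr_norm_eq)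

lemma sr_dist_le:
  assumes "horizontal_path c"
  shows "sr_dist A (c 0) (c 1) \<le> sr_length A c"
  unfolding sr_dist_def
proof (rule cInf_lower)
  show "bdd_below {sr_length A c' |c'. horizontal_path c' \<and> c' 0 = c 0 \<and> c' 1 = c 1}"
    by (rule bdd_belowI[of _ 0]) (use sr_length_nonneg in blast)
qed (use assms in blast)

section \<open>The systole of the base torus\<close>

lemma P0_Gamma_r: "P0 ` Gamma_r r = {(real r * of_int a) *\<^sub>R X1 + of_int b *\<^sub>R X2 | a b. True}"
proof (intro equalityI subsetI)
  fix x assume "x \<in> P0 ` Gamma_r r"
  then obtain a b k where "x = P0 (lat r a b k)" by (auto simp: Gamma_r_eq)
  then have "x = (real r * of_int a) *\<^sub>R X1 + of_int b *\<^sub>R X2" by (simp add: P0_def hlog_def)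
  then show "x \<in> {(real r * of_int a) *\<^sub>R X1 + of_int b *\<^sub>R X2 | a b. True}" by blast
next
  fix x assume "x \<in> {(real r * of_int a) *\<^sub>R X1 + of_int b *\<^sub>R X2 | a b. True}"
  then obtain a b where "x = (real r * of_int a) *\<^sub>R X1 + of_int b *\<^sub>R X2" by blast
  then have "x = P0 (lat r a b 0)" by (simp add: P0_def hlog_def)
  then show "x \<in> P0 ` Gamma_r r" by blast
qed

definition base_vec :: "real^3^3 \<Rightarrow> nat \<Rightarrow> int \<Rightarrow> int \<Rightarrow> real^2" where
  "base_vec A r a b = sr_coords A ((real r * of_int a) *\<^sub>R X1 + of_int b *\<^sub>R X2)"

lemma base_vec_lat: "base_vec A r a b = sr_coords A (lat r a b k)"
  unfolding base_vec_def by (rule sr_coords_cong) simp_all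

lemma base_vec_add: "base_vec A r (a + a') (b + b') = base_vec A r a b + base_vec A r a' b'"
proof -
  have "sr_coords A (u + v) = sr_coords A u + sr_coords A v" for u v
    using linear_sr_coords by (rule linear_add)
  then show ?thesis by (simp add: base_vec_def distrib_left scaleR_add_left)
qed

lemma base_vec_scale: "base_vec A r (k * a) (k * b) = of_int k *\<^sub>R base_vec A r a b"
  unfolding base_vec_def sr_coords_scaleR[symmetric] by (simp add: algebra_simps)

lemma cross2_base_vec:
  assumes "A \<in> calA"
  shows "cross2 (base_vec A r a b) (base_vec A r c d) = real r * of_int (a * d - b * c) / det (tilde A)"
proof -
  have "det (tilde A) * cross2 (base_vec A r a b) (base_vec A r c d) = real r * of_int (a * d - b * c)"
    unfolding base_vec_def cross_eq_det_cross2[OF assms, symmetric] by (simp add: algebra_simps)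
  then show ?thesis using calA_inverse(2)[OF assms] by (simp add: field_simps)
qed

lemma base_vec_eq_0_iff:
  assumes "A \<in> calA" "r > 0"
  shows "base_vec A r a b = 0 \<longleftrightarrow> a = 0 \<and> b = 0"
proof
  assume 0: "base_vec A r a b = 0"
  have "cross2 (base_vec A r a b) (base_vec A r 0 1) = 0" "cross2 (base_vec A r a b) (base_vec A r 1 0) = 0"
    by (simp_all add: 0 cross2_def)
  then show "a = 0 \<and> b = 0"
    unfolding cross2_base_vec[OF assms(1)] using assms calA_inverse(2)[OF assms(1)] by simp
next
  assume "a = 0 \<and> b = 0"
  then show "base_vec A r a b = 0" by (simp add: base_vec_def)
qed

text \<open>Cramer's rule: the cross products with the two basis vectors recover \<open>a\<close>
  and \<open>b\<close> up to a constant factor, so a bound on the norm bounds both.\<close>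

lemma finite_base_vec:
  assumes A: "A \<in> calA" and r: "r > 0"
  shows "finite {(a, b). norm (base_vec A r a b) \<le> M}"
proof -
  define d where "d = \<bar>det (tilde A)\<bar>"
  have d: "d > 0" using calA_inverse(2)[OF A] by (simp add: d_def)
  define m where "m = \<lceil>d * M * (norm (base_vec A r 0 1) + norm (base_vec A r 1 0))\<rceil>"
  have "{(a, b). norm (base_vec A r a b) \<le> M} \<subseteq> {-m..m} \<times> {-m..m}"
  proof clarify
    fix a b assume M: "norm (base_vec A r a b) \<le> M"
    then have "0 \<le> M" using norm_ge_zero order_trans by blast
    have est: "\<bar>real_of_int k\<bar> \<le> d * M * norm v"
      if "cross2 (base_vec A r a b) v = real r * of_int k / det (tilde A)" for k v
    proof -
      have "real r * \<bar>real_of_int k\<bar> / d \<le> norm (base_vec A r a b) * norm v"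
        using abs_cross2_le[of "base_vec A r a b" v] unfolding that by (simp add: d_def abs_mult)
      also have "\<dots> \<le> M * norm v" using M by (intro mult_right_mono) auto
      finally have "real r * \<bar>real_of_int k\<bar> \<le> d * M * norm v" using d by (simp add: field_simps)
      moreover have "1 * \<bar>real_of_int k\<bar> \<le> real r * \<bar>real_of_int k\<bar>" using r by (intro mult_right_mono) auto
      ultimately show ?thesis by simp
    qed
    have "\<bar>real_of_int a\<bar> \<le> d * M * norm (base_vec A r 0 1)"
      by (rule est) (simp add: cross2_base_vec[OF A])
    also have "\<dots> \<le> d * M * (norm (base_vec A r 0 1) + norm (base_vec A r 1 0))"
      using d \<open>0 \<le> M\<close> by (intro mult_left_mono) auto
    finally have "\<bar>a\<bar> \<le> m" unfolding m_def by linarith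
    have "\<bar>real_of_int (- b)\<bar> \<le> d * M * norm (base_vec A r 1 0)"
      by (rule est) (simp add: cross2_base_vec[OF A])
    also have "\<dots> \<le> d * M * (norm (base_vec A r 0 1) + norm (base_vec A r 1 0))"
      using d \<open>0 \<le> M\<close> by (intro mult_left_mono) auto
    finally have "\<bar>b\<bar> \<le> m" unfolding m_def by linarith
    with \<open>\<bar>a\<bar> \<le> m\<close> show "a \<in> {-m..m} \<and> b \<in> {-m..m}" by auto
  qed
  then show ?thesis by (rule finite_subset) simp
qed

lemma s1_set: "A \<in> calA \<Longrightarrow> r > 0 \<Longrightarrow>
  sr_norm A ` (P0 ` Gamma_r r - {0}) = {norm (base_vec A r a b) | a b. \<not> (a = 0 \<and> b = 0)}"
proof -
  assume A: "A \<in> calA" "r > 0"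
  have "(real r * of_int a) *\<^sub>R X1 + of_int b *\<^sub>R X2 = 0 \<longleftrightarrow> a = 0 \<and> b = 0" for a b
    using A by (auto simp: vec3_eq_iff)
  then show ?thesis
    unfolding P0_Gamma_r by (auto simp: sr_norm_eq base_vec_def) (blast, force)
qed

text \<open>Only finitely many lattice vectors are no longer than a fixed one, so the
  \<open>LEAST\<close> in \<open>s1\<close> denotes a genuine minimum.\<close>

lemma s1_attained:
  assumes A: "A \<in> calA" and r: "r > 0"
  obtains a b where "\<not> (a = 0 \<and> b = 0)" "s1 r A = norm (base_vec A r a b)"
    "\<And>a' b'. \<not> (a' = 0 \<and> b' = 0) \<Longrightarrow> s1 r A \<le> norm (base_vec A r a' b')"
proof -
  let ?S = "{norm (base_vec A r a b) | a b. \<not> (a = 0 \<and> b = 0)}"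
  define M where "M = norm (base_vec A r 1 0)"
  define F where "F = {x \<in> ?S. x \<le> M}"
  have "F \<subseteq> (\<lambda>(a, b). norm (base_vec A r a b)) ` {(a, b). norm (base_vec A r a b) \<le> M}"
    by (force simp: F_def)
  then have fin: "finite F" using finite_base_vec[OF A r] by (meson finite_imageI finite_subset)
  have ne: "M \<in> F" unfolding F_def M_def by force
  have min: "Min F \<in> ?S" using Min_in[OF fin] ne unfolding F_def by blast
  have le: "Min F \<le> x" if "x \<in> ?S" for x
  proof (cases "x \<le> M")
    case True
    then show ?thesis using fin that by (intro Min_le) (auto simp: F_def)
  next
    case False
    then show ?thesis using Min_le[OF fin ne] by simp
  qed
  have "s1 r A = Min F"
    unfolding s1_def s1_set[OF A r] by (rule Least_equality) (use min le in auto)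
  moreover from min obtain a b where "\<not> (a = 0 \<and> b = 0)" "Min F = norm (base_vec A r a b)" by blast
  ultimately show ?thesis using le by (intro that[of a b]) auto
qed

text \<open>Hermite's reduction: complete a shortest vector to a basis and shift the second basis vector
  along the first one until their inner product is at most half the squared norm of the first.\<close>

lemma s1_systolic_inequality:
  assumes A: "A \<in> calA" and r: "r > 0"
  shows "s1 r A \<le> C2 * sqrt (real r * inverse \<bar>det (tilde A)\<bar>)"
proof -
  define d where "d = \<bar>det (tilde A)\<bar>"
  have d: "d > 0" using calA_inverse(2)[OF A] by (simp add: d_def)
  obtain a b where ab: "\<not> (a = 0 \<and> b = 0)" "s1 r A = norm (base_vec A r a b)"
    "\<And>a' b'. \<not> (a' = 0 \<and> b' = 0) \<Longrightarrow> s1 r A \<le> norm (base_vec A r a' b')"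
    by (rule s1_attained[OF A r]) blast
  define u where "u = base_vec A r a b"
  have u: "norm u > 0" using ab(1) base_vec_eq_0_iff[OF A r] by (simp add: u_def)
  \<comment> \<open>A common factor \<open>g \<ge> 2\<close> could be divided out, giving a shorter
    nonzero lattice vector.\<close>
  have "coprime a b"
  proof (rule ccontr)
    assume nc: "\<not> coprime a b"
    define g where "g = gcd a b"
    have g0: "g \<noteq> 0" using ab(1) by (simp add: g_def)
    have "g \<noteq> 1" using nc by (simp add: g_def coprime_iff_gcd_eq_1)
    moreover have "g \<ge> 0" by (simp add: g_def)
    ultimately have g: "g \<ge> 2" using g0 by linarith
    obtain a' b' where ab': "a = g * a'" "b = g * b'" unfolding g_def by (meson dvdE gcd_dvd1 gcd_dvd2)
    have "norm u = g * norm (base_vec A r a' b')"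
      using g by (simp add: u_def ab' base_vec_scale)
    moreover have "norm u \<le> norm (base_vec A r a' b')"
      using ab(3)[of a' b'] ab(1,2) by (auto simp: u_def ab')
    moreover have "2 * norm (base_vec A r a' b') \<le> g * norm (base_vec A r a' b')"
      using g by (intro mult_right_mono) auto
    ultimately show False using u by linarith
  qed
  then obtain x y where xy: "a * x + b * y = 1" using bezout_int[of a b] by (auto simp: mult.commute)
  \<comment> \<open>The Bezout coefficients complete \<open>(a, b)\<close> to a basis: the
    determinant of \<open>(a, b)\<close> and \<open>(- y, x)\<close> is 1.\<close>
  define v where "v = base_vec A r (- y) x"
  define k where "k = round ((v \<bullet> u) / (norm u)\<^sup>2)"
  define w where "w = base_vec A r (- y - k * a) (x - k * b)"
  have w: "w = v - of_int k *\<^sub>R u"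
    using base_vec_add[of A r "- y" "(-k) * a" x "(-k) * b"] base_vec_scale[of A r "-k" a b]
    by (simp add: w_def v_def u_def)
  have "cross2 u w = real r / det (tilde A)"
  proof -
    have "a * (x - k * b) - b * (- y - k * a) = 1" using xy by (simp add: algebra_simps)
    then show ?thesis unfolding u_def w_def cross2_base_vec[OF A] by simp
  qed
  then have area: "(cross2 u w)\<^sup>2 = (real r / d)\<^sup>2" by (simp add: d_def power_divide)
  have "\<not> (- y - k * a = 0 \<and> x - k * b = 0)"
  proof
    assume "- y - k * a = 0 \<and> x - k * b = 0"
    then have "y = - k * a" "x = k * b" by auto
    then show False using xy by (simp add: algebra_simps)
  qed
  then have uw: "norm u \<le> norm w" using ab(2,3) by (simp add: u_def w_def)
  define q where "q = (v \<bullet> u) / (norm u)\<^sup>2"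
  have "w \<bullet> u = (q - of_int k) * (norm u)\<^sup>2"
    using u by (simp add: w q_def inner_diff_left power2_norm_eq_inner field_simps)
  then have "(w \<bullet> u)\<^sup>2 = (q - of_int k)\<^sup>2 * (norm u)\<^sup>2 * (norm u)\<^sup>2" by (simp add: power2_eq_square)
  also have "(q - of_int k)\<^sup>2 \<le> (1/2)\<^sup>2"
    using of_int_round_abs_le[of q] unfolding k_def q_def[symmetric]
    by (intro abs_le_square_iff[THEN iffD1]) (simp add: abs_minus_commute)
  then have "(q - of_int k)\<^sup>2 * (norm u)\<^sup>2 * (norm u)\<^sup>2 \<le> (1/2)\<^sup>2 * (norm u)\<^sup>2 * (norm u)\<^sup>2"
    by (intro mult_right_mono) auto
  finally have inner: "(w \<bullet> u)\<^sup>2 \<le> 1/4 * (norm u)\<^sup>2 * (norm u)\<^sup>2" by (simp add: power2_eq_square)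
  \<comment> \<open>Minimality of \<open>u\<close> against the reduced vector \<open>w\<close>, then
    Lagrange's identity. The inner product absorbs at most a quarter of the left side, and the
    remaining 3/4 produces \<open>C2\<^sup>2 = 2 / sqrt 3\<close>.\<close>
  have "(norm u)\<^sup>2 * (norm u)\<^sup>2 \<le> (norm u)\<^sup>2 * (norm w)\<^sup>2"
    using uw by (intro mult_left_mono power_mono) auto
  also have "\<dots> = (cross2 u w)\<^sup>2 + (w \<bullet> u)\<^sup>2"
    unfolding power2_norm_eq_inner by (simp add: cross2_def inner_vec_def sum_2 power2_eq_square algebra_simps)
  finally have "3/4 * ((norm u)\<^sup>2)\<^sup>2 \<le> (real r / d)\<^sup>2" 
    using inner area unfolding power2_eq_square[of "(norm u)\<^sup>2"] by linarith
  then have "((norm u)\<^sup>2)\<^sup>2 \<le> 4/3 * (real r / d)\<^sup>2" by simp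
  also have "\<dots> = (2 / sqrt 3 * (real r / d))\<^sup>2" by (simp add: power_mult_distrib power_divide)
  finally have "(norm u)\<^sup>2 \<le> 2 / sqrt 3 * (real r / d)"
    by (rule power2_le_imp_le) (use d in simp)
  then have "sqrt ((norm u)\<^sup>2) \<le> sqrt (2 / sqrt 3 * (real r / d))" by (rule real_sqrt_le_mono)
  then have "norm u \<le> C2 * sqrt (real r / d)" unfolding C2_def real_sqrt_mult[symmetric] by simp
  then show ?thesis using ab(2) by (simp add: u_def d_def divide_inverse)
qed

section \<open>Explicit horizontal paths\<close>

lemma lipschitz_imp_abs_continuous:
  assumes "\<And>s t. a \<le> s \<Longrightarrow> s \<le> t \<Longrightarrow> t \<le> b \<Longrightarrow> dist (c s) (c t) \<le> L * (t - s)"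
  shows "abs_continuous_on_Icc a b c"
  unfolding abs_continuous_on_Icc_iff_modulus
proof (intro allI impI)
  fix e :: real assume e: "e > 0"
  \<comment> \<open>The maximum with 1 keeps the divisor in \<open>e / L'\<close> positive for every
    \<open>L\<close>.\<close>
  define L' where "L' = max L 1"
  have L': "L' > 0" "L \<le> L'" by (simp_all add: L'_def)
  have "abs_continuity_modulus a b c e (e / L')"
    unfolding abs_continuity_modulus_def
  proof (intro allI impI, elim conjE)
    fix n :: nat and s t
    assume st: "\<forall>i<n. a \<le> s i \<and> s i \<le> t i \<and> t i \<le> b" and small: "(\<Sum>i<n. t i - s i) < e / L'"
    have "(\<Sum>i<n. dist (c (s i)) (c (t i))) \<le> (\<Sum>i<n. L' * (t i - s i))"
    proof (rule sum_mono)
      fix i assume "i \<in> {..<n}"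
      then have "dist (c (s i)) (c (t i)) \<le> L * (t i - s i)" "s i \<le> t i" using assms st by auto
      moreover have "L * (t i - s i) \<le> L' * (t i - s i)"
        using L' \<open>s i \<le> t i\<close> by (intro mult_right_mono) auto
      ultimately show "dist (c (s i)) (c (t i)) \<le> L' * (t i - s i)" by linarith
    qed
    also have "\<dots> = L' * (\<Sum>i<n. t i - s i)" by (simp add: sum_distrib_left)
    also have "\<dots> < e" using small L' by (simp add: field_simps)
    finally show "(\<Sum>i<n. dist (c (s i)) (c (t i))) < e" .
  qed
  then show "\<exists>d>0. abs_continuity_modulus a b c e d" using e L' by (intro exI[of _ "e / L'"]) auto
qed

text \<open>An affine change of parameter makes a path on \<open>{0..1}\<close> out of the arc
  between any two times of one globally defined curve. The case \<open>a = b\<close> occurs, since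
  partitions in \<open>curve_length\<close> may repeat points.\<close>

lemma C1_horizontal_path:
  assumes ab: "a \<le> b"
    and c: "\<And>t. (c has_vector_derivative c' t) (at t)" and cont: "continuous_on UNIV c'"
    and hor: "\<And>t. mc (c t) (c' t) \<in> v0" and speed: "\<And>t. norm (sr_coords A (c' t)) \<le> l"
  shows "\<exists>\<gamma>. horizontal_path \<gamma> \<and> \<gamma> 0 = c a \<and> \<gamma> 1 = c b \<and> sr_length A \<gamma> \<le> (b - a) * l"
proof (intro exI conjI)
  define \<gamma> where "\<gamma> = (\<lambda>t. c (a + t * (b - a)))"
  define \<gamma>' where "\<gamma>' = (\<lambda>t. (b - a) *\<^sub>R c' (a + t * (b - a)))"
  show "\<gamma> 0 = c a" "\<gamma> 1 = c b" by (simp_all add: \<gamma>_def)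
  have d: "(\<gamma> has_vector_derivative \<gamma>' t) (at t within S)" for t S
  proof -
    have "((\<lambda>t. a + t * (b - a)) has_vector_derivative (b - a)) (at t within S)"
      by (auto intro!: derivative_eq_intros simp: has_vector_derivative_def)
    from vector_diff_chain_within[OF this has_vector_derivative_at_within[OF c]]
    show ?thesis by (simp add: \<gamma>_def \<gamma>'_def o_def)
  qed
  have "continuous_on {0..1} \<gamma>'"
    unfolding \<gamma>'_def by (intro continuous_intros continuous_on_compose2[OF cont]) auto
  then have "bounded (\<gamma>' ` {0..1})" by (intro compact_imp_bounded compact_continuous_image) auto
  then obtain L where "\<forall>x\<in>\<gamma>' ` {0..1}. norm x \<le> L" unfolding bounded_iff by blast
  then have L: "norm (\<gamma>' t) \<le> L" if "t \<in> {0..1}" for t using that by blast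
  have "abs_continuous_on_Icc 0 1 \<gamma>"
  proof (rule lipschitz_imp_abs_continuous)
    fix s t :: real assume st: "0 \<le> s" "s \<le> t" "t \<le> 1"
    have "norm (\<gamma> t - \<gamma> s) \<le> L * norm (t - s)"
    proof (rule differentiable_bound[where S = "{0..1}" and f' = "\<lambda>x h. h *\<^sub>R \<gamma>' x"])
      show "(\<gamma> has_derivative (\<lambda>h. h *\<^sub>R \<gamma>' x)) (at x within {0..1})" for x
        using d by (simp add: has_vector_derivative_def)
      show "onorm (\<lambda>h. h *\<^sub>R \<gamma>' x) \<le> L" if "x \<in> {0..1}" for x
      proof (rule onorm_le)
        show "norm (h *\<^sub>R \<gamma>' x) \<le> L * norm h" for h
          using mult_right_mono[OF L[OF that], of "norm h"] by (simp add: mult.commute)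
      qed
    qed (use st in auto)
    then show "dist (\<gamma> s) (\<gamma> t) \<le> L * (t - s)" using st by (simp add: dist_norm norm_minus_commute)
  qed
  moreover have "mc p (k *\<^sub>R w) $ 3 = k * mc p w $ 3" for p k w
    by (simp add: algebra_simps diff_divide_distrib)
  then have "mc (\<gamma> t) (\<gamma>' t) \<in> v0" for t
    using hor[of "a + t * (b - a)"] unfolding in_v0_iff \<gamma>_def \<gamma>'_def by simp
  ultimately show "horizontal_path \<gamma>"
    unfolding horizontal_path_def using d by (intro conjI AE_I2) blast+
  have vd: "vector_derivative \<gamma> (at t within {0..1}) = \<gamma>' t" if "t \<in> {0..1}" for t
    using that d by (intro vector_derivative_within_closed_interval) auto
  have "sr_length A \<gamma> = (LINT t:{0..1}|lebesgue. norm (sr_coords A (\<gamma>' t)))"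
    unfolding sr_length_def sr_norm_mc set_lebesgue_integral_def
    by (rule Bochner_Integration.integral_cong) (auto simp: vd indicator_def)
  also have "\<dots> \<le> (LINT t:{0..1::real}|lebesgue. (b - a) * l)"
    unfolding set_lebesgue_integral_def
  proof (rule Bochner_Integration.integral_mono')
    show "integrable lebesgue (\<lambda>t::real. indicat_real {0..1} t *\<^sub>R ((b - a) * l))"
      by (simp add: lmeasurable_iff_integrable[symmetric])
    have "norm (sr_coords A (\<gamma>' t)) \<le> (b - a) * l" for t
      using speed ab by (simp add: \<gamma>'_def sr_coords_scaleR mult_left_mono)
    then show "indicat_real {0..1} t *\<^sub>R norm (sr_coords A (\<gamma>' t)) \<le> indicat_real {0..1} t *\<^sub>R ((b - a) * l)" for t :: real
      by (simp add: indicator_def)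
    have "0 \<le> l" using speed[of 0] norm_ge_zero order_trans by blast
    then show "0 \<le> indicat_real {0..1} t *\<^sub>R ((b - a) * l)" for t :: real
      using ab by (simp add: indicator_def)
  qed
  also have "\<dots> = integral {0..1::real} (\<lambda>t. (b - a) * l)"
    by (intro set_lebesgue_integral_eq_integral absolutely_integrable_on_const) simp
  also have "\<dots> = (b - a) * l" by simp
  finally show "sr_length A \<gamma> \<le> (b - a) * l" .
qed

text \<open>In the coordinates \<open>sr_coords A\<close> the curve is the sum of the segment from \<open>0\<close> to
  \<open>(x, y)\<close> and an ellipse with half axes \<open>R\<close>, \<open>S\<close>; the third coordinate at time \<open>1\<close> is then
  \<open>det (tilde A) R (\<pi> S - y)\<close>, which can be prescribed.\<close>

definition hcurve_plane :: "real \<Rightarrow> real \<Rightarrow> real \<Rightarrow> real \<Rightarrow> real \<Rightarrow> real^2" where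
  "hcurve_plane x y R S t = vector [t * x + R * (cos (2 * pi * t) - 1), t * y + S * sin (2 * pi * t)]"

text \<open>Primitive of half the cross product of \<open>hcurve_plane\<close> with its velocity,
  normalised to vanish at time 0.\<close>

definition hcurve_height :: "real \<Rightarrow> real \<Rightarrow> real \<Rightarrow> real \<Rightarrow> real \<Rightarrow> real" where
  "hcurve_height x y R S t = pi * R * S * t - R * S * sin (2 * pi * t) / 2
     + R * y * (sin (2 * pi * t) / (2 * pi) - t) / 2 + S * x * t * sin (2 * pi * t) / 2
     + S * x * (cos (2 * pi * t) - 1) / (2 * pi) - R * y * t * cos (2 * pi * t) / 2
     + R * y * sin (2 * pi * t) / (4 * pi)"

definition hcurve_plane' :: "real \<Rightarrow> real \<Rightarrow> real \<Rightarrow> real \<Rightarrow> real \<Rightarrow> real^2" where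
  "hcurve_plane' x y R S t = vector [x - 2 * pi * R * sin (2 * pi * t), y + 2 * pi * S * cos (2 * pi * t)]"

lemma hcurve_height_deriv:
  "(hcurve_height x y R S has_real_derivative
     cross2 (hcurve_plane x y R S t) (hcurve_plane' x y R S t) / 2) (at t)"
proof -
  have sc: "sin (2 * pi * t) * sin (2 * pi * t) = 1 - cos (2 * pi * t) * cos (2 * pi * t)"
    using sin_cos_squared_add[of "2 * pi * t"] by (simp add: power2_eq_square)
  have "(hcurve_height x y R S has_real_derivative
     (pi * R * S - R * S * (2 * pi * cos (2 * pi * t)) / 2 + R * y * (cos (2 * pi * t) - 1) / 2
      + S * x * (sin (2 * pi * t) + t * (2 * pi * cos (2 * pi * t))) / 2
      - S * x * sin (2 * pi * t) - R * y * (cos (2 * pi * t) - t * (2 * pi * sin (2 * pi * t))) / 2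
      + R * y * cos (2 * pi * t) / 2)) (at t)"
    unfolding hcurve_height_def
    by (rule derivative_eq_intros refl | simp)+ (simp add: field_simps)
  moreover have "pi * R * S - R * S * (2 * pi * cos (2 * pi * t)) / 2 + R * y * (cos (2 * pi * t) - 1) / 2
      + S * x * (sin (2 * pi * t) + t * (2 * pi * cos (2 * pi * t))) / 2
      - S * x * sin (2 * pi * t) - R * y * (cos (2 * pi * t) - t * (2 * pi * sin (2 * pi * t))) / 2
      + R * y * cos (2 * pi * t) / 2 = cross2 (hcurve_plane x y R S t) (hcurve_plane' x y R S t) / 2"
    (is "?lhs = ?rhs")
  proof -
    define C Q where "C = cos (2 * pi * t)" "Q = sin (2 * pi * t)"
    have "C * C = 1 - Q * Q" using sc by (simp add: C_Q_def)
    moreover have "?lhs - ?rhs = pi * R * S * (1 - Q * Q - C * C)"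
      unfolding cross2_def hcurve_plane_def hcurve_plane'_def vector_2 C_Q_def[symmetric]
      by (simp add: field_simps)
    ultimately have "?lhs - ?rhs = 0" by simp
    then show ?thesis by (simp only: right_minus_eq)
  qed
  ultimately show ?thesis by (simp only:)
qed

definition hcurve :: "real^3^3 \<Rightarrow> real \<Rightarrow> real \<Rightarrow> real \<Rightarrow> real \<Rightarrow> real \<Rightarrow> real^3" where
  "hcurve A x y R S t = vector [(tilde A *v hcurve_plane x y R S t) $ 1,
     (tilde A *v hcurve_plane x y R S t) $ 2, det (tilde A) * hcurve_height x y R S t]"

lemma hcurve_0: "hcurve A x y R S 0 = 0"
  by (simp add: vec3_eq_iff hcurve_def hcurve_plane_def hcurve_height_def matrix_vector_mult_def sum_2)

text \<open>Half the cross product of the plane curve and its velocity, times the determinant, is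
  the vertical velocity that horizontality demands. Left translation by \<open>g\<close> preserves
  horizontality and the speed in \<open>sr_coords\<close>.\<close>

lemma hcurve_horizontal_path:
  assumes A: "A \<in> calA" and ab: "a \<le> b" and speed: "\<And>t. norm (hcurve_plane' x y R S t) \<le> l"
  shows "\<exists>\<gamma>. horizontal_path \<gamma> \<and> \<gamma> 0 = hmul g (hcurve A x y R S a) \<and> \<gamma> 1 = hmul g (hcurve A x y R S b)
    \<and> sr_length A \<gamma> \<le> (b - a) * l"
proof -
  define c where "c = hcurve A x y R S"
  define c' where "c' = (\<lambda>t. vector [(tilde A *v hcurve_plane' x y R S t) $ 1,
     (tilde A *v hcurve_plane' x y R S t) $ 2,
     det (tilde A) * (cross2 (hcurve_plane x y R S t) (hcurve_plane' x y R S t) / 2)] :: real^3)"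
  have c12: "vector [c t $ 1, c t $ 2] = tilde A *v hcurve_plane x y R S t"
    "vector [c' t $ 1, c' t $ 2] = tilde A *v hcurve_plane' x y R S t" for t
    by (simp_all add: c_def c'_def hcurve_def vec_eq_iff forall_2)
  have coords: "sr_coords A (c t) = hcurve_plane x y R S t" "sr_coords A (c' t) = hcurve_plane' x y R S t" for t
    using calA_inverse(4)[OF A] c12 by metis+
  have comp: "((\<lambda>t. c t $ i) has_real_derivative c' t $ i) (at t)" for t i
  proof -
    have "((\<lambda>t. c t $ 1) has_real_derivative c' t $ 1) (at t)"
      unfolding c_def c'_def hcurve_def hcurve_plane_def hcurve_plane'_def
      by (auto simp: matrix_vector_mult_def sum_2 algebra_simps intro!: derivative_eq_intros)
    moreover have "((\<lambda>t. c t $ 2) has_real_derivative c' t $ 2) (at t)"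
      unfolding c_def c'_def hcurve_def hcurve_plane_def hcurve_plane'_def
      by (auto simp: matrix_vector_mult_def sum_2 algebra_simps intro!: derivative_eq_intros)
    moreover have "((\<lambda>t. c t $ 3) has_real_derivative c' t $ 3) (at t)"
      using DERIV_cmult[OF hcurve_height_deriv] by (simp add: c_def c'_def hcurve_def)
    ultimately show ?thesis by (cases i rule: exhaust_3[THEN disjE]) auto
  qed
  have dc: "(c has_vector_derivative c' t) (at t)" for t
  proof -
    have "((\<lambda>s. c s $ i) has_derivative (\<lambda>h. h * c' t $ i)) (at t)" for i
      using comp[of i t] by (simp add: has_field_derivative_def mult_commute_abs)
    then show ?thesis
      unfolding has_vector_derivative_def has_derivative_componentwise_within[of c]
      by (auto simp: Basis_vec_def inner_axis)
  qed
  have cont: "continuous_on UNIV c'"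
  proof -
    have "continuous_on UNIV (\<lambda>t. c' t $ 1)"
      unfolding c'_def vector_3 hcurve_plane'_def
      by (simp add: matrix_vector_mult_def sum_2) (intro continuous_intros)
    moreover have "continuous_on UNIV (\<lambda>t. c' t $ 2)"
      unfolding c'_def vector_3 hcurve_plane'_def
      by (simp add: matrix_vector_mult_def sum_2) (intro continuous_intros)
    moreover have "continuous_on UNIV (\<lambda>t. c' t $ 3)"
      unfolding c'_def vector_3 hcurve_plane'_def hcurve_plane_def cross2_def vector_2
      by (intro continuous_intros) auto
    ultimately have "continuous_on UNIV (\<lambda>t. c' t $ i)" for i
      using exhaust_3[of i] by auto
    then have "continuous_on UNIV (\<lambda>t. \<chi> i. c' t $ i)" by (intro continuous_on_vec_lambda)
    then show ?thesis by simp
  qed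
  define k where "k = (\<lambda>t. hmul g (c t))"
  define k' where "k' = (\<lambda>t. c' t + (1/2) *\<^sub>R lie_bracket g (c' t))"
  have lin: "bounded_linear (\<lambda>w. w + (1/2) *\<^sub>R lie_bracket g w)"
    unfolding linear_conv_bounded_linear[symmetric]
    by (rule linearI) (simp_all add: lie_bracket_def algebra_simps)
  have "(k has_vector_derivative k' t) (at t)" for t
  proof -
    have "k = (\<lambda>t. g + (c t + (1/2) *\<^sub>R lie_bracket g (c t)))"
      by (simp add: k_def hmul_eq fun_eq_iff)
    moreover have "((\<lambda>t. g + (c t + (1/2) *\<^sub>R lie_bracket g (c t))) has_vector_derivative 0 + k' t) (at t)"
      unfolding k'_def
      by (intro has_vector_derivative_add has_vector_derivative_const
          bounded_linear.has_vector_derivative[OF lin] dc)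
    ultimately show ?thesis by simp
  qed
  moreover have "continuous_on UNIV k'"
    unfolding k'_def using lin cont by (rule bounded_linear.continuous_on)
  moreover have "mc (k t) (k' t) \<in> v0" for t
  proof -
    have "c' t $ 3 = (c t $ 1 * c' t $ 2 - c t $ 2 * c' t $ 1) / 2"
      unfolding cross_eq_det_cross2[OF A] coords by (simp add: c'_def)
    then show ?thesis by (simp add: in_v0_iff k_def k'_def field_simps)
  qed
  moreover have "norm (sr_coords A (k' t)) \<le> l" for t
  proof -
    have "sr_coords A (k' t) = sr_coords A (c' t)" by (rule sr_coords_cong) (simp_all add: k'_def)
    then show ?thesis using speed coords by simp
  qed
  ultimately show ?thesis using C1_horizontal_path[OF ab, of k k' A l] by (simp add: k_def c_def)
qed

section \<open>The systole of the Heisenberg manifold\<close>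

text \<open>Speed bound for an explicit curve from 0 to \<open>g\<close>: with \<open>R\<close> the
  square root and \<open>\<bar>S\<bar> \<le> \<bar>y\<bar> / pi + R\<close>, the sum
  \<open>\<bar>x\<bar> + 2 * pi * R + \<bar>y\<bar> + 2 * pi * \<bar>S\<bar>\<close> is at most
  \<open>\<bar>x\<bar> + 3 * \<bar>y\<bar> + 4 * pi * R\<close>. Its use is that it is continuous
  and vanishes at 0, so nearby points have small \<open>sr_dist\<close>.\<close>

definition hgauge :: "real^3^3 \<Rightarrow> real^3 \<Rightarrow> real" where
  "hgauge A g = \<bar>sr_coords A g $ 1\<bar> + 3 * \<bar>sr_coords A g $ 2\<bar> + 4 * pi * sqrt (\<bar>g $ 3\<bar> / (\<bar>det (tilde A)\<bar> * pi))"

lemma hcurve_1: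
  assumes A: "A \<in> calA" and x: "x = sr_coords A g $ 1" and y: "y = sr_coords A g $ 2"
    and z: "det (tilde A) * (R * (pi * S - y)) = g $ 3"
  shows "hcurve A x y R S 1 = g"
proof -
  have "hcurve_plane x y R S 1 = sr_coords A g"
    by (simp add: hcurve_plane_def x y vec_eq_iff forall_2)
  moreover have "hcurve_height x y R S 1 = R * (pi * S - y)"
    by (simp add: hcurve_height_def field_simps)
  ultimately show ?thesis
    using calA_inverse(3)[OF A, of g] z by (simp add: hcurve_def vec3_eq_iff)
qed

lemma horizontal_path_exists:
  assumes A: "A \<in> calA"
  shows "\<exists>\<gamma>. horizontal_path \<gamma> \<and> \<gamma> 0 = p \<and> \<gamma> 1 = q \<and> sr_length A \<gamma> \<le> hgauge A (hmul (- p) q)"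
proof -
  define g where "g = hmul (- p) q"
  define x y where "x = sr_coords A g $ 1" "y = sr_coords A g $ 2"
  define z where "z = g $ 3 / det (tilde A)"
  define R where "R = sqrt (\<bar>z\<bar> / pi)"
  \<comment> \<open>Solves \<open>R * (pi * S - y) = z\<close>: the summand \<open>y / pi\<close>
    cancels the contribution of the segment, and the sign of \<open>z\<close> orients the
    ellipse.\<close>
  define S where "S = y / pi + sgn z * R"
  have d: "det (tilde A) \<noteq> 0" by (rule calA_inverse(2)[OF A])
  have R: "R \<ge> 0" "R * R = \<bar>z\<bar> / pi" by (simp_all add: R_def)
  have "pi * S - y = pi * (sgn z * R)" by (simp add: S_def field_simps)
  then have "R * (pi * S - y) = sgn z * (pi * (R * R))" by simp
  also have "\<dots> = z" unfolding R(2) by (simp add: sgn_mult_abs)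
  finally have "hcurve A x y R S 1 = g"
    using d by (intro hcurve_1[OF A x_y_def]) (simp add: z_def)
  moreover have "norm (hcurve_plane' x y R S t) \<le> hgauge A g" for t
  proof -
    have RS: "\<bar>S\<bar> \<le> \<bar>y\<bar> / pi + R"
    proof -
      have "\<bar>sgn z * R\<bar> \<le> R" using R by (simp add: abs_mult sgn_real_def)
      moreover have "\<bar>S\<bar> \<le> \<bar>y / pi\<bar> + \<bar>sgn z * R\<bar>" unfolding S_def by (rule abs_triangle_ineq)
      ultimately show ?thesis by simp
    qed
    have sc: "\<bar>sin (2 * pi * t)\<bar> \<le> 1" "\<bar>cos (2 * pi * t)\<bar> \<le> 1" by simp_all
    have "norm (hcurve_plane' x y R S t) \<le> \<bar>x - 2 * pi * R * sin (2 * pi * t)\<bar> + \<bar>y + 2 * pi * S * cos (2 * pi * t)\<bar>"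
      using norm_le_l1_cart[of "hcurve_plane' x y R S t"] by (simp add: hcurve_plane'_def sum_2)
    also have "\<dots> \<le> (\<bar>x\<bar> + \<bar>2 * pi * R * sin (2 * pi * t)\<bar>) + (\<bar>y\<bar> + \<bar>2 * pi * S * cos (2 * pi * t)\<bar>)"
      by (intro add_mono abs_triangle_ineq abs_triangle_ineq4)
    also have "\<bar>2 * pi * R * sin (2 * pi * t)\<bar> \<le> 2 * pi * R"
      using mult_left_mono[OF sc(1), of "2 * pi * R"] R by (simp add: abs_mult)
    also have "\<bar>2 * pi * S * cos (2 * pi * t)\<bar> \<le> 2 * pi * \<bar>S\<bar>"
      using mult_left_mono[OF sc(2), of "2 * pi * \<bar>S\<bar>"] by (simp add: abs_mult)
    also have "2 * pi * \<bar>S\<bar> \<le> 2 * pi * (\<bar>y\<bar> / pi + R)" using RS by (intro mult_left_mono) auto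
    also have "\<dots> = 2 * \<bar>y\<bar> + 2 * pi * R" by (simp add: field_simps)
    also have "\<bar>x\<bar> + 2 * pi * R + (\<bar>y\<bar> + (2 * \<bar>y\<bar> + 2 * pi * R)) = hgauge A g"
      by (simp add: hgauge_def x_y_def[symmetric] R_def z_def)
    finally show ?thesis by simp
  qed
  from hcurve_horizontal_path[OF A zero_le_one this, of p]
  obtain \<gamma> where "horizontal_path \<gamma>" "\<gamma> 0 = hmul p (hcurve A x y R S 0)"
    "\<gamma> 1 = hmul p (hcurve A x y R S 1)" "sr_length A \<gamma> \<le> hgauge A g" by auto
  ultimately show ?thesis by (intro exI[of _ \<gamma>]) (simp add: hcurve_0 g_def)
qed

lemma sr_dist_le_hgauge: "A \<in> calA \<Longrightarrow> sr_dist A p q \<le> hgauge A (hmul (- p) q)"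
  using horizontal_path_exists[of A p q] sr_dist_le[of _ A] by fastforce

lemma sr_dist_nonneg: "A \<in> calA \<Longrightarrow> 0 \<le> sr_dist A p q"
  unfolding sr_dist_def
  using horizontal_path_exists[of A p q] sr_length_nonneg by (intro cInf_greatest) auto

lemma sr_dist_less_hchain:
  assumes "A \<in> calA" "sr_dist A p q < l" "e > 0"
  shows "hchain A e p q l"
  using sr_dist_less_imp_hchain[OF assms(1) _ assms(2,3)] horizontal_path_exists[OF assms(1), of p q] by blast

lemma continuous_on_hgauge: "continuous_on UNIV (hgauge A)"
proof -
  have "continuous_on UNIV (sr_coords A)"
    using linear_sr_coords by (rule linear_continuous_on_compose[OF continuous_on_id])
  then show ?thesis
    unfolding hgauge_def divide_inverse by (intro continuous_intros)
qed

lemma hgauge_0: "hgauge A 0 = 0"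
  by (simp add: hgauge_def)

lemma sr_dist_vertical:
  assumes A: "A \<in> calA"
  shows "sr_dist A 0 (k *\<^sub>R Z) = 2 * sqrt (pi * \<bar>k\<bar> / \<bar>det (tilde A)\<bar>)"
proof (rule antisym)
  let ?d = "det (tilde A)" and ?g = "k *\<^sub>R Z"
  have d: "?d \<noteq> 0" by (rule calA_inverse(2)[OF A])
  show "2 * sqrt (pi * \<bar>k\<bar> / \<bar>?d\<bar>) \<le> sr_dist A 0 ?g"
  proof (rule dense_ge)
    fix l assume l: "sr_dist A 0 ?g < l"
    then have "0 \<le> l" using sr_dist_nonneg[OF A, of 0 ?g] by linarith
    have "4 * pi * \<bar>?g $ 3\<bar> \<le> \<bar>?d\<bar> * l\<^sup>2"
      by (rule hchain_isoperimetric[OF A sr_dist_less_hchain[OF A l]]) simp_all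
    then have "4 * (pi * \<bar>k\<bar> / \<bar>?d\<bar>) \<le> l\<^sup>2" using d by (simp add: field_simps)
    then have "sqrt (4 * (pi * \<bar>k\<bar> / \<bar>?d\<bar>)) \<le> l" using \<open>0 \<le> l\<close> by (rule real_le_lsqrt[rotated])
    then show "2 * sqrt (pi * \<bar>k\<bar> / \<bar>?d\<bar>) \<le> l" unfolding real_sqrt_mult by simp
  qed
  \<comment> \<open>In orthonormal coordinates the extremal is a circle of area
    \<open>pi * R\<^sup>2 = \<bar>z\<bar>\<close>, oriented by the sign of \<open>z\<close>; its
    length \<open>2 * pi * R\<close> meets the isoperimetric bound.\<close>
  define z where "z = k / ?d"
  define R where "R = sqrt (\<bar>z\<bar> / pi)"
  have R: "R \<ge> 0" "R * R = \<bar>z\<bar> / pi" by (simp_all add: R_def)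
  have g0: "sr_coords A ?g = 0" using sr_coords_cong[of ?g 0 A] by simp
  have "R * (pi * (sgn z * R) - 0) = sgn z * (pi * (R * R))" by simp
  also have "\<dots> = z" unfolding R(2) by (simp add: sgn_mult_abs)
  finally have end1: "hcurve A 0 0 R (sgn z * R) 1 = ?g"
    using d by (intro hcurve_1[OF A]) (simp_all add: g0 z_def)
  have "norm (hcurve_plane' 0 0 R (sgn z * R) t) \<le> 2 * pi * R" for t
  proof -
    have "(norm (hcurve_plane' 0 0 R (sgn z * R) t))\<^sup>2
        = (2 * pi * R)\<^sup>2 * ((sin (2 * pi * t))\<^sup>2 + (sgn z)\<^sup>2 * (cos (2 * pi * t))\<^sup>2)"
      unfolding power2_norm_eq_inner
      by (simp add: hcurve_plane'_def inner_vec_def sum_2 power2_eq_square algebra_simps)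
    also have "\<dots> \<le> (2 * pi * R)\<^sup>2 * ((sin (2 * pi * t))\<^sup>2 + 1 * (cos (2 * pi * t))\<^sup>2)"
      by (intro mult_left_mono add_left_mono mult_right_mono) (auto simp: sgn_real_def)
    finally have "(norm (hcurve_plane' 0 0 R (sgn z * R) t))\<^sup>2 \<le> (2 * pi * R)\<^sup>2" by simp
    then show ?thesis by (rule power2_le_imp_le) (use R in simp)
  qed
  from hcurve_horizontal_path[OF A zero_le_one this, of 0]
  obtain \<gamma> where \<gamma>: "horizontal_path \<gamma>" "\<gamma> 0 = 0" "\<gamma> 1 = ?g" "sr_length A \<gamma> \<le> 2 * pi * R"
    unfolding hcurve_0 end1 by auto
  have "sr_dist A 0 ?g \<le> 2 * pi * R" using sr_dist_le[OF \<gamma>(1), of A] \<gamma> by simp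
  also have "\<dots> = 2 * (sqrt (pi\<^sup>2) * R)" by simp
  also have "sqrt (pi\<^sup>2) * R = sqrt (pi\<^sup>2 * (\<bar>z\<bar> / pi))" unfolding R_def real_sqrt_mult ..
  also have "pi\<^sup>2 * (\<bar>z\<bar> / pi) = pi * \<bar>k\<bar> / \<bar>?d\<bar>" by (simp add: z_def power2_eq_square)
  finally show "sr_dist A 0 ?g \<le> 2 * sqrt (pi * \<bar>k\<bar> / \<bar>?d\<bar>)" .
qed

lemma s2_eq:
  assumes A: "A \<in> calA"
  shows "s2 A = 2 * sqrt (pi / \<bar>det (tilde A)\<bar>)"
proof -
  have d: "\<bar>det (tilde A)\<bar> > 0" using calA_inverse(2)[OF A] by simp
  have "pi / \<bar>det (tilde A)\<bar> \<le> pi * \<bar>real_of_int p\<bar> / \<bar>det (tilde A)\<bar>" if "p \<noteq> 0" for p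
  proof -
    have "1 \<le> \<bar>p\<bar>" using that by linarith
    then have "1 \<le> \<bar>real_of_int p\<bar>" by linarith
    then have "pi * 1 \<le> pi * \<bar>real_of_int p\<bar>" by (intro mult_left_mono) auto
    then show ?thesis using d by (simp add: divide_right_mono)
  qed
  then have le: "2 * sqrt (pi / \<bar>det (tilde A)\<bar>) \<le> 2 * sqrt (pi * \<bar>real_of_int p\<bar> / \<bar>det (tilde A)\<bar>)"
    if "p \<noteq> 0" for p using that by simp
  show ?thesis
    unfolding s2_def hexp_def sr_dist_vertical[OF A]
  proof (rule Least_equality)
    show "2 * sqrt (pi / \<bar>det (tilde A)\<bar>) \<in>
        (\<lambda>p. 2 * sqrt (pi * \<bar>real_of_int p\<bar> / \<bar>det (tilde A)\<bar>)) ` (- {0})"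
      by (rule image_eqI[of _ _ 1]) auto
  qed (use le in blast)
qed

section \<open>Lower bound for the systole\<close>

text \<open>The displacement \<open>hmul (- p) (hmul \<gamma> p)\<close> depends on \<open>p\<close>
  only in its third coordinate, and not at all for central \<open>\<gamma>\<close>. So the
  projection bound and the isoperimetric bound apply at every base point.\<close>

lemma hchain_lattice_lower_bound:
  assumes A: "A \<in> calA" and r: "r > 0" and \<gamma>: "\<gamma> \<in> Gamma_r r" "\<gamma> \<noteq> 0"
    and ch: "\<And>e. e > 0 \<Longrightarrow> hchain A e p (hmul \<gamma> p) l"
  shows "min (s1 r A) (s2 A) \<le> l"
proof -
  obtain a b k where lat: "\<gamma> = lat r a b k" using \<gamma> by (auto simp: Gamma_r_eq)
  have d: "\<bar>det (tilde A)\<bar> > 0" using calA_inverse(2)[OF A] by simp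
  have l: "0 \<le> l" using ch[of 1] hchain_nonneg by auto
  show ?thesis
  proof (cases "a = 0 \<and> b = 0")
    case True
    then have k: "\<bar>k\<bar> \<ge> 1" using \<gamma>(2) lat_eq_0_iff[OF r] lat by force
    have q: "hmul (- p) (hmul \<gamma> p) = of_int k *\<^sub>R Z" using True by (simp add: lat vec3_eq_iff)
    have "hchain A e 0 (of_int k *\<^sub>R Z) l" if "e > 0" for e
      using hchain_left_mult[OF ch[OF that], of "- p"] unfolding q by simp
    from hchain_isoperimetric[OF A this] have "4 * pi * \<bar>real_of_int k\<bar> \<le> \<bar>det (tilde A)\<bar> * l\<^sup>2" by simp
    moreover have "1 \<le> \<bar>real_of_int k\<bar>" using k by linarith
    then have "4 * pi * 1 \<le> 4 * pi * \<bar>real_of_int k\<bar>" by (intro mult_left_mono) auto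
    ultimately have "4 * pi \<le> \<bar>det (tilde A)\<bar> * l\<^sup>2" by linarith
    then have "4 * (pi / \<bar>det (tilde A)\<bar>) \<le> l\<^sup>2" using d by (simp add: field_simps)
    then have "sqrt (4 * (pi / \<bar>det (tilde A)\<bar>)) \<le> l" using l by (rule real_le_lsqrt[rotated])
    then have "s2 A \<le> l" unfolding s2_eq[OF A] real_sqrt_mult by simp
    then show ?thesis by simp
  next
    case False
    have "norm (sr_coords A (hmul \<gamma> p - p)) \<le> l" using hchain_projection[OF ch[of 1]] by simp
    also have "sr_coords A (hmul \<gamma> p - p) = base_vec A r a b"
      unfolding base_vec_lat[of A r a b k] lat by (rule sr_coords_cong) simp_all
    finally have "norm (base_vec A r a b) \<le> l" .
    moreover have "s1 r A \<le> norm (base_vec A r a b)" using s1_attained[OF A r] False by metis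
    ultimately show ?thesis by simp
  qed
qed

lemma quot_dist_le:
  assumes "A \<in> calA"
  shows "quot_dist A (proj r p) (proj r q) \<le> sr_dist A p q"
  unfolding quot_dist_def
proof (rule cInf_lower)
  show "bdd_below {sr_dist A p' q' |p' q'. p' \<in> proj r p \<and> q' \<in> proj r q}"
    by (rule bdd_belowI[of _ 0]) (use sr_dist_nonneg[OF assms] in blast)
qed (use self_in_proj in blast)

lemma quot_dist_nonneg:
  assumes "A \<in> calA"
  shows "0 \<le> quot_dist A (proj r p) (proj r q)"
  unfolding quot_dist_def
proof (rule cInf_greatest)
  show "{sr_dist A p' q' |p' q'. p' \<in> proj r p \<and> q' \<in> proj r q} \<noteq> {}" using self_in_proj by blast
qed (use sr_dist_nonneg[OF assms] in blast)

text \<open>Below half of the lower bound for displacements by lattice elements the quotient map is an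
  isometry as far as chains are concerned.\<close>

lemma quot_dist_less_hchain:
  assumes A: "A \<in> calA" and r: "r > 0" and l: "quot_dist A (proj r p) (proj r q) < l"
    and close: "sr_dist A p q < h" and sum: "h + l < min (s1 r A) (s2 A)" and e: "e > 0"
  shows "hchain A e p q l"
proof -
  have "{sr_dist A p' q' |p' q'. p' \<in> proj r p \<and> q' \<in> proj r q} \<noteq> {}" using self_in_proj by blast
  from cInf_lessD[OF this l[unfolded quot_dist_def]]
  obtain p' q' where pq': "p' \<in> proj r p" "q' \<in> proj r q" "sr_dist A p' q' < l" by blast
  obtain g where g: "g \<in> Gamma_r r" "p' = hmul g p" using pq'(1) by (auto simp: proj_eq)
  obtain h' where h': "h' \<in> Gamma_r r" "q' = hmul h' q" using pq'(2) by (auto simp: proj_eq)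
  define \<gamma> where "\<gamma> = hmul (- g) h'"
  have \<gamma>: "\<gamma> \<in> Gamma_r r" using g h' Gamma_closed by (simp add: \<gamma>_def)
  have ch: "hchain A e p (hmul \<gamma> q) l" if "e > 0" for e
    using hchain_left_mult[OF sr_dist_less_hchain[OF A pq'(3) that], of "- g"]
    by (simp add: g h' \<gamma>_def hmul_assoc)
  have "\<gamma> = 0"
  proof (rule ccontr)
    assume "\<gamma> \<noteq> 0"
    \<comment> \<open>The way from \<open>q\<close> back to \<open>p\<close> and on to
      \<open>hmul \<gamma> q\<close> would be too short for a nontrivial lattice
      displacement.\<close>
    have "hchain A e q (hmul \<gamma> q) (h + l)" if "e > 0" for e
      by (rule hchain_trans[OF ch[OF that] hchain_sym[OF sr_dist_less_hchain[OF A close that]]])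
    from hchain_lattice_lower_bound[OF A r \<gamma> \<open>\<gamma> \<noteq> 0\<close> this] sum show False by simp
  qed
  then show ?thesis using ch[OF e] by simp
qed

text \<open>A shorter curve is cut so finely that consecutive points of its lift are closer than the
  slack. Each quotient distance is then realised by a chain between the lifted points themselves,
  and these chains concatenate to one from \<open>g 0\<close> to \<open>hmul \<gamma> (g 0)\<close>
  that is too short.\<close>

lemma curve_length_lower_bound:
  assumes A: "A \<in> calA" and r: "r > 0" and g: "continuous_on {0..1} g"
    and c: "\<And>t. t \<in> {0..1} \<Longrightarrow> proj r (g t) = c t"
    and \<gamma>: "\<gamma> \<in> Gamma_r r" "\<gamma> \<noteq> 0" "g 1 = hmul \<gamma> (g 0)"
  shows "ereal (min (s1 r A) (s2 A)) \<le> curve_length (quot_dist A) c"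
proof (rule ccontr)
  define m where "m = min (s1 r A) (s2 A)"
  assume "\<not> ereal (min (s1 r A) (s2 A)) \<le> curve_length (quot_dist A) c"
  then have "curve_length (quot_dist A) c < ereal m" unfolding m_def by (simp only: not_le)
  then obtain \<rho> where \<rho>: "curve_length (quot_dist A) c < ereal \<rho>" "\<rho> < m"
    using ereal_dense2 by (metis ereal_less_eq(3) less_ereal.simps(1))
  \<comment> \<open>Closeness in \<open>sr_dist\<close> is read off its majorant
    \<open>hgauge\<close> at \<open>(s, t)\<close>, compared with the value 0 at
    \<open>(s, s)\<close>.\<close>
  have "continuous_on ({0..1} \<times> {0..1}) (\<lambda>x. hgauge A (hmul (- g (fst x)) (g (snd x))))"
    by (intro continuous_on_compose2[OF continuous_on_hgauge] continuous_intros
        continuous_on_compose2[OF g]) auto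
  then have "uniformly_continuous_on ({0..1} \<times> {0..1}) (\<lambda>x. hgauge A (hmul (- g (fst x)) (g (snd x))))"
    by (rule compact_uniformly_continuous) (intro compact_Times compact_Icc)
  then obtain \<eta> where \<eta>: "\<eta> > 0" "\<And>x y. x \<in> {0..1} \<times> {0..1} \<Longrightarrow> y \<in> {0..1} \<times> {0..1} \<Longrightarrow> dist y x < \<eta> \<Longrightarrow>
     dist (hgauge A (hmul (- g (fst y)) (g (snd y)))) (hgauge A (hmul (- g (fst x)) (g (snd x)))) < (m - \<rho>) / 2"
    unfolding uniformly_continuous_on_def using \<rho>(2) by (metis diff_gt_0_iff_gt half_gt_zero)
  have close: "sr_dist A (g s) (g t) < (m - \<rho>) / 2" if "s \<in> {0..1}" "t \<in> {0..1}" "dist t s < \<eta>" for s t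
  proof -
    have "dist (hgauge A (hmul (- g s) (g t))) (hgauge A (hmul (- g s) (g s))) < (m - \<rho>) / 2"
      using \<eta>(2)[of "(s, s)" "(s, t)"] that by (simp add: dist_Pair_Pair)
    then show ?thesis using sr_dist_le_hgauge[OF A, of "g s" "g t"] by (simp add: hgauge_0 dist_real_def)
  qed
  obtain n :: nat where n: "n > 0" "1 / n < \<eta>"
    using \<eta>(1) by (metis reals_Archimedean inverse_eq_divide of_nat_Suc zero_less_Suc)
  define t where "t = (\<lambda>i::nat. real i / real n)"
  have t: "t i \<in> {0..1}" if "i \<le> n" for i using that n by (simp add: t_def)
  define q where "q = (\<lambda>i. quot_dist A (proj r (g (t i))) (proj r (g (t (Suc i)))))"
  have "ereal (\<Sum>i<n. quot_dist A (c (t i)) (c (t (Suc i)))) \<le> curve_length (quot_dist A) c"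
    unfolding curve_length_def
    by (rule Sup_upper) (use n in \<open>auto simp: t_def divide_right_mono intro!: exI[of _ n] exI[of _ t]\<close>)
  also have "(\<Sum>i<n. quot_dist A (c (t i)) (c (t (Suc i)))) = (\<Sum>i<n. q i)"
    using c t by (intro sum.cong) (auto simp: q_def)
  finally have "ereal (\<Sum>i<n. q i) < ereal \<rho>" using \<rho>(1) by (rule le_less_trans)
  then have q_sum: "(\<Sum>i<n. q i) < \<rho>" by simp
  have q_nonneg: "0 \<le> q i" for i unfolding q_def by (rule quot_dist_nonneg[OF A])
  \<comment> \<open>Over \<open>n\<close> steps these surpluses use a quarter of the slack
    \<open>m - \<rho>\<close>. With half of it spent on closeness,
    \<open>(m - \<rho>) / 2 + \<rho> + (m - \<rho>) / 4\<close> is still below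
    \<open>m\<close>.\<close>
  define \<epsilon> where "\<epsilon> = (m - \<rho>) / (4 * n)"
  have \<epsilon>: "\<epsilon> > 0" using \<rho> n by (simp add: \<epsilon>_def)
  have step: "hchain A e (g (t i)) (g (t (Suc i))) (q i + \<epsilon>)" if i: "i < n" and e: "e > 0" for i e
  proof (rule quot_dist_less_hchain[OF A r _ _ _ e])
    show "quot_dist A (proj r (g (t i))) (proj r (g (t (Suc i)))) < q i + \<epsilon>"
      using \<epsilon> by (simp add: q_def)
    have "dist (t (Suc i)) (t i) = 1 / n" by (simp add: t_def dist_real_def diff_divide_distrib[symmetric])
    then show "sr_dist A (g (t i)) (g (t (Suc i))) < (m - \<rho>) / 2"
      using i n t by (intro close) auto
    have "q i \<le> (\<Sum>i<n. q i)" using i q_nonneg by (intro member_le_sum) auto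
    moreover have "\<epsilon> \<le> (m - \<rho>) / 4"
      using \<rho>(2) n unfolding \<epsilon>_def by (intro divide_left_mono) auto
    ultimately have "(m - \<rho>) / 2 + (q i + \<epsilon>) < m"
      using q_sum \<rho>(2) by (simp add: field_simps)
    then show "(m - \<rho>) / 2 + (q i + \<epsilon>) < min (s1 r A) (s2 A)"
      by (simp only: m_def)
  qed
  have "hchain A e (g 0) (g (t i)) (\<Sum>j<i. q j + \<epsilon>)" if "i \<le> n" "e > 0" for i e
    using that(1)
  proof (induction i)
    case 0
    then show ?case by (simp add: t_def hchain_refl)
  next
    case (Suc i)
    then show ?case using hchain_trans[OF step[of i e]] that(2) by simp
  qed
  from this[of n] have "hchain A e (g 0) (hmul \<gamma> (g 0)) ((\<Sum>j<n. q j) + n * \<epsilon>)" if "e > 0" for e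
    using that n \<gamma>(3) by (simp add: t_def sum.distrib)
  from hchain_lattice_lower_bound[OF A r \<gamma>(1,2) this] have "m \<le> (\<Sum>j<n. q j) + n * \<epsilon>"
    by (simp add: m_def)
  also have "n * \<epsilon> = (m - \<rho>) / 4" using n by (simp add: \<epsilon>_def)
  finally show False using q_sum \<rho>(2) by (simp add: field_simps)
qed

lemma systole_lower_bound:
  assumes A: "A \<in> calA" and r: "r > 0"
  shows "ereal (min (s1 r A) (s2 A)) \<le> sys r A"
  unfolding sys_def systole_def
proof (rule Inf_greatest, clarify)
  fix c assume c: "closed_curve (heis_manifold r) c"
    and nz: "homology_class (heis_manifold r) c \<noteq> \<one>\<^bsub>homology_group 1 (heis_manifold r)\<^esub>"
  have "continuous_map (top_of_set {0..1}) (heis_manifold r) c"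
    using c by (simp add: closed_curve_def pathin_def)
  from lift_to_Heisenberg[OF r _ this] obtain g where g: "continuous_on {0..1} g"
    "\<And>t. t \<in> {0..1} \<Longrightarrow> proj r (g t) = c t" by auto
  have "proj r (g 0) = proj r (g 1)" using g(2)[of 0] g(2)[of 1] c by (simp add: closed_curve_def)
  then obtain \<gamma> where \<gamma>: "\<gamma> \<in> Gamma_r r" "g 1 = hmul \<gamma> (g 0)" by (auto simp: proj_eq_iff)
  have "\<gamma> \<noteq> 0"
    using null_homologous_if_lift_closed[OF g(1) _ g(2)] nz \<gamma> by auto
  then show "ereal (min (s1 r A) (s2 A)) \<le> curve_length (quot_dist A) c"
    using curve_length_lower_bound[OF A r g] \<gamma> by blast
qed

section \<open>Upper bounds by explicit loops\<close>

text \<open>Every arc has \<open>sr_length\<close> at most \<open>l\<close> times the elapsed time,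
  so each partition sum is bounded by a telescoping one. The base point \<open>p\<close> is left
  free for the sake of \<open>systole_le_s1\<close>.\<close>

lemma systole_upper_bound:
  assumes A: "A \<in> calA" and r: "r > 0"
    and speed: "\<And>t. norm (hcurve_plane' x y R S t) \<le> l"
    and final: "hmul p (hcurve A x y R S 1) = hmul (lat r a b k) p"
    and nz: "a \<noteq> 0 \<or> b \<noteq> 0 \<or> \<not> int r dvd k"
  shows "sys r A \<le> ereal l"
proof -
  define g where "g = (\<lambda>t. hmul p (hcurve A x y R S t))"
  define c where "c = (\<lambda>t. proj r (g t))"
  have "continuous_on UNIV (\<lambda>t. hcurve_height x y R S t)"
    by (rule DERIV_continuous_on[OF has_field_derivative_at_within[OF hcurve_height_deriv]])
  moreover have "continuous_on UNIV (\<lambda>t. (tilde A *v hcurve_plane x y R S t) $ i)" for i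
    unfolding hcurve_plane_def
    by (simp add: matrix_vector_mult_def sum_2) (intro continuous_intros)
  ultimately have "continuous_on UNIV (\<lambda>t. hcurve A x y R S t $ 1) \<and>
    continuous_on UNIV (\<lambda>t. hcurve A x y R S t $ 2) \<and> continuous_on UNIV (\<lambda>t. hcurve A x y R S t $ 3)"
    unfolding hcurve_def vector_3 by (simp add: continuous_on_mult_left)
  then have "continuous_on UNIV (\<lambda>t. hcurve A x y R S t $ i)" for i
    using exhaust_3[of i] by auto
  then have "continuous_on UNIV (\<lambda>t. \<chi> i. hcurve A x y R S t $ i)" by (intro continuous_on_vec_lambda)
  then have cont: "continuous_on UNIV g" unfolding g_def by (intro continuous_intros) simp
  have g01: "g 0 = p" "g 1 = hmul (lat r a b k) p" using final by (simp_all add: g_def hcurve_0)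
  have "continuous_map (top_of_set {0..1}) euclidean g" using cont continuous_on_subset by auto
  from continuous_map_compose[OF this continuous_map_proj[of r]]
  have "pathin (heis_manifold r) c" by (simp add: pathin_def c_def o_def)
  moreover have "c 0 = c 1" unfolding c_def g01 proj_eq_iff by blast
  ultimately have closed: "closed_curve (heis_manifold r) c" by (simp add: closed_curve_def)
  have "homology_class (heis_manifold r) c \<noteq> \<one>\<^bsub>homology_group 1 (heis_manifold r)\<^esub>"
    unfolding c_def using cont g01 by (intro not_null_homologous[OF r _ _ nz]) (auto intro: continuous_on_subset)
  with closed have "sys r A \<le> curve_length (quot_dist A) c"
    unfolding sys_def systole_def by (intro Inf_lower) blast
  also have "\<dots> \<le> ereal l"
    unfolding curve_length_def
  proof (rule Sup_least, clarify)
    fix n :: nat and t :: "nat \<Rightarrow> real"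
    assume t: "t 0 = 0" "t n = 1" "\<forall>i<n. t i \<le> t (Suc i)"
    have "(\<Sum>i<n. quot_dist A (c (t i)) (c (t (Suc i)))) \<le> (\<Sum>i<n. l * (t (Suc i) - t i))"
    proof (rule sum_mono)
      fix i assume "i \<in> {..<n}"
      then have ti: "t i \<le> t (Suc i)" using t by simp
      obtain \<gamma> where \<gamma>: "horizontal_path \<gamma>" "\<gamma> 0 = g (t i)" "\<gamma> 1 = g (t (Suc i))"
          "sr_length A \<gamma> \<le> (t (Suc i) - t i) * l"
        using hcurve_horizontal_path[OF A ti speed, of p] unfolding g_def by blast
      have "quot_dist A (c (t i)) (c (t (Suc i))) \<le> sr_dist A (\<gamma> 0) (\<gamma> 1)"
        unfolding c_def \<gamma> by (rule quot_dist_le[OF A])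
      also have "\<dots> \<le> (t (Suc i) - t i) * l" using sr_dist_le[OF \<gamma>(1), of A] \<gamma>(4) by linarith
      finally show "quot_dist A (c (t i)) (c (t (Suc i))) \<le> l * (t (Suc i) - t i)" by (simp add: mult.commute)
    qed
    also have "\<dots> = l" unfolding sum_distrib_left[symmetric] sum_lessThan_telescope t by simp
    finally show "ereal (\<Sum>i<n. quot_dist A (c (t i)) (c (t (Suc i)))) \<le> ereal l" by simp
  qed
  finally show ?thesis .
qed

lemma systole_le_s1:
  assumes A: "A \<in> calA" and r: "r > 0"
  shows "sys r A \<le> ereal (s1 r A)"
proof -
  obtain a b where ab: "\<not> (a = 0 \<and> b = 0)" "s1 r A = norm (base_vec A r a b)"
    by (rule s1_attained[OF A r]) blast
  define v :: "real^3" where "v = vector [real r * of_int a, of_int b, 0]"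
  \<comment> \<open>Conjugation by this point removes the height \<open>r * a * b / 2\<close> of
    \<open>lat r a b 0\<close> and leaves the horizontal vector \<open>v\<close>, so a straight
    segment suffices.\<close>
  define p :: "real^3" where "p = vector [real r * of_int a / 2, 0, 0]"
  have bv: "base_vec A r a b = sr_coords A v"
    unfolding base_vec_lat[of A r a b 0] by (rule sr_coords_cong) (simp_all add: v_def)
  let ?x = "sr_coords A v $ 1" and ?y = "sr_coords A v $ 2"
  have "hcurve A ?x ?y 0 0 1 = v"
    by (rule hcurve_1[OF A]) (simp_all add: v_def)
  then have "hmul p (hcurve A ?x ?y 0 0 1) = hmul (lat r a b 0) p"
    by (simp add: vec3_eq_iff v_def p_def)
  moreover have "hcurve_plane' ?x ?y 0 0 t = sr_coords A v" for t
    by (simp add: hcurve_plane'_def vec_eq_iff forall_2)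
  ultimately show ?thesis
    using ab by (intro systole_upper_bound[OF A r, of ?x ?y 0 0 _ p a b 0]) (auto simp: bv)
qed

lemma systole_le_s2:
  assumes A: "A \<in> calA" and r: "r > 1"
  shows "sys r A \<le> ereal (s2 A)"
proof -
  let ?d = "det (tilde A)"
  have d: "?d \<noteq> 0" by (rule calA_inverse(2)[OF A])
  \<comment> \<open>Radius of the circle with \<open>pi * R\<^sup>2 * \<bar>?d\<bar> = 1\<close>;
    below, the factor \<open>sgn ?d\<close> orients it so that the lift ends in \<open>Z\<close> and
    not in \<open>- Z\<close>.\<close>
  define R where "R = sqrt (1 / (\<bar>?d\<bar> * pi))"
  have R: "R \<ge> 0" "R * R = 1 / (\<bar>?d\<bar> * pi)" by (simp_all add: R_def)
  have "?d * (R * (pi * (sgn ?d * R) - 0)) = (?d * sgn ?d) * (pi * (R * R))" by simp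
  also have "\<dots> = 1" unfolding R(2) using d by (simp add: mult_sgn_abs abs_sgn[symmetric])
  finally have "hcurve A 0 0 R (sgn ?d * R) 1 = Z"
    using sr_coords_cong[of Z 0 A] by (intro hcurve_1[OF A]) simp_all
  then have fin: "hmul 0 (hcurve A 0 0 R (sgn ?d * R) 1) = hmul (lat r 0 0 1) 0"
    by (simp add: vec3_eq_iff)
  have "norm (hcurve_plane' 0 0 R (sgn ?d * R) t) \<le> s2 A" for t
  proof -
    have s: "sgn ?d * sgn ?d = 1" using d by (simp add: sgn_real_def)
    have "(norm (hcurve_plane' 0 0 R (sgn ?d * R) t))\<^sup>2
        = (2 * pi)\<^sup>2 * (R * R) * ((sin (2 * pi * t))\<^sup>2 + (sgn ?d * sgn ?d) * (cos (2 * pi * t))\<^sup>2)"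
      unfolding power2_norm_eq_inner
      by (simp add: hcurve_plane'_def inner_vec_def sum_2 power2_eq_square algebra_simps)
    also have "(sin (2 * pi * t))\<^sup>2 + (sgn ?d * sgn ?d) * (cos (2 * pi * t))\<^sup>2 = 1"
      unfolding s by simp
    also have "(2 * pi)\<^sup>2 * (R * R) * 1 = (s2 A)\<^sup>2"
      unfolding R(2) s2_eq[OF A] using d by (simp add: power_mult_distrib power2_eq_square[of pi])
    finally have "(norm (hcurve_plane' 0 0 R (sgn ?d * R) t))\<^sup>2 \<le> (s2 A)\<^sup>2" by simp
    then show ?thesis by (rule power2_le_imp_le) (simp add: s2_eq[OF A])
  qed
  then show ?thesis
    using r by (intro systole_upper_bound[OF A _ _ fin]) auto
qed

section \<open>Popp's volume\<close>

text \<open>\<open>mc p\<close> is unipotent in these coordinates, so a left invariant form has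
  constant density.\<close>

lemma popp_coordinate_fields:
  "popp A p (axis 1 1) (axis 2 1) (axis 3 1) = inverse (delta A) * inverse (det (tilde A))"
proof -
  have "det (vector [mc p (axis 1 1), mc p (axis 2 1), mc p (axis 3 1)] :: real^3^3) = 1"
    unfolding det_3 vector_3 mc_nth by (simp add: axis_def)
  then show ?thesis by (simp add: popp_def)
qed

lemma delta_eq: "delta A = sqrt 2 * \<bar>det (tilde A)\<bar>"
proof -
  have "transpose (tilde A) ** J1 ** tilde A = det (tilde A) *\<^sub>R J1"
    by (simp add: vec_eq_iff forall_2 matrix_matrix_mult_def transpose_def sum_2 J1_def det_2 algebra_simps)
  moreover have "norm J1 = sqrt 2"
    by (simp add: norm_vec_def L2_set_def sum_2 J1_def)
  ultimately show ?thesis by (simp add: delta_def)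
qed

text \<open>Left translation is a linear shear of determinant 1 followed by a Euclidean
  translation.\<close>

lemma emeasure_left_translate:
  assumes S: "S \<in> sets borel" "emeasure lborel S < \<infinity>"
  shows "hmul g ` S \<in> sets borel" "emeasure lborel (hmul g ` S) = emeasure lborel S"
proof -
  have img: "hmul g ` T = hmul (- g) -` T" for T
    by (force simp: image_iff intro: bexI[of _ "hmul (- g) _"])
  have "hmul (- g) \<in> borel_measurable borel"
    by (intro borel_measurable_continuous_onI continuous_intros)
  from measurable_sets[OF this S(1)] show borel: "hmul g ` S \<in> sets borel"
    unfolding img by simp
  define L where "L = (\<lambda>w::real^3. w + (1/2) *\<^sub>R lie_bracket g w)"
  have L: "linear L"
    unfolding L_def by (rule linearI) (simp_all add: lie_bracket_def algebra_simps)
  have det: "det (matrix L) = 1"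
    by (simp add: det_3 matrix_def L_def axis_def)
  have hm: "hmul g ` S = (+) g ` L ` S" by (auto simp: hmul_eq L_def image_image add.assoc)
  have Sl: "S \<in> lmeasurable" using S by (auto simp: fmeasurable_def)
  have "measure lebesgue (hmul g ` S) = measure lebesgue S"
    unfolding hm measure_translation using measure_linear_image[OF L Sl] det by simp
  moreover have "hmul g ` S \<in> lmeasurable"
    unfolding hm using measurable_linear_image[OF L Sl] by (simp add: measurable_translation)
  ultimately have "emeasure lebesgue (hmul g ` S) = emeasure lebesgue S"
    using Sl by (simp add: emeasure_eq_measure2)
  then show "emeasure lborel (hmul g ` S) = emeasure lborel S"
    using borel S by simp
qed

text \<open>\<open>quot_integral\<close> integrates over an unspecified domain, hence this
  independence. \<open>F\<close> is cut into the countably many pieces \<open>P g\<close>, and their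
  translates by \<open>g\<close> tile \<open>F'\<close>.\<close>

lemma emeasure_fundamental_domain_eq:
  assumes F: "fundamental_domain (Gamma_r r) F" "fundamental_domain (Gamma_r r) F'"
    and fin: "emeasure lborel F < \<infinity>"
  shows "emeasure lborel F' = emeasure lborel F"
proof -
  let ?G = "Gamma_r r"
  have borel: "F \<in> sets borel" "F' \<in> sets borel" using F by (simp_all add: fundamental_domain_def)
  have ex: "\<exists>!g. g \<in> ?G \<and> hmul g p \<in> F" "\<exists>!g. g \<in> ?G \<and> hmul g p \<in> F'" for p
    using F by (simp_all add: fundamental_domain_def)
  define P where "P = (\<lambda>g. {p \<in> F. hmul g p \<in> F'})"
  have P_borel: "P g \<in> sets borel" for g
  proof -
    have "hmul g \<in> borel_measurable borel"
      by (intro borel_measurable_continuous_onI continuous_intros)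
    from measurable_sets[OF this borel(2)] have "F \<inter> hmul g -` F' \<in> sets borel"
      using borel by auto
    moreover have "P g = F \<inter> hmul g -` F'" by (auto simp: P_def)
    ultimately show ?thesis by simp
  qed
  have P_fin: "emeasure lborel (P g) < \<infinity>" for g
  proof -
    have "emeasure lborel (P g) \<le> emeasure lborel F"
      using borel by (intro emeasure_mono) (auto simp: P_def)
    then show ?thesis using fin by simp
  qed
  have "F = (\<Union>g\<in>?G. P g)"
  proof (intro equalityI subsetI)
    fix p assume "p \<in> F"
    moreover obtain g where "g \<in> ?G" "hmul g p \<in> F'" using ex(2)[of p] by blast
    ultimately show "p \<in> (\<Union>g\<in>?G. P g)" by (auto simp: P_def)
  qed (auto simp: P_def)
  moreover have "disjoint_family_on P ?G"
    unfolding disjoint_family_on_def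
  proof (intro ballI impI)
    fix g h assume gh: "g \<in> ?G" "h \<in> ?G" "g \<noteq> h"
    have False if "p \<in> P g" "p \<in> P h" for p
      using ex(2)[of p] that gh unfolding P_def by blast
    then show "P g \<inter> P h = {}" by blast
  qed
  then have "emeasure lborel (\<Union>g\<in>?G. P g) = (\<integral>\<^sup>+g. emeasure lborel (P g) \<partial>count_space ?G)"
    using countable_Gamma_r P_borel by (intro emeasure_UN_countable) auto
  ultimately have 1: "emeasure lborel F = (\<integral>\<^sup>+g. emeasure lborel (P g) \<partial>count_space ?G)"
    by (simp only:)
  have "F' = (\<Union>g\<in>?G. hmul g ` P g)"
  proof (intro equalityI subsetI)
    fix q assume q: "q \<in> F'"
    obtain g where g: "g \<in> ?G" "hmul g q \<in> F" using ex(1)[of q] by blast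
    have "hmul g q \<in> P (- g)" using g q by (simp add: P_def)
    then have "hmul (- g) (hmul g q) \<in> hmul (- g) ` P (- g)" by (rule imageI)
    then show "q \<in> (\<Union>g\<in>?G. hmul g ` P g)" using Gamma_closed(3)[OF g(1)] by auto
  qed (auto simp: P_def)
  moreover have "disjoint_family_on (\<lambda>g. hmul g ` P g) ?G"
    unfolding disjoint_family_on_def
  proof (intro ballI impI)
    fix g h assume gh: "g \<in> ?G" "h \<in> ?G" "g \<noteq> h"
    show "hmul g ` P g \<inter> hmul h ` P h = {}"
    proof (rule ccontr)
      assume "hmul g ` P g \<inter> hmul h ` P h \<noteq> {}"
      then obtain p q where pq: "p \<in> P g" "q \<in> P h" "hmul g p = hmul h q" by blast
      have "hmul (- g) (hmul g p) \<in> F" using pq(1) by (simp add: P_def)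
      moreover have "hmul (- h) (hmul g p) \<in> F" unfolding pq(3) using pq(2) by (simp add: P_def)
      moreover have "- g \<in> ?G" "- h \<in> ?G" using gh Gamma_closed(3) by auto
      ultimately have "- g = - h" using ex(1)[of "hmul g p"] by blast
      then show False using gh by simp
    qed
  qed
  then have "emeasure lborel (\<Union>g\<in>?G. hmul g ` P g) =
      (\<integral>\<^sup>+g. emeasure lborel (hmul g ` P g) \<partial>count_space ?G)"
    using countable_Gamma_r emeasure_left_translate(1)[OF P_borel P_fin]
    by (intro emeasure_UN_countable) auto
  ultimately have 2: "emeasure lborel F' = (\<integral>\<^sup>+g. emeasure lborel (hmul g ` P g) \<partial>count_space ?G)"
    by (simp only:)
  show ?thesis unfolding 1 2 emeasure_left_translate(2)[OF P_borel P_fin] ..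
qed

definition standard_domain :: "nat \<Rightarrow> (real^3) set" where
  "standard_domain r = {p. 0 \<le> p$1 \<and> p$1 < r \<and> 0 \<le> p$2 \<and> p$2 < 1 \<and> 0 \<le> p$3 \<and> p$3 < 1}"

lemma fundamental_domain_standard_domain:
  assumes r: "r > 0"
  shows "fundamental_domain (Gamma_r r) (standard_domain r)"
  unfolding fundamental_domain_def
proof (intro conjI allI)
  show "standard_domain r \<in> sets borel"
    unfolding standard_domain_def by measurable
  fix p :: "real^3"
  \<comment> \<open>The conditions are triangular: the first two fix \<open>a\<close> and
    \<open>b\<close> as integer parts, and these enter the one that fixes \<open>k\<close>.\<close>
  have mem: "hmul (lat r a b k) p \<in> standard_domain r \<longleftrightarrow>
      a = - \<lfloor>p$1 / r\<rfloor> \<and> b = - \<lfloor>p$2\<rfloor> \<and> k = - \<lfloor>p$3 + real r * of_int a * of_int b / 2 + (real r * of_int a * p$2 - of_int b * p$1) / 2\<rfloor>" for a b k :: int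
  proof -
    have "hmul (lat r a b k) p \<in> standard_domain r \<longleftrightarrow>
      (0 \<le> of_int a + p$1 / r \<and> of_int a + p$1 / r < 1) \<and> (0 \<le> of_int b + p$2 \<and> of_int b + p$2 < 1) \<and>
      (0 \<le> of_int k + (p$3 + real r * of_int a * of_int b / 2 + (real r * of_int a * p$2 - of_int b * p$1) / 2) \<and>
       of_int k + (p$3 + real r * of_int a * of_int b / 2 + (real r * of_int a * p$2 - of_int b * p$1) / 2) < 1)"
    proof -
      have "0 \<le> real r * of_int a + p$1 \<longleftrightarrow> 0 \<le> of_int a + p$1 / r" "real r * of_int a + p$1 < r \<longleftrightarrow> of_int a + p$1 / r < 1"
        using r by (simp_all add: field_simps)
      then show ?thesis by (simp add: standard_domain_def add_ac)
    qed
    moreover have "0 \<le> of_int i + x \<and> of_int i + x < 1 \<longleftrightarrow> i = - \<lfloor>x\<rfloor>" for i and x :: real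
      by linarith
    ultimately show ?thesis by (simp only:)
  qed
  define a b where "a = - \<lfloor>p$1 / r\<rfloor>" "b = - \<lfloor>p$2\<rfloor>"
  define k where "k = - \<lfloor>p$3 + real r * of_int a * of_int b / 2 + (real r * of_int a * p$2 - of_int b * p$1) / 2\<rfloor>"
  show "\<exists>!g. g \<in> Gamma_r r \<and> hmul g p \<in> standard_domain r"
  proof (rule ex1I[of _ "lat r a b k"])
    show "lat r a b k \<in> Gamma_r r \<and> hmul (lat r a b k) p \<in> standard_domain r"
      using mem[of a b k] by (simp add: a_b_def[symmetric] k_def[symmetric])
    fix g assume g: "g \<in> Gamma_r r \<and> hmul g p \<in> standard_domain r"
    then obtain a' b' k' where g': "g = lat r a' b' k'" by (auto simp: Gamma_r_eq)
    from g have "hmul (lat r a' b' k') p \<in> standard_domain r" by (simp only: g')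
    then have "a' = a" "b' = b" "k' = - \<lfloor>p$3 + real r * of_int a' * of_int b' / 2 + (real r * of_int a' * p$2 - of_int b' * p$1) / 2\<rfloor>"
      unfolding mem a_b_def by blast+
    then show "g = lat r a b k" by (simp only: g' k_def)
  qed
qed

lemma emeasure_standard_domain: "emeasure lborel (standard_domain r) = ennreal (real r)"
proof -
  define u :: "real^3" where "u = vector [real r, 1, 1]"
  have u: "u$1 = real r" "u$2 = 1" "u$3 = 1" by (simp_all add: u_def)
  have pos: "0 \<le> u $ i" for i using exhaust_3[of i] u by auto
  then have "cbox 0 u \<noteq> {}" by (simp add: interval_ne_empty_cart)
  then have "measure lborel (cbox 0 u) = (\<Prod>i\<in>UNIV. u $ i - 0 $ i)" by (rule content_cbox_cart)
  also have "\<dots> = real r" unfolding UNIV_3 by (simp add: u)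
  finally have "emeasure lborel (cbox 0 u) = ennreal (real r)"
    using emeasure_lborel_cbox_finite[of 0 u] by (subst emeasure_eq_ennreal_measure) auto
  moreover have "emeasure lborel (box 0 u) = emeasure lborel (cbox 0 u)"
    by (simp only: emeasure_lborel_box_eq emeasure_lborel_cbox_eq)
  moreover have sub: "box 0 u \<subseteq> standard_domain r" "standard_domain r \<subseteq> cbox 0 u"
    unfolding standard_domain_def using u by (auto simp: mem_box_cart forall_3)
  moreover have m: "standard_domain r \<in> sets lborel" unfolding standard_domain_def by measurable
  moreover have "emeasure lborel (box 0 u) \<le> emeasure lborel (standard_domain r)"
    using sub m by (intro emeasure_mono) auto
  moreover have "emeasure lborel (standard_domain r) \<le> emeasure lborel (cbox 0 u)"
    using sub by (intro emeasure_mono) auto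
  ultimately show ?thesis by simp
qed

lemma quot_integral_popp:
  assumes r: "r > 0"
  shows "quot_integral r (popp A) = real r * (inverse (delta A) * inverse (det (tilde A)))"
proof -
  define F where "F = (SOME F. fundamental_domain (Gamma_r r) F)"
  have F: "fundamental_domain (Gamma_r r) F"
    unfolding F_def using fundamental_domain_standard_domain[OF r] by (rule someI)
  have "emeasure lborel F = ennreal (real r)"
    using emeasure_fundamental_domain_eq[OF fundamental_domain_standard_domain[OF r] F]
    by (simp add: emeasure_standard_domain)
  then have "measure lborel F = real r" by (simp add: measure_def)
  moreover have "F \<in> sets lborel" using F by (simp add: fundamental_domain_def)
  ultimately show ?thesis
    unfolding quot_integral_def F_def[symmetric] popp_coordinate_fields
    by (simp add: set_lebesgue_integral_def)
qed

lemma abs_quot_integral_popp: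
  assumes r: "r > 0"
  shows "\<bar>quot_integral r (popp A)\<bar> = real r / (sqrt 2 * (det (tilde A))\<^sup>2)"
proof -
  define e where "e = \<bar>det (tilde A)\<bar>"
  have "\<bar>quot_integral r (popp A)\<bar> = real r * (inverse (sqrt 2 * e) * inverse e)"
    unfolding quot_integral_popp[OF r] delta_eq abs_mult abs_inverse abs_idempotent e_def by simp
  also have "\<dots> = real r / (sqrt 2 * e\<^sup>2)" by (simp add: divide_inverse power2_eq_square)
  finally show ?thesis by (simp add: e_def)
qed

section \<open>The systolic inequality\<close>

text \<open>The prefactor cancels everything in the volume except the determinant and leaves the
  scaling \<open>1 / sqrt d\<close> common to \<open>s2\<close> and the Hermite bound.\<close>

lemma powr_quarter_popp_volume:
  fixes d \<rho> :: real
  assumes "d > 0" "\<rho> > 0"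
  shows "(sqrt 2 / \<rho>) powr (1/4) * (\<rho> / (sqrt 2 * d\<^sup>2)) powr (1/4) = 1 / sqrt d"
proof -
  have "(sqrt 2 / \<rho>) powr (1/4) * (\<rho> / (sqrt 2 * d\<^sup>2)) powr (1/4)
      = (sqrt 2 / \<rho> * (\<rho> / (sqrt 2 * d\<^sup>2))) powr (1/4)"
    by (rule powr_mult[symmetric])
  also have "sqrt 2 / \<rho> * (\<rho> / (sqrt 2 * d\<^sup>2)) = 1 / d\<^sup>2"
    using assms by (simp add: field_simps)
  also have "\<dots> = d powr (-2)"
    using assms by (simp add: powr_minus divide_inverse)
  also have "(d powr (-2)) powr (1/4) = d powr (- (1/2))" by (simp add: powr_powr)
  also have "\<dots> = 1 / sqrt d"
    unfolding powr_minus powr_half_sqrt[OF less_imp_le[OF assms(1)]] by (rule inverse_eq_divide)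
  finally show ?thesis .
qed

lemma le_threshold_iff:
  "real r \<le> 4 * pi / C2\<^sup>2 \<longleftrightarrow> C2 * sqrt r \<le> 2 * sqrt pi"
  "4 * pi / C2\<^sup>2 \<le> real r \<longleftrightarrow> 2 * sqrt pi \<le> C2 * sqrt r"
proof -
  have C2: "C2 > 0" by (simp add: C2_def)
  have sq: "(C2 * sqrt r)\<^sup>2 = C2\<^sup>2 * r" "(2 * sqrt pi)\<^sup>2 = 4 * pi" by (simp_all add: power_mult_distrib)
  have "C2 * sqrt r \<le> 2 * sqrt pi \<longleftrightarrow> (C2 * sqrt r)\<^sup>2 \<le> (2 * sqrt pi)\<^sup>2"
    "2 * sqrt pi \<le> C2 * sqrt r \<longleftrightarrow> (2 * sqrt pi)\<^sup>2 \<le> (C2 * sqrt r)\<^sup>2"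
    using C2 by (intro power_mono_iff[symmetric]; simp)+
  then show "real r \<le> 4 * pi / C2\<^sup>2 \<longleftrightarrow> C2 * sqrt r \<le> 2 * sqrt pi"
    "4 * pi / C2\<^sup>2 \<le> real r \<longleftrightarrow> 2 * sqrt pi \<le> C2 * sqrt r"
    unfolding sq using C2 by (simp_all add: field_simps)
qed

text \<open>Guarantees \<open>r > 1\<close> in part (2), as \<open>systole_le_s2\<close>
  demands.\<close>

lemma threshold_greater_1: "1 < 4 * pi / C2\<^sup>2"
proof -
  have "C2\<^sup>2 = 2 / sqrt 3" by (simp add: C2_def)
  also have "\<dots> \<le> 2" by (simp add: field_simps)
  finally have "C2\<^sup>2 \<le> 2" .
  moreover have "C2\<^sup>2 > 0" by (simp add: C2_def)
  ultimately show ?thesis using pi_gt3 by (simp add: field_simps)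
qed

theorem theoremA2:
  shows "\<forall>r::nat. r > 0 \<longrightarrow> (\<exists>C::real. \<forall>A\<in>calA. rho A = 0 \<longrightarrow>
    (real r \<le> 4 * pi / C2\<^sup>2 \<longrightarrow>
       sys r A = ereal (s1 r A) \<and>
       sys r A \<le> ereal (C * \<bar>quot_integral r (popp A)\<bar> powr (1/4)) \<and>
       (sys r A = ereal (C * \<bar>quot_integral r (popp A)\<bar> powr (1/4)) \<longleftrightarrow>
          s1 r A = C2 * sqrt (real r * inverse \<bar>det (tilde A)\<bar>))) \<and>
    (real r \<ge> 4 * pi / C2\<^sup>2 \<longrightarrow>
       sys r A \<le> ereal (C * \<bar>quot_integral r (popp A)\<bar> powr (1/4)) \<and>
       (sys r A = ereal (C * \<bar>quot_integral r (popp A)\<bar> powr (1/4)) \<longleftrightarrow>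
          s1 r A \<ge> s2 A)))"
proof (intro allI impI)
  fix r :: nat assume r: "r > 0"
  \<comment> \<open>The minimum selects the Hermite bound below the threshold and \<open>s2\<close>
    above it; the two agree at the threshold, so one constant serves both parts.\<close>
  define C where "C = min (C2 * sqrt r) (2 * sqrt pi) * (sqrt 2 / real r) powr (1/4)"
  have main: "(real r \<le> 4 * pi / C2\<^sup>2 \<longrightarrow>
       sys r A = ereal (s1 r A) \<and>
       sys r A \<le> ereal (C * \<bar>quot_integral r (popp A)\<bar> powr (1/4)) \<and>
       (sys r A = ereal (C * \<bar>quot_integral r (popp A)\<bar> powr (1/4)) \<longleftrightarrow>
          s1 r A = C2 * sqrt (real r * inverse \<bar>det (tilde A)\<bar>))) \<and>
    (real r \<ge> 4 * pi / C2\<^sup>2 \<longrightarrow>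
       sys r A \<le> ereal (C * \<bar>quot_integral r (popp A)\<bar> powr (1/4)) \<and>
       (sys r A = ereal (C * \<bar>quot_integral r (popp A)\<bar> powr (1/4)) \<longleftrightarrow>
          s1 r A \<ge> s2 A))" if A: "A \<in> calA" for A
  proof -
    define d where "d = \<bar>det (tilde A)\<bar>"
    have d: "d > 0" using calA_inverse(2)[OF A] by (simp add: d_def)
    have vol: "C * \<bar>quot_integral r (popp A)\<bar> powr (1/4) = min (C2 * sqrt r) (2 * sqrt pi) / sqrt d"
    proof -
      have "\<bar>quot_integral r (popp A)\<bar> = real r / (sqrt 2 * d\<^sup>2)"
        unfolding abs_quot_integral_popp[OF r] by (simp add: d_def)
      then have "C * \<bar>quot_integral r (popp A)\<bar> powr (1/4) = min (C2 * sqrt r) (2 * sqrt pi) *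
          ((sqrt 2 / real r) powr (1/4) * (real r / (sqrt 2 * d\<^sup>2)) powr (1/4))"
        by (simp only: C_def mult.assoc)
      also have "(sqrt 2 / real r) powr (1/4) * (real r / (sqrt 2 * d\<^sup>2)) powr (1/4) = 1 / sqrt d"
        by (rule powr_quarter_popp_volume) (use d r in auto)
      finally show ?thesis by simp
    qed
    have X: "C2 * sqrt (real r * inverse \<bar>det (tilde A)\<bar>) = C2 * sqrt r / sqrt d"
      unfolding d_def[symmetric] divide_inverse[symmetric] real_sqrt_divide by simp
    have s1: "s1 r A \<le> C2 * sqrt r / sqrt d" using s1_systolic_inequality[OF A r] unfolding X .
    have s2: "s2 A = 2 * sqrt pi / sqrt d" unfolding s2_eq[OF A] d_def[symmetric] real_sqrt_divide by simp
    show ?thesis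
      unfolding X vol le_threshold_iff
    proof (intro conjI impI)
      assume le: "C2 * sqrt r \<le> 2 * sqrt pi"
      then have "C2 * sqrt r / sqrt d \<le> s2 A" unfolding s2 using d by (intro divide_right_mono) auto
      \<comment> \<open>Below the threshold even the Hermite bound lies under \<open>s2\<close>. The
        systole is thus pinned down by the lower bound and the straight loop, also for
        \<open>r = 1\<close>.\<close>
      then have "min (s1 r A) (s2 A) = s1 r A" using s1 by simp
      then have "ereal (s1 r A) \<le> sys r A" using systole_lower_bound[OF A r] by (simp only:)
      then show sys: "sys r A = ereal (s1 r A)" using systole_le_s1[OF A r] by simp
      have min: "min (C2 * sqrt r) (2 * sqrt pi) = C2 * sqrt r" using le by simp
      show "sys r A \<le> ereal (min (C2 * sqrt r) (2 * sqrt pi) / sqrt d)"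
        unfolding sys min using s1 by simp
      show "sys r A = ereal (min (C2 * sqrt r) (2 * sqrt pi) / sqrt d) \<longleftrightarrow> s1 r A = C2 * sqrt r / sqrt d"
        unfolding sys min by simp
    next
      assume ge: "2 * sqrt pi \<le> C2 * sqrt r"
      then have "4 * pi / C2\<^sup>2 \<le> real r" by (simp only: le_threshold_iff)
      then have "r > 1" using threshold_greater_1 by linarith
      have "sys r A \<le> ereal (min (s1 r A) (s2 A))"
        using systole_le_s1[OF A r] systole_le_s2[OF A \<open>r > 1\<close>] by (simp add: min_def)
      then have sys: "sys r A = ereal (min (s1 r A) (s2 A))"
        using systole_lower_bound[OF A r] by (rule antisym)
      have min: "min (C2 * sqrt r) (2 * sqrt pi) = 2 * sqrt pi" using ge by simp
      show "sys r A \<le> ereal (min (C2 * sqrt r) (2 * sqrt pi) / sqrt d)"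
        unfolding sys min s2[symmetric] by simp
      show "sys r A = ereal (min (C2 * sqrt r) (2 * sqrt pi) / sqrt d) \<longleftrightarrow> s2 A \<le> s1 r A"
        unfolding sys min s2[symmetric] by (auto simp: min_def)
    qed
  qed
  then show "\<exists>C::real. \<forall>A\<in>calA. rho A = 0 \<longrightarrow>
    (real r \<le> 4 * pi / C2\<^sup>2 \<longrightarrow>
       sys r A = ereal (s1 r A) \<and>
       sys r A \<le> ereal (C * \<bar>quot_integral r (popp A)\<bar> powr (1/4)) \<and>
       (sys r A = ereal (C * \<bar>quot_integral r (popp A)\<bar> powr (1/4)) \<longleftrightarrow>
          s1 r A = C2 * sqrt (real r * inverse \<bar>det (tilde A)\<bar>))) \<and>
    (real r \<ge> 4 * pi / C2\<^sup>2 \<longrightarrow>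
       sys r A \<le> ereal (C * \<bar>quot_integral r (popp A)\<bar> powr (1/4)) \<and>
       (sys r A = ereal (C * \<bar>quot_integral r (popp A)\<bar> powr (1/4)) \<longleftrightarrow>
          s1 r A \<ge> s2 A))"
    by blast
qed

end
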